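(* Let $T$ be a complete first-order theory with monster model $\mathbb{M}$, and let $\perp$ be a ternary relation $A \perp_M B$ between small sets over small models $M\prec\mathbb{M}$ satisfying invariance, monotonicity, full existence over models, full stationarity, and the generalized freedom axiom. Then $\perp$ satisfies the relative Kim's lemma if and only if $\perp^{K^{\perp}}$ is symmetric (i.e. for all models $M$ and sets $a,b$: $a\perp^{K^{\perp}}_M b$ iff $b\perp^{K^{\perp}}_M a$).
   Context: Axioms for $\perp$ (defined only over models): Invariance: whether $A\perp_M B$ holds depends only on $\mathrm{tp}(ABM)$. Monotonicity: $A\perp_M B$, $A_0\subseteq A$, $B_0\subseteq B$ imply $A_0\perp_M B_0$. Full existence over models: for any $a,B,M$ there is $a'\equiv_M a$ with $a'\perp_M B$. Full stationarity: $A\perp_M B$, $A'\perp_M B$, $A\equiv_M A'$ imply $A\equiv_{MB}A'$. A global type $p$ is $M$-invariant if whether $\varphi(x,b)\in p$ depends only on $\mathrm{tp}(b/M)$. An invariant Morley sequence over $M$ in an $M$-invariant global type $p$ is a sequence $(b_i)_{i\in I}$ with $b_i\models p|_{M b_{<i}}$. A $\perp$-Morley sequence over $M$ is an infinite sequence $(a_i)_{i\in I}$ with $a_i\equiv_M a_j$ for all $i,j$ and $a_i\perp_M a_{<i}$ for all $i$. Under the axioms above, for each type $p$ over $M$ there is a unique global extension $p^*$ such that $a\perp_M B$ whenever $a\models p^*|_{MB}$; $p^*$ is $M$-invariant, and $\perp$-Morley sequences in $p$ are exactly invariant Morley sequences in $p^*$. Generalized freedom axiom: whenever $M\prec M'\prec\mathbb{M}$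 and there is a $\perp$-Morley sequence over $M$ starting with $a$ which is indiscernible over $M'$, every $\perp$-Morley sequence over $M'$ starting with $a$ is also a $\perp$-Morley sequence over $M$. Kim-dividing order: for $M$-invariant global types $p,q$ with the same restriction $r$ to $M$, $p\geq q$ if for every formula $\varphi(x,b)$ with $b\models r$, whenever every (equivalently some) invariant Morley sequence over $M$ in $q$ starting with $b$ makes $\{\varphi(x,b_i)\}$ inconsistent, the same holds for Morley sequences in $p$. An $M$-invariant $p$ is least if it is $\leq$ every $M$-invariant global type with the same restriction to $M$. Relative Kim's lemma: for every model $M$ and type $p$ over $M$, $p^*$ is least in the Kim-dividing order among $M$-invariant global extensions of $p$. $\perp$-Kim-dividing: $\varphi(x,b)$ $\perp$-Kim-divides over $M$ if $\{\varphi(x,b_i)\}$ is inconsistent for some (any) $\perp$-Morley sequence $(b_i)$ over $M$ starting with $b$; $\perp$-Kim-forks if it implies a finite disjunction of such formulas; $a\perp^{K^{\perp}}_M b$ iff $\mathrm{tp}(a/Mb)$ has no $\perp$-Kim-forking formula. *)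

theory Defs
  imports Main
begin

unbundle cardinal_syntax

section \<open>First-order logic\<close>

record ('f, 'r) lang =
  funs :: "'f set"
  rels :: "'r set"
  fun_ar :: "'f \<Rightarrow> nat"
  rel_ar :: "'r \<Rightarrow> nat"

text \<open>
  Formulas are locally nameless: bound variables are de Bruijn indices, and the free variables are
  labelled by elements of an arbitrary type \<open>'v\<close>, so that variable tuples of any length are available.
  A formula in the variables \<open>'x\<close> with parameters from \<open>'a\<close> is a formula over \<open>'v = 'x + 'a\<close>.
\<close>

datatype (dead 'f, fv_term: 'v) fo_term =
    Bound nat
  | Free 'v
  | App 'f "('f, 'v) fo_term list"

datatype (dead 'f, dead 'r, fv: 'v) fo_formula =
    Equal "('f, 'v) fo_term" "('f, 'v) fo_term"
  | Rel 'r "('f, 'v) fo_term list"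
  | Neg "('f, 'r, 'v) fo_formula"
  | Conj "('f, 'r, 'v) fo_formula" "('f, 'r, 'v) fo_formula"
  | Ex "('f, 'r, 'v) fo_formula"

fun wf_term :: "('f, 'r) lang \<Rightarrow> nat \<Rightarrow> ('f, 'v) fo_term \<Rightarrow> bool" where
  "wf_term L n (Bound k) \<longleftrightarrow> k < n"
| "wf_term L n (Free v) \<longleftrightarrow> True"
| "wf_term L n (App f ts) \<longleftrightarrow> f \<in> funs L \<and> length ts = fun_ar L f \<and> (\<forall>t\<in>set ts. wf_term L n t)"

fun wf_formula :: "('f, 'r) lang \<Rightarrow> nat \<Rightarrow> ('f, 'r, 'v) fo_formula \<Rightarrow> bool" where
  "wf_formula L n (Equal s t) \<longleftrightarrow> wf_term L n s \<and> wf_term L n t"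
| "wf_formula L n (Rel r ts) \<longleftrightarrow> r \<in> rels L \<and> length ts = rel_ar L r \<and> (\<forall>t\<in>set ts. wf_term L n t)"
| "wf_formula L n (Neg \<phi>) \<longleftrightarrow> wf_formula L n \<phi>"
| "wf_formula L n (Conj \<phi> \<psi>) \<longleftrightarrow> wf_formula L n \<phi> \<and> wf_formula L n \<psi>"
| "wf_formula L n (Ex \<phi>) \<longleftrightarrow> wf_formula L (Suc n) \<phi>"

record ('f, 'r, 'a) struct =
  univ :: "'a set"
  ifun :: "'f \<Rightarrow> 'a list \<Rightarrow> 'a"
  irel :: "'r \<Rightarrow> 'a list \<Rightarrow> bool"

definition is_struct :: "('f, 'r) lang \<Rightarrow> ('f, 'r, 'a) struct \<Rightarrow> bool" where
  "is_struct L \<AA> \<longleftrightarrow> univ \<AA> \<noteq> {} \<and>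
     (\<forall>f\<in>funs L. \<forall>xs. length xs = fun_ar L f \<and> set xs \<subseteq> univ \<AA> \<longrightarrow> ifun \<AA> f xs \<in> univ \<AA>)"

primrec eval :: "('f, 'r, 'a) struct \<Rightarrow> ('v \<Rightarrow> 'a) \<Rightarrow> 'a list \<Rightarrow> ('f, 'v) fo_term \<Rightarrow> 'a" where
  "eval \<AA> \<rho> bs (Bound k) = bs ! k"
| "eval \<AA> \<rho> bs (Free v) = \<rho> v"
| "eval \<AA> \<rho> bs (App f ts) = ifun \<AA> f (map (eval \<AA> \<rho> bs) ts)"

primrec sat :: "('f, 'r, 'a) struct \<Rightarrow> ('v \<Rightarrow> 'a) \<Rightarrow> 'a list \<Rightarrow> ('f, 'r, 'v) fo_formula \<Rightarrow> bool" where
  "sat \<AA> \<rho> bs (Equal s t) \<longleftrightarrow> eval \<AA> \<rho> bs s = eval \<AA> \<rho> bs t"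
| "sat \<AA> \<rho> bs (Rel r ts) \<longleftrightarrow> irel \<AA> r (map (eval \<AA> \<rho> bs) ts)"
| "sat \<AA> \<rho> bs (Neg \<phi>) \<longleftrightarrow> \<not> sat \<AA> \<rho> bs \<phi>"
| "sat \<AA> \<rho> bs (Conj \<phi> \<psi>) \<longleftrightarrow> sat \<AA> \<rho> bs \<phi> \<and> sat \<AA> \<rho> bs \<psi>"
| "sat \<AA> \<rho> bs (Ex \<phi>) \<longleftrightarrow> (\<exists>x\<in>univ \<AA>. sat \<AA> \<rho> (x # bs) \<phi>)"

definition sentences :: "('f, 'r) lang \<Rightarrow> ('f, 'r, 'v) fo_formula set" where
  "sentences L = {\<phi>. wf_formula L 0 \<phi> \<and> fv \<phi> = {}}"

text \<open>Complete theories are taken to be deductively closed; consistency follows from having a model.\<close>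

definition complete_theory :: "('f, 'r) lang \<Rightarrow> ('f, 'r, 'v) fo_formula set \<Rightarrow> bool" where
  "complete_theory L T \<longleftrightarrow> T \<subseteq> sentences L \<and> (\<forall>\<phi>\<in>sentences L. \<phi> \<in> T \<or> Neg \<phi> \<in> T)"

definition models :: "('f, 'r, 'a) struct \<Rightarrow> ('f, 'r, 'v) fo_formula set \<Rightarrow> bool" where
  "models \<AA> T \<longleftrightarrow> (\<forall>\<phi>\<in>T. \<forall>\<rho>. range \<rho> \<subseteq> univ \<AA> \<longrightarrow> sat \<AA> \<rho> [] \<phi>)"

definition elem_substruct ::
    "('f, 'r) lang \<Rightarrow> ('f, 'r, 'a) struct \<Rightarrow> ('f, 'r, 'a) struct \<Rightarrow> bool" where
  "elem_substruct L \<AA> \<BB> \<longleftrightarrow> is_struct L \<AA> \<and> is_struct L \<BB> \<and> univ \<AA> \<subseteq> univ \<BB> \<and>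
     (\<forall>f\<in>funs L. \<forall>xs. length xs = fun_ar L f \<and> set xs \<subseteq> univ \<AA> \<longrightarrow> ifun \<AA> f xs = ifun \<BB> f xs) \<and>
     (\<forall>r\<in>rels L. \<forall>xs. length xs = rel_ar L r \<and> set xs \<subseteq> univ \<AA> \<longrightarrow> irel \<AA> r xs = irel \<BB> r xs) \<and>
     (\<forall>(\<phi> :: ('f, 'r, nat) fo_formula) \<rho>. wf_formula L 0 \<phi> \<and> range \<rho> \<subseteq> univ \<AA> \<longrightarrow>
        (sat \<AA> \<rho> [] \<phi> \<longleftrightarrow> sat \<BB> \<rho> [] \<phi>))"

definition automorphism :: "('f, 'r) lang \<Rightarrow> ('f, 'r, 'a) struct \<Rightarrow> ('a \<Rightarrow> 'a) \<Rightarrow> bool" where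
  "automorphism L \<AA> \<sigma> \<longleftrightarrow> bij_betw \<sigma> (univ \<AA>) (univ \<AA>) \<and>
     (\<forall>f\<in>funs L. \<forall>xs. length xs = fun_ar L f \<and> set xs \<subseteq> univ \<AA> \<longrightarrow>
        \<sigma> (ifun \<AA> f xs) = ifun \<AA> f (map \<sigma> xs)) \<and>
     (\<forall>r\<in>rels L. \<forall>xs. length xs = rel_ar L r \<and> set xs \<subseteq> univ \<AA> \<longrightarrow>
        (irel \<AA> r xs \<longleftrightarrow> irel \<AA> r (map \<sigma> xs)))"

definition formulas :: "('f, 'r) lang \<Rightarrow> 'x set \<Rightarrow> 'c set \<Rightarrow> ('f, 'r, 'x + 'c) fo_formula set" where
  "formulas L V C = {\<phi>. wf_formula L 0 \<phi> \<and> fv \<phi> \<subseteq> V <+> C}"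


section \<open>Types in a structure whose universe is the whole type\<close>

text \<open>
  A tuple with index set \<open>V\<close> is a function of which only the values on \<open>V\<close> matter;
  a subset \<open>A\<close> of the universe is enumerated by \<open>id\<close> on the index set \<open>A\<close>.
\<close>

definition holds :: "('f, 'r, 'a) struct \<Rightarrow> ('x \<Rightarrow> 'a) \<Rightarrow> ('f, 'r, 'x + 'a) fo_formula \<Rightarrow> bool" where
  "holds \<MM> a \<phi> \<longleftrightarrow> sat \<MM> (case_sum a id) [] \<phi>"

definition tp :: "('f, 'r) lang \<Rightarrow> ('f, 'r, 'a) struct \<Rightarrow> 'a set \<Rightarrow> 'x set \<Rightarrow> ('x \<Rightarrow> 'a)
    \<Rightarrow> ('f, 'r, 'x + 'a) fo_formula set" where
  "tp L \<MM> C V a = {\<phi> \<in> formulas L V C. holds \<MM> a \<phi>}"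

definition consistent :: "('f, 'r, 'a) struct \<Rightarrow> ('f, 'r, 'x + 'a) fo_formula set \<Rightarrow> bool" where
  "consistent \<MM> \<Phi> \<longleftrightarrow> (\<forall>\<Psi>\<subseteq>\<Phi>. finite \<Psi> \<longrightarrow> (\<exists>a. \<forall>\<psi>\<in>\<Psi>. holds \<MM> a \<psi>))"

definition type_over :: "('f, 'r) lang \<Rightarrow> ('f, 'r, 'a) struct \<Rightarrow> 'a set \<Rightarrow> 'x set
    \<Rightarrow> ('f, 'r, 'x + 'a) fo_formula set \<Rightarrow> bool" where
  "type_over L \<MM> C V p \<longleftrightarrow> p \<subseteq> formulas L V C \<and> consistent \<MM> p \<and>
     (\<forall>\<phi>\<in>formulas L V C. \<phi> \<in> p \<or> Neg \<phi> \<in> p)"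

abbreviation global_type :: "('f, 'r) lang \<Rightarrow> ('f, 'r, 'a) struct \<Rightarrow> 'x set
    \<Rightarrow> ('f, 'r, 'x + 'a) fo_formula set \<Rightarrow> bool" where
  "global_type L \<MM> \<equiv> type_over L \<MM> UNIV"

definition restrict_type ::
    "('f, 'r, 'x + 'a) fo_formula set \<Rightarrow> 'a set \<Rightarrow> ('f, 'r, 'x + 'a) fo_formula set" where
  "restrict_type p C = {\<phi> \<in> p. fv \<phi> \<subseteq> UNIV <+> C}"

text \<open>\<open>inst b \<phi>\<close> is \<open>\<phi>(x, b)\<close>, for a formula \<open>\<phi>(x, y)\<close> possibly with further parameters.\<close>

definition inst :: "('y \<Rightarrow> 'a) \<Rightarrow> ('f, 'r, 'x + ('y + 'a)) fo_formula \<Rightarrow> ('f, 'r, 'x + 'a) fo_formula" where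
  "inst b = map_fo_formula (map_sum id (case_sum b id))"

definition invariant_global_type :: "('f, 'r) lang \<Rightarrow> ('f, 'r, 'a) struct \<Rightarrow> 'a set \<Rightarrow> 'k set
    \<Rightarrow> ('f, 'r, 'k + 'a) fo_formula set \<Rightarrow> bool" where
  "invariant_global_type L \<MM> M V p \<longleftrightarrow> global_type L \<MM> V p \<and>
     (\<forall>(J :: 'k set) b b'. \<forall>\<phi>\<in>formulas L V (J <+> {}).
        tp L \<MM> M J b = tp L \<MM> M J b' \<longrightarrow> (inst b \<phi> \<in> p \<longleftrightarrow> inst b' \<phi> \<in> p))"


section \<open>Sequences of tuples\<close>

text \<open>
  \<open>R\<close> is a linear order on the index set \<open>Field R\<close>, and \<open>s i\<close> is the \<open>i\<close>-th tuple, with index set \<open>V\<close>.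
\<close>

definition before :: "'i rel \<Rightarrow> 'k set \<Rightarrow> ('i \<Rightarrow> 'k \<Rightarrow> 'a) \<Rightarrow> 'i \<Rightarrow> 'a set" where
  "before R V s i = (\<Union>j\<in>underS R i. s j ` V)"

definition starts_with :: "'i rel \<Rightarrow> 'k set \<Rightarrow> ('i \<Rightarrow> 'k \<Rightarrow> 'a) \<Rightarrow> ('k \<Rightarrow> 'a) \<Rightarrow> bool" where
  "starts_with R V s b \<longleftrightarrow> (\<exists>i\<in>Field R. (\<forall>j\<in>Field R. (i, j) \<in> R) \<and> (\<forall>v\<in>V. s i v = b v))"

definition increasing :: "'i rel \<Rightarrow> nat \<Rightarrow> (nat \<Rightarrow> 'i) \<Rightarrow> bool" where
  "increasing R n e \<longleftrightarrow> (\<forall>k<n. e k \<in> Field R) \<and> (\<forall>l<n. \<forall>k<l. e k \<in> underS R (e l))"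

definition indiscernible :: "('f, 'r) lang \<Rightarrow> ('f, 'r, 'a) struct \<Rightarrow> 'a set \<Rightarrow> 'k set \<Rightarrow> 'i rel
    \<Rightarrow> ('i \<Rightarrow> 'k \<Rightarrow> 'a) \<Rightarrow> bool" where
  "indiscernible L \<MM> C V R s \<longleftrightarrow>
     (\<forall>n e e'. increasing R n e \<and> increasing R n e' \<longrightarrow>
        tp L \<MM> C ({..<n} \<times> V) (\<lambda>(k, v). s (e k) v) = tp L \<MM> C ({..<n} \<times> V) (\<lambda>(k, v). s (e' k) v))"

definition consistent_along :: "('f, 'r, 'a) struct \<Rightarrow> 'i rel \<Rightarrow> ('i \<Rightarrow> 'k \<Rightarrow> 'a)
    \<Rightarrow> ('f, 'r, 'x + ('k + 'a)) fo_formula \<Rightarrow> bool" where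
  "consistent_along \<MM> R s \<phi> \<longleftrightarrow> consistent \<MM> ((\<lambda>i. inst (s i) \<phi>) ` Field R)"


section \<open>Monster models\<close>

text \<open>
  Small means of cardinality less than \<open>\<kappa>\<close>. The elements of \<open>'k\<close> serve as labels: every small set,
  and every linear order on a small set, has a copy on a subset of \<open>'k\<close>, so tuples and sequences
  indexed by subsets of \<open>'k\<close> are all small tuples and all small sequences up to reindexing.
\<close>

locale monster =
  fixes L :: "('f, 'r) lang"
    and T :: "('f, 'r, nat) fo_formula set"
    and \<kappa> :: "'k rel"
    and \<MM> :: "('f, 'r, 'a) struct"
  assumes Card_order_\<kappa>: "Card_order \<kappa>"
    and \<kappa>_uncountable: "natLeq <o \<kappa>"
    and funs_small: "|funs L| <o \<kappa>"
    and rels_small: "|rels L| <o \<kappa>"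
    and complete: "complete_theory L T"
    and universe: "univ \<MM> = UNIV"
    and model: "models \<MM> T"
    and saturated: "\<And>C (\<Phi> :: ('f, 'r, unit + 'a) fo_formula set).
          |C| <o \<kappa> \<Longrightarrow> \<Phi> \<subseteq> formulas L UNIV C \<Longrightarrow> consistent \<MM> \<Phi> \<Longrightarrow> \<exists>a. \<forall>\<phi>\<in>\<Phi>. holds \<MM> a \<phi>"
    and strongly_homogeneous: "\<And>A f. |A| <o \<kappa> \<Longrightarrow> tp L \<MM> {} A id = tp L \<MM> {} A f \<Longrightarrow>
          \<exists>\<sigma>. automorphism L \<MM> \<sigma> \<and> (\<forall>x\<in>A. \<sigma> x = f x)"
begin

definition small :: "'b set \<Rightarrow> bool" where
  "small A \<longleftrightarrow> |A| <o \<kappa>"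

definition sub :: "'a set \<Rightarrow> ('f, 'r, 'a) struct" where
  "sub M = \<MM>\<lparr>univ := M\<rparr>"

definition small_model :: "'a set \<Rightarrow> bool" where
  "small_model M \<longleftrightarrow> small M \<and> elem_substruct L (sub M) \<MM>"

definition sequence_order :: "'k rel \<Rightarrow> bool" where
  "sequence_order R \<longleftrightarrow> Linear_order R \<and> infinite (Field R) \<and> small (Field R)"

definition invariant_Morley :: "'a set \<Rightarrow> 'k set \<Rightarrow> ('f, 'r, 'k + 'a) fo_formula set \<Rightarrow> 'k rel
    \<Rightarrow> ('k \<Rightarrow> 'k \<Rightarrow> 'a) \<Rightarrow> bool" where
  "invariant_Morley M V p R s \<longleftrightarrow> sequence_order R \<and>
     (\<forall>i\<in>Field R. tp L \<MM> (M \<union> before R V s i) V (s i) = restrict_type p (M \<union> before R V s i))"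

text \<open>
  \<open>Kim_dividing_ge M V p q\<close> is \<open>p \<ge> q\<close>, for \<open>M\<close>-invariant global types \<open>p\<close> and \<open>q\<close> in the
  variables \<open>V\<close> with the same restriction to \<open>M\<close>.
\<close>

definition Kim_dividing_ge :: "'a set \<Rightarrow> 'k set \<Rightarrow> ('f, 'r, 'k + 'a) fo_formula set
    \<Rightarrow> ('f, 'r, 'k + 'a) fo_formula set \<Rightarrow> bool" where
  "Kim_dividing_ge M V p q \<longleftrightarrow>
     (\<forall>b. \<forall>\<phi> \<in> formulas L (UNIV :: 'k set) (V <+> M).
        tp L \<MM> M V b = restrict_type q M \<longrightarrow>
        (\<forall>R s. invariant_Morley M V q R s \<and> starts_with R V s b \<longrightarrow> \<not> consistent_along \<MM> R s \<phi>) \<longrightarrow>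
        (\<forall>R s. invariant_Morley M V p R s \<and> starts_with R V s b \<longrightarrow> \<not> consistent_along \<MM> R s \<phi>))"

definition least_Kim_dividing :: "'a set \<Rightarrow> 'k set \<Rightarrow> ('f, 'r, 'k + 'a) fo_formula set \<Rightarrow> bool" where
  "least_Kim_dividing M V p \<longleftrightarrow> invariant_global_type L \<MM> M V p \<and>
     (\<forall>q. invariant_global_type L \<MM> M V q \<and> restrict_type q M = restrict_type p M \<longrightarrow>
        Kim_dividing_ge M V q p)"

end


section \<open>Independence relations\<close>

text \<open>\<open>ind A M B\<close> stands for \<open>A \<bottom>\<^sub>M B\<close>; only its values on small sets over small models matter.\<close>

context monster
begin

text \<open>The tuple \<open>e\<close>, restricted to \<open>IA \<union> IM \<union> IB\<close>, enumerates \<open>A\<close>, \<open>M\<close> and \<open>B\<close> jointly.\<close>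

definition invariance :: "('a set \<Rightarrow> 'a set \<Rightarrow> 'a set \<Rightarrow> bool) \<Rightarrow> bool" where
  "invariance ind \<longleftrightarrow>
     (\<forall>(IA :: 'k set) IM IB e e'.
        small IA \<and> small IB \<and> small IM \<and> small_model (e ` IM) \<and> small_model (e' ` IM) \<and>
        tp L \<MM> {} (IA \<union> IM \<union> IB) e = tp L \<MM> {} (IA \<union> IM \<union> IB) e' \<longrightarrow>
        (ind (e ` IA) (e ` IM) (e ` IB) \<longleftrightarrow> ind (e' ` IA) (e' ` IM) (e' ` IB)))"

definition monotonicity :: "('a set \<Rightarrow> 'a set \<Rightarrow> 'a set \<Rightarrow> bool) \<Rightarrow> bool" where
  "monotonicity ind \<longleftrightarrow>
     (\<forall>M A B A0 B0. small_model M \<and> small A \<and> small B \<and> ind A M B \<and> A0 \<subseteq> A \<and> B0 \<subseteq> B \<longrightarrow>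
        ind A0 M B0)"

definition full_existence :: "('a set \<Rightarrow> 'a set \<Rightarrow> 'a set \<Rightarrow> bool) \<Rightarrow> bool" where
  "full_existence ind \<longleftrightarrow>
     (\<forall>M (V :: 'k set) a B. small_model M \<and> small V \<and> small B \<longrightarrow>
        (\<exists>a'. tp L \<MM> M V a' = tp L \<MM> M V a \<and> ind (a' ` V) M B))"

definition full_stationarity :: "('a set \<Rightarrow> 'a set \<Rightarrow> 'a set \<Rightarrow> bool) \<Rightarrow> bool" where
  "full_stationarity ind \<longleftrightarrow>
     (\<forall>M (V :: 'k set) a a' B. small_model M \<and> small V \<and> small B \<and>
        ind (a ` V) M B \<and> ind (a' ` V) M B \<and> tp L \<MM> M V a = tp L \<MM> M V a' \<longrightarrow>
        tp L \<MM> (M \<union> B) V a = tp L \<MM> (M \<union> B) V a')"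

definition ind_Morley :: "('a set \<Rightarrow> 'a set \<Rightarrow> 'a set \<Rightarrow> bool) \<Rightarrow> 'a set \<Rightarrow> 'k set \<Rightarrow> 'k rel
    \<Rightarrow> ('k \<Rightarrow> 'k \<Rightarrow> 'a) \<Rightarrow> bool" where
  "ind_Morley ind M V R s \<longleftrightarrow> sequence_order R \<and>
     (\<forall>i\<in>Field R. \<forall>j\<in>Field R. tp L \<MM> M V (s i) = tp L \<MM> M V (s j)) \<and>
     (\<forall>i\<in>Field R. ind (s i ` V) M (before R V s i))"

definition generalized_freedom :: "('a set \<Rightarrow> 'a set \<Rightarrow> 'a set \<Rightarrow> bool) \<Rightarrow> bool" where
  "generalized_freedom ind \<longleftrightarrow>
     (\<forall>M M' V a. small_model M \<and> small_model M' \<and> elem_substruct L (sub M) (sub M') \<and> small V \<and>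
        (\<exists>R s. ind_Morley ind M V R s \<and> starts_with R V s a \<and> indiscernible L \<MM> M' V R s) \<longrightarrow>
        (\<forall>R s. ind_Morley ind M' V R s \<and> starts_with R V s a \<longrightarrow> ind_Morley ind M V R s))"

text \<open>The type \<open>p\<^sup>*\<close>; it exists and is unique under the axioms other than generalized freedom.\<close>

definition star :: "('a set \<Rightarrow> 'a set \<Rightarrow> 'a set \<Rightarrow> bool) \<Rightarrow> 'a set \<Rightarrow> 'k set
    \<Rightarrow> ('f, 'r, 'k + 'a) fo_formula set \<Rightarrow> ('f, 'r, 'k + 'a) fo_formula set" where
  "star ind M V p = (THE P. global_type L \<MM> V P \<and> restrict_type P M = p \<and>
     (\<forall>B a. small B \<and> tp L \<MM> (M \<union> B) V a = restrict_type P (M \<union> B) \<longrightarrow> ind (a ` V) M B))"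

definition relative_Kims_lemma :: "('a set \<Rightarrow> 'a set \<Rightarrow> 'a set \<Rightarrow> bool) \<Rightarrow> bool" where
  "relative_Kims_lemma ind \<longleftrightarrow>
     (\<forall>M (V :: 'k set) p. small_model M \<and> small V \<and> type_over L \<MM> M V p \<longrightarrow>
        least_Kim_dividing M V (star ind M V p))"

text \<open>\<open>Kim_divides ind M V \<phi> b\<close> says that \<open>\<phi>(x, b)\<close> \<open>\<bottom>\<close>-Kim-divides over \<open>M\<close>.\<close>

definition Kim_divides :: "('a set \<Rightarrow> 'a set \<Rightarrow> 'a set \<Rightarrow> bool) \<Rightarrow> 'a set \<Rightarrow> 'k set
    \<Rightarrow> ('f, 'r, 'x + ('k + 'a)) fo_formula \<Rightarrow> ('k \<Rightarrow> 'a) \<Rightarrow> bool" where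
  "Kim_divides ind M V \<phi> b \<longleftrightarrow>
     (\<exists>R s. ind_Morley ind M V R s \<and> starts_with R V s b \<and> \<not> consistent_along \<MM> R s \<phi>)"

definition Kim_forks :: "('a set \<Rightarrow> 'a set \<Rightarrow> 'a set \<Rightarrow> bool) \<Rightarrow> 'a set \<Rightarrow> 'x set
    \<Rightarrow> ('f, 'r, 'x + 'a) fo_formula \<Rightarrow> bool" where
  "Kim_forks ind M X \<chi> \<longleftrightarrow>
     (\<exists>D :: ('k set \<times> ('f, 'r, 'x + ('k + 'a)) fo_formula \<times> ('k \<Rightarrow> 'a)) set. finite D \<and>
        (\<forall>(V, \<phi>, b)\<in>D. small V \<and> \<phi> \<in> formulas L X (V <+> M) \<and> Kim_divides ind M V \<phi> b) \<and>
        (\<forall>a. holds \<MM> a \<chi> \<longrightarrow> (\<exists>(V, \<phi>, b)\<in>D. holds \<MM> a (inst b \<phi>))))"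

text \<open>The relation \<open>A \<bottom>\<^sup>K\<^sub>M B\<close> derived from \<open>ind\<close>; the variables of \<open>tp(A/MB)\<close> are labelled by \<open>A\<close>.\<close>

definition Kim_ind :: "('a set \<Rightarrow> 'a set \<Rightarrow> 'a set \<Rightarrow> bool) \<Rightarrow> 'a set \<Rightarrow> 'a set \<Rightarrow> 'a set \<Rightarrow> bool" where
  "Kim_ind ind A M B \<longleftrightarrow> (\<forall>\<chi>\<in>tp L \<MM> (M \<union> B) A id. \<not> Kim_forks ind M A \<chi>)"

end

end

theory Submission
  imports Defs
begin

text \<open>
  Compactness and monotonicity show that Kim-forking equals Kim-dividing, so \<open>A\<close> is Kim-independent from \<open>B\<close>
  over \<open>M\<close> iff some \<open>\<bottom>\<close>-Morley sequence over \<open>M\<close> starting with \<open>B\<close> is indiscernible over \<open>MA\<close>. Generalized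
  freedom then says: if a model \<open>M'\<close> above \<open>M\<close> is Kim-independent from \<open>b\<close> over \<open>M\<close>, a formula \<open>\<phi>(x, b)\<close> that
  Kim-divides over \<open>M\<close> also Kim-divides over \<open>M'\<close>.

  Suppose symmetry, and let \<open>\<phi>(x, b)\<close> Kim-divide over \<open>M\<close> but be consistent along Morley sequences of an invariant
  type \<open>q\<close>. Choose a chain of models with union \<open>M'\<close> and \<open>b\<^sub>i\<close> realizing \<open>q\<close> over the \<open>i\<close>-th one, then \<open>a\<close> satisfying all
  \<open>\<phi>(x, b\<^sub>i)\<close>, and let \<open>b'\<close> realize an average type of the \<open>b\<^sub>i\<close> over \<open>M'a\<close>. As \<open>b'\<close> realizes \<open>q\<close> over \<open>M'\<close>, symmetry
  and freedom make \<open>\<phi>(x, b')\<close> Kim-divide over \<open>M'\<close>; as \<open>tp(b'/M'a)\<close> extends to an \<open>M'\<close>-invariant type, symmetry over \<open>M'\<close>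
  makes \<open>a\<close> Kim-independent from \<open>b'\<close>, contradicting \<open>\<phi>(a, b')\<close>.

  Suppose the relative Kim's lemma, \<open>A\<close> Kim-independent from \<open>B\<close> over \<open>M\<close>, and \<open>\<phi>(B, A)\<close> with \<open>\<phi>(x, A)\<close> Kim-dividing.
  The lemma yields the chain condition and hence an increasing chain of models \<open>N\<^sub>i\<close> and copies \<open>A\<^sub>i \<subseteq> N\<^sub>i\<^sub>+\<^sub>1\<close> of \<open>A\<close> over \<open>MB\<close>
  with \<open>N\<^sub>i\<close> Kim-independent from \<open>A\<^sub>i\<close>. Over \<open>M' = \<Union>N\<^sub>i\<close>, freedom makes \<open>\<phi>\<close> Kim-divide at a realization of an average
  type of the \<open>A\<^sub>i\<close>, while \<open>B\<close> satisfies \<open>\<phi>\<close> along Morley sequences of that type, contradicting the lemma over \<open>M'\<close>.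
\<close>

section \<open>Formulas and automorphisms\<close>

text \<open>Both directions meet the same obstacle. Freedom transfers Kim-dividing from
  \<open>M\<close> to a larger model only if that model is Kim-independent from the parameters,
  while the contradiction has to be found over the larger model, from one tuple that satisfies a
  formula along a whole sequence. An average type of the sequence serves both ends: being finitely
  satisfiable in the sequence, it is invariant over the union \<open>M'\<close> of the chain, and
  its realizations keep whatever holds of all late terms. Average types also yield indiscernible
  sequences without Ramsey or Erdos--Rado arguments, so sequences of length \<omega> suffice.

  The chain condition needs the lemma because a Morley sequence cut into blocks is a Morley sequence
  of an invariant type that may differ from the canonical type of a block; consistency along the
  blocks says nothing about Kim-dividing by itself. As \<kappa> is not assumed regular, smallness of
  a countable union of small models needs an argument, and a common bound on the sizes is what makes
  the second chain usable.\<close>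

lemma eval_map: "eval A \<rho> bs (map_fo_term f t) = eval A (\<rho> \<circ> f) bs t"
  by (induction t) (auto intro!: arg_cong[where f = "ifun A _"])

lemma sat_map: "sat A \<rho> bs (map_fo_formula f \<phi>) = sat A (\<rho> \<circ> f) bs \<phi>"
proof (induction \<phi> arbitrary: bs)
  case (Rel r ts)
  have "map (eval A \<rho> bs) (map (map_fo_term f) ts) = map (eval A (\<rho> \<circ> f) bs) ts"
    by (simp add: eval_map)
  then show ?case by (simp only: fo_formula.map sat.simps)
qed (simp_all add: eval_map)

lemma eval_cong: "(\<And>v. v \<in> fv_term t \<Longrightarrow> \<rho> v = \<rho>' v) \<Longrightarrow> eval A \<rho> bs t = eval A \<rho>' bs t"
proof (induction t)
  case (App f ts)
  then have "map (eval A \<rho> bs) ts = map (eval A \<rho>' bs) ts"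
    by (auto intro!: map_cong)
  then show ?case by (simp only: eval.simps)
qed auto

lemma sat_cong: "(\<And>v. v \<in> fv \<phi> \<Longrightarrow> \<rho> v = \<rho>' v) \<Longrightarrow> sat A \<rho> bs \<phi> = sat A \<rho>' bs \<phi>"
proof (induction \<phi> arbitrary: bs)
  case (Equal s t)
  then show ?case using eval_cong[of s \<rho> \<rho>' A] eval_cong[of t \<rho> \<rho>' A] by simp
next
  case (Rel r ts)
  then have "map (eval A \<rho> bs) ts = map (eval A \<rho>' bs) ts"
    by (auto intro!: map_cong eval_cong)
  then show ?case by (simp only: sat.simps)
qed auto

lemma wf_term_map [simp]: "wf_term L n (map_fo_term f t) = wf_term L n t"
  by (induction t) auto

lemma wf_formula_map [simp]: "wf_formula L n (map_fo_formula f \<phi>) = wf_formula L n \<phi>"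
  by (induction \<phi> arbitrary: n) auto

lemma finite_fv_term [simp]: "finite (fv_term t)"
  by (induction t) auto

lemma finite_fv [simp]: "finite (fv \<phi>)"
  by (induction \<phi>) auto

lemma map_fo_formula_id_on: "(\<And>v. v \<in> fv \<phi> \<Longrightarrow> f v = v) \<Longrightarrow> map_fo_formula f \<phi> = \<phi>"
  using fo_formula.map_cong0[of \<phi> f id] by (simp add: fo_formula.map_id)

section \<open>Quantification over a labelled free variable\<close>

fun bind_term :: "'v \<Rightarrow> nat \<Rightarrow> ('f, 'v) fo_term \<Rightarrow> ('f, 'v) fo_term" where
  "bind_term v n (Bound k) = Bound k"
| "bind_term v n (Free w) = (if w = v then Bound n else Free w)"
| "bind_term v n (App f ts) = App f (map (bind_term v n) ts)"

text \<open>The index \<open>n\<close> counts the quantifiers already passed, so the new index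
  points just beyond them and is captured by an \<open>Ex\<close> put in front. Formulas quantify
  only over indices, while realizing a type in many variables requires quantifying one labelled
  variable at a time.\<close>

fun bind_formula :: "'v \<Rightarrow> nat \<Rightarrow> ('f, 'r, 'v) fo_formula \<Rightarrow> ('f, 'r, 'v) fo_formula" where
  "bind_formula v n (Equal s t) = Equal (bind_term v n s) (bind_term v n t)"
| "bind_formula v n (Rel r ts) = Rel r (map (bind_term v n) ts)"
| "bind_formula v n (Neg \<phi>) = Neg (bind_formula v n \<phi>)"
| "bind_formula v n (Conj \<phi> \<psi>) = Conj (bind_formula v n \<phi>) (bind_formula v n \<psi>)"
| "bind_formula v n (Ex \<phi>) = Ex (bind_formula v (Suc n) \<phi>)"

lemma wf_bind_term: "wf_term L n t \<Longrightarrow> wf_term L (Suc n) (bind_term v n t)"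
  by (induction t) auto

lemma wf_bind_formula: "wf_formula L n \<phi> \<Longrightarrow> wf_formula L (Suc n) (bind_formula v n \<phi>)"
  by (induction \<phi> arbitrary: n) (auto simp: wf_bind_term)

lemma fv_bind_term: "fv_term (bind_term v n t) = fv_term t - {v}"
  by (induction t) auto

lemma fv_bind_formula: "fv (bind_formula v n \<phi>) = fv \<phi> - {v}"
  by (induction \<phi> arbitrary: n) (auto simp: fv_bind_term)

text \<open>The added quantifier is the outermost one, so its value \<open>x\<close> stands at the
  end of the list of bound values.\<close>

lemma eval_bind_term:
  "wf_term L (length bs) t \<Longrightarrow> eval A \<rho> (bs @ [x]) (bind_term v (length bs) t) = eval A (\<rho>(v := x)) bs t"
proof (induction t)
  case (App f ts)
  then have "map (eval A \<rho> (bs @ [x])) (map (bind_term v (length bs)) ts) = map (eval A (\<rho>(v := x)) bs) ts"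
    by (auto simp del: fun_upd_apply)
  then show ?case by (simp only: eval.simps bind_term.simps)
qed (auto simp: nth_append)

lemma sat_bind_formula:
  "wf_formula L (length bs) \<phi> \<Longrightarrow>
     sat A \<rho> (bs @ [x]) (bind_formula v (length bs) \<phi>) = sat A (\<rho>(v := x)) bs \<phi>"
proof (induction \<phi> arbitrary: bs)
  case (Rel r ts)
  then have "map (eval A \<rho> (bs @ [x])) (map (bind_term v (length bs)) ts) = map (eval A (\<rho>(v := x)) bs) ts"
    by (auto simp add: eval_bind_term simp del: fun_upd_apply)
  then show ?case by (simp only: sat.simps bind_formula.simps)
next
  case (Ex \<phi>)
  have "sat A \<rho> (y # bs @ [x]) (bind_formula v (Suc (length bs)) \<phi>) = sat A (\<rho>(v := x)) (y # bs) \<phi>" for y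
    using Ex.IH[of "y # bs"] Ex.prems by (simp del: fun_upd_apply)
  then show ?case by (simp del: fun_upd_apply)
qed (auto simp: eval_bind_term)

lemma ex_conj:
  assumes "finite \<Psi>" and "\<And>\<psi>. \<psi> \<in> \<Psi> \<Longrightarrow> wf_formula L 0 \<psi>" and "univ A \<noteq> {}"
  shows "\<exists>\<chi>. wf_formula L 0 \<chi> \<and> fv \<chi> \<subseteq> (\<Union>\<psi>\<in>\<Psi>. fv \<psi>) \<and> (\<forall>\<rho>. sat A \<rho> [] \<chi> \<longleftrightarrow> (\<forall>\<psi>\<in>\<Psi>. sat A \<rho> [] \<psi>))"
  using assms
proof (induction rule: finite_induct)
  case empty
  \<comment> \<open>The empty conjunction is a sentence without free variables that is true in every
    nonempty structure.\<close>
  have "wf_formula L 0 (Ex (Equal (Bound 0) (Bound 0)))" "fv (Ex (Equal (Bound 0) (Bound 0))) = {}"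
    "sat A \<rho> [] (Ex (Equal (Bound 0) (Bound 0)))" for \<rho>
    using empty by auto
  then show ?case by (intro exI[of _ "Ex (Equal (Bound 0) (Bound 0))"]) auto
next
  case (insert \<psi> \<Psi>)
  then obtain \<chi> where "wf_formula L 0 \<chi>" "fv \<chi> \<subseteq> (\<Union>\<psi>\<in>\<Psi>. fv \<psi>)"
    "\<forall>\<rho>. sat A \<rho> [] \<chi> \<longleftrightarrow> (\<forall>\<psi>\<in>\<Psi>. sat A \<rho> [] \<psi>)"
    by auto
  then show ?case
    using insert by (intro exI[of _ "Conj \<psi> \<chi>"]) auto
qed

section \<open>Satisfaction under automorphisms\<close>

lemma eval_automorphism:
  assumes "automorphism L A \<sigma>" "univ A = UNIV"
  shows "wf_term L (length bs) t \<Longrightarrow> eval A (\<sigma> \<circ> \<rho>) (map \<sigma> bs) t = \<sigma> (eval A \<rho> bs t)"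
proof (induction t)
  case (App f ts)
  then have "map (eval A (\<sigma> \<circ> \<rho>) (map \<sigma> bs)) ts = map \<sigma> (map (eval A \<rho> bs) ts)"
    unfolding map_map by (intro map_cong) (simp_all del: o_apply, simp)
  then show ?case using assms App.prems unfolding automorphism_def
    by (simp del: map_eq_conv map_map o_apply)
qed auto

lemma sat_automorphism:
  assumes "automorphism L A \<sigma>" "univ A = UNIV"
  shows "wf_formula L (length bs) \<phi> \<Longrightarrow> sat A (\<sigma> \<circ> \<rho>) (map \<sigma> bs) \<phi> = sat A \<rho> bs \<phi>"
proof (induction \<phi> arbitrary: bs)
  case (Equal s t)
  moreover have "inj \<sigma>"
    using assms unfolding automorphism_def bij_betw_def by auto
  ultimately show ?case using eval_automorphism[OF assms, of bs s \<rho>] eval_automorphism[OF assms, of bs t \<rho>]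
    by (simp add: inj_eq del: o_apply)
next
  case (Rel r ts)
  have "eval A (\<sigma> \<circ> \<rho>) (map \<sigma> bs) t = \<sigma> (eval A \<rho> bs t)" if "t \<in> set ts" for t
    using eval_automorphism[OF assms] Rel that by auto
  then have "map (eval A (\<sigma> \<circ> \<rho>) (map \<sigma> bs)) ts = map \<sigma> (map (eval A \<rho> bs) ts)"
    unfolding map_map by (intro map_cong refl) (metis o_apply)
  then have "irel A r (map (eval A (\<sigma> \<circ> \<rho>) (map \<sigma> bs)) ts) = irel A r (map \<sigma> (map (eval A \<rho> bs) ts))"
    by (rule arg_cong)
  also have "\<dots> = irel A r (map (eval A \<rho> bs) ts)"
    using assms Rel unfolding automorphism_def by (metis length_map subset_UNIV wf_formula.simps(2))
  finally show ?case by (simp only: sat.simps)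
next
  case (Ex \<phi>)
  have "sat A (\<sigma> \<circ> \<rho>) (\<sigma> x # map \<sigma> bs) \<phi> = sat A \<rho> (x # bs) \<phi>" for x
    using Ex.IH[of "x # bs"] Ex.prems by (simp del: o_apply)
  \<comment> \<open>Surjectivity lets every witness be written in the form
    \<open>\<sigma> x\<close>.\<close>
  moreover have "surj \<sigma>"
    using assms unfolding automorphism_def bij_betw_def by auto
  ultimately show ?case using assms(2) by (simp del: o_apply) (metis surjD)
qed auto

section \<open>Formulas with parameters and types of tuples\<close>

lemma formulasI: "wf_formula L 0 \<phi> \<Longrightarrow> fv \<phi> \<subseteq> V <+> C \<Longrightarrow> \<phi> \<in> formulas L V C"
  by (simp add: formulas_def)

lemma formulas_wf: "\<phi> \<in> formulas L V C \<Longrightarrow> wf_formula L 0 \<phi>"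
  by (simp add: formulas_def)

lemma formulas_mono: "\<phi> \<in> formulas L V C \<Longrightarrow> V \<subseteq> V' \<Longrightarrow> C \<subseteq> C' \<Longrightarrow> \<phi> \<in> formulas L V' C'"
  by (auto simp: formulas_def)

lemma formulas_map:
  assumes "\<phi> \<in> formulas L V C"
    and "\<And>v. v \<in> V \<Longrightarrow> Inl v \<in> fv \<phi> \<Longrightarrow> f (Inl v) \<in> V' <+> C'"
    and "\<And>c. c \<in> C \<Longrightarrow> Inr c \<in> fv \<phi> \<Longrightarrow> f (Inr c) \<in> V' <+> C'"
  shows "map_fo_formula f \<phi> \<in> formulas L V' C'"
proof (rule formulasI)
  show "wf_formula L 0 (map_fo_formula f \<phi>)" using assms by (simp add: formulas_def)
  have "f u \<in> V' <+> C'" if "u \<in> fv \<phi>" for u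
  proof -
    have "u \<in> V <+> C" using that assms(1) by (auto simp: formulas_def)
    then show ?thesis using assms(2,3) that by (elim PlusE) auto
  qed
  then show "fv (map_fo_formula f \<phi>) \<subseteq> V' <+> C'" by (auto simp: fo_formula.set_map)
qed

lemma formulas_Neg [simp]: "Neg \<phi> \<in> formulas L V C \<longleftrightarrow> \<phi> \<in> formulas L V C"
  by (simp add: formulas_def)

lemma formulas_Conj [simp]: "Conj \<phi> \<psi> \<in> formulas L V C \<longleftrightarrow> \<phi> \<in> formulas L V C \<and> \<psi> \<in> formulas L V C"
  by (auto simp: formulas_def)

lemma holds_Neg [simp]: "holds A a (Neg \<phi>) \<longleftrightarrow> \<not> holds A a \<phi>"
  by (simp add: holds_def)

lemma holds_Conj [simp]: "holds A a (Conj \<phi> \<psi>) \<longleftrightarrow> holds A a \<phi> \<and> holds A a \<psi>"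
  by (simp add: holds_def)

lemma holds_map: "holds A a (map_fo_formula f \<phi>) = sat A (case_sum a id \<circ> f) [] \<phi>"
  by (simp add: holds_def sat_map)

lemma holds_cong: "(\<And>v. Inl v \<in> fv \<phi> \<Longrightarrow> a v = b v) \<Longrightarrow> holds A a \<phi> = holds A b \<phi>"
  unfolding holds_def by (rule sat_cong) (auto split: sum.split)

lemma holds_cong_on: "\<phi> \<in> formulas L V C \<Longrightarrow> (\<And>v. v \<in> V \<Longrightarrow> a v = b v) \<Longrightarrow> holds A a \<phi> = holds A b \<phi>"
  by (rule holds_cong) (auto simp: formulas_def)

lemma holds_inst: "holds A a (inst b \<phi>) = sat A (case_sum a (case_sum b id)) [] \<phi>"
proof -
  have "case_sum a id \<circ> map_sum id (case_sum b id) = case_sum a (case_sum b id)"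
    by (auto split: sum.split simp: fun_eq_iff)
  then show ?thesis by (simp add: inst_def holds_map)
qed

lemma inst_formulas: "\<phi> \<in> formulas L X (V <+> M) \<Longrightarrow> inst b \<phi> \<in> formulas L X (M \<union> b ` V)"
  unfolding inst_def by (rule formulas_map) auto

lemma inst_cong:
  "\<phi> \<in> formulas L X (V <+> M) \<Longrightarrow> (\<And>v. v \<in> V \<Longrightarrow> b v = b' v) \<Longrightarrow> inst b \<phi> = inst b' \<phi>"
  unfolding inst_def by (rule fo_formula.map_cong0) (auto simp: formulas_def split: sum.split)

text \<open>Parameters outside \<open>M\<close> are replaced by labels at which \<open>b\<close>
  takes their value. As \<open>b\<close> need not be injective, the label is chosen; a parameter
  lying both in \<open>M\<close> and among the entries of \<open>b\<close> stays a
  parameter.\<close>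

lemma ex_inst:
  fixes \<chi> :: "('f, 'r, 'x + 'a) fo_formula" and b :: "'y \<Rightarrow> 'a"
  assumes "\<chi> \<in> formulas L X (M \<union> b ` V)"
  shows "\<exists>\<phi>\<in>formulas L X (V <+> M). inst b \<phi> = \<chi>"
proof
  define f where "f y = (if y \<in> M then Inr y else Inl (SOME v. v \<in> V \<and> b v = y))" for y
  have f: "f y \<in> V <+> M \<and> case_sum b id (f y) = y" if "y \<in> M \<union> b ` V" for y
  proof (cases "y \<in> M")
    case False
    then have "\<exists>v. v \<in> V \<and> b v = y" using that by auto
    then have "(SOME v. v \<in> V \<and> b v = y) \<in> V \<and> b (SOME v. v \<in> V \<and> b v = y) = y" by (rule someI_ex)
    then show ?thesis using False by (auto simp: f_def)
  qed (auto simp: f_def)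
  let ?\<phi> = "map_fo_formula (map_sum id f) \<chi>"
  show "?\<phi> \<in> formulas L X (V <+> M)" using assms f by (intro formulas_map) auto
  have "inst b ?\<phi> = map_fo_formula (map_sum id (case_sum b id \<circ> f)) \<chi>"
    by (simp add: inst_def fo_formula.map_comp map_sum.comp)
  also have "\<dots> = \<chi>"
  proof (rule map_fo_formula_id_on)
    fix u assume "u \<in> fv \<chi>"
    then have "u \<in> X <+> (M \<union> b ` V)" using assms by (auto simp: formulas_def)
    then show "map_sum id (case_sum b id \<circ> f) u = u" by (elim PlusE) (use f in auto)
  qed
  finally show "inst b ?\<phi> = \<chi>" .
qed

lemma tp_eq_iff: "tp L A C V a = tp L A C V a' \<longleftrightarrow> (\<forall>\<phi>\<in>formulas L V C. holds A a \<phi> = holds A a' \<phi>)"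
  by (auto simp: tp_def)

lemma tp_eqD: "tp L A C V a = tp L A C V a' \<Longrightarrow> \<phi> \<in> formulas L V C \<Longrightarrow> holds A a \<phi> = holds A a' \<phi>"
  by (auto simp: tp_eq_iff)

lemma tp_mono:
  "tp L A C V a = tp L A C V a' \<Longrightarrow> C' \<subseteq> C \<Longrightarrow> V' \<subseteq> V \<Longrightarrow> tp L A C' V' a = tp L A C' V' a'"
  unfolding tp_eq_iff using formulas_mono by blast

lemma tp_cong: "(\<And>v. v \<in> V \<Longrightarrow> a v = a' v) \<Longrightarrow> tp L A C V a = tp L A C V a'"
  unfolding tp_eq_iff using holds_cong_on by blast

text \<open>A formula mentions only finitely many variables.\<close>

lemma tp_local:
  assumes "\<And>V0. V0 \<subseteq> V \<Longrightarrow> finite V0 \<Longrightarrow> tp L A C V0 a = tp L A C V0 a'"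
  shows "tp L A C V a = tp L A C V a'"
  unfolding tp_eq_iff
proof
  fix \<phi> assume \<phi>: "\<phi> \<in> formulas L V C"
  have 1: "Inl -` fv \<phi> \<subseteq> V" "\<phi> \<in> formulas L (Inl -` fv \<phi>) C" using \<phi> by (auto simp: formulas_def)
  have "finite (Inl -` fv \<phi>)" by (simp add: finite_vimageI)
  from tp_eqD[OF assms[OF 1(1) this] 1(2)] show "holds A a \<phi> = holds A a' \<phi>" .
qed

lemma holds_reindex: "holds A (a \<circ> f) \<phi> = holds A a (map_fo_formula (map_sum f id) \<phi>)"
proof -
  have "case_sum a id \<circ> map_sum f id = case_sum (a \<circ> f) id"
    by (auto split: sum.split simp: fun_eq_iff)
  then show ?thesis by (simp add: holds_map) (simp add: holds_def)
qed

text \<open>Substituting variables along \<open>f\<close> turns a formula about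
  \<open>a \<circ> f\<close> into one about \<open>a\<close>. As \<open>f\<close> is arbitrary, this
  covers restricting, repeating and reordering the entries of a tuple.\<close>

lemma tp_reindex:
  assumes "tp L A C V a = tp L A C V a'" "f ` W \<subseteq> V"
  shows "tp L A C W (a \<circ> f) = tp L A C W (a' \<circ> f)"
  unfolding tp_eq_iff holds_reindex
proof
  fix \<phi> assume "\<phi> \<in> formulas L W C"
  then have "map_fo_formula (map_sum f id) \<phi> \<in> formulas L V C"
    by (rule formulas_map) (use assms(2) in auto)
  then show "holds A a (map_fo_formula (map_sum f id) \<phi>) = holds A a' (map_fo_formula (map_sum f id) \<phi>)"
    by (rule tp_eqD[OF assms(1)])
qed

lemma restrict_type_formulas: "p \<subseteq> formulas L V UNIV \<Longrightarrow> restrict_type p C = p \<inter> formulas L V C"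
  by (auto simp: restrict_type_def formulas_def)

section \<open>Complete types\<close>

text \<open>Lindenbaum's argument uses of consistency only that it passes to subsets and survives
  adding a formula or its negation. Keeping \<open>good\<close> abstract covers both satisfiability
  and truth at infinitely many terms of a sequence; the latter produces average types.\<close>

lemma lindenbaum:
  assumes "\<Phi> \<subseteq> U" and good: "\<And>\<Psi>. finite \<Psi> \<Longrightarrow> \<Psi> \<subseteq> \<Phi> \<Longrightarrow> good \<Psi>"
    and mono: "\<And>\<Psi> \<Psi>'. good \<Psi> \<Longrightarrow> \<Psi>' \<subseteq> \<Psi> \<Longrightarrow> good \<Psi>'"
    and split: "\<And>\<Psi> \<phi>. finite \<Psi> \<Longrightarrow> good \<Psi> \<Longrightarrow> good (insert \<phi> \<Psi>) \<or> good (insert (neg \<phi>) \<Psi>)"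
    and neg: "\<And>\<phi>. \<phi> \<in> U \<Longrightarrow> neg \<phi> \<in> U"
  obtains p where "\<Phi> \<subseteq> p" "p \<subseteq> U" "\<And>\<Psi>. finite \<Psi> \<Longrightarrow> \<Psi> \<subseteq> p \<Longrightarrow> good \<Psi>"
    "\<And>\<phi>. \<phi> \<in> U \<Longrightarrow> \<phi> \<in> p \<or> neg \<phi> \<in> p"
proof -
  define \<A> where "\<A> = {p. \<Phi> \<subseteq> p \<and> p \<subseteq> U \<and> (\<forall>\<Psi>. finite \<Psi> \<longrightarrow> \<Psi> \<subseteq> p \<longrightarrow> good \<Psi>)}"
  have "\<exists>M\<in>\<A>. \<forall>X\<in>\<A>. M \<subseteq> X \<longrightarrow> X = M"
  proof (rule subset_Zorn_nonempty)
    show "\<A> \<noteq> {}" using assms by (auto simp: \<A>_def)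
  next
    fix \<C> assume ne: "\<C> \<noteq> {}" and ch: "subset.chain \<A> \<C>"
    then have sub: "\<C> \<subseteq> \<A>" by (simp add: subset.chain_def)
    have "good \<Psi>" if \<Psi>: "finite \<Psi>" "\<Psi> \<subseteq> \<Union>\<C>" for \<Psi>
    proof -
      obtain X where "X \<in> \<C>" "\<Psi> \<subseteq> X"
        using finite_subset_Union_chain[OF \<Psi> ne ch] by blast
      then show ?thesis using sub that by (auto simp: \<A>_def)
    qed
    moreover have "\<Phi> \<subseteq> X \<and> X \<subseteq> U" if "X \<in> \<C>" for X using that sub by (auto simp: \<A>_def)
    then have "\<Phi> \<subseteq> \<Union>\<C>" "\<Union>\<C> \<subseteq> U" using ne by (auto intro: Sup_least)
    ultimately show "\<Union>\<C> \<in> \<A>" by (simp add: \<A>_def)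
  qed
  then obtain p where p: "p \<in> \<A>" and max: "\<And>X. X \<in> \<A> \<Longrightarrow> p \<subseteq> X \<Longrightarrow> X = p" by auto
  \<comment> \<open>Maximality makes every missing formula fail already against a finite part of
    \<open>p\<close>.\<close>
  have bad: "\<exists>\<Psi>. finite \<Psi> \<and> \<Psi> \<subseteq> p \<and> \<not> good (insert \<phi> \<Psi>)" if "\<phi> \<in> U" "\<phi> \<notin> p" for \<phi>
  proof (rule ccontr)
    assume *: "\<not> ?thesis"
    have "insert \<phi> p \<in> \<A>"
    proof -
      have "good \<Psi>" if "finite \<Psi>" "\<Psi> \<subseteq> insert \<phi> p" for \<Psi>
      proof -
        have "finite (\<Psi> - {\<phi>})" "\<Psi> - {\<phi>} \<subseteq> p" using that by auto
        then have "good (insert \<phi> (\<Psi> - {\<phi>}))" using * by blast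
        then show ?thesis by (rule mono) auto
      qed
      then show ?thesis using p that by (auto simp: \<A>_def)
    qed
    then show False using max[of "insert \<phi> p"] that by auto
  qed
  show ?thesis
  proof
    show "\<phi> \<in> p \<or> neg \<phi> \<in> p" if U: "\<phi> \<in> U" for \<phi>
    proof (rule ccontr)
      assume "\<not> ?thesis"
      with bad[of \<phi>] bad[of "neg \<phi>"] U neg obtain \<Psi> \<Psi>' where
        f: "finite \<Psi>" "\<Psi> \<subseteq> p" "\<not> good (insert \<phi> \<Psi>)" "finite \<Psi>'" "\<Psi>' \<subseteq> p" "\<not> good (insert (neg \<phi>) \<Psi>')"
        by metis
      \<comment> \<open>The two finite obstructions are joined; whichever formula
        \<open>split\<close> allows to be added contradicts one of them.\<close>
      have "good (\<Psi> \<union> \<Psi>')" using p f by (auto simp: \<A>_def)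
      then have "good (insert \<phi> (\<Psi> \<union> \<Psi>')) \<or> good (insert (neg \<phi>) (\<Psi> \<union> \<Psi>'))" using split f by auto
      then show False using f mono[of _ "insert \<phi> \<Psi>"] mono[of _ "insert (neg \<phi>) \<Psi>'"] by (metis insert_mono sup_ge1 sup_ge2)
    qed
  qed (use p in \<open>auto simp: \<A>_def\<close>)
qed

lemma consistent_extend:
  fixes \<Phi> :: "('f, 'r, 'x + 'a) fo_formula set"
  assumes "\<Phi> \<subseteq> formulas L V C" "consistent A \<Phi>"
  obtains p where "\<Phi> \<subseteq> p" "type_over L A C V p"
proof -
  have "(\<exists>a. \<forall>\<psi>\<in>insert \<phi> \<Psi>. holds A a \<psi>) \<or> (\<exists>a. \<forall>\<psi>\<in>insert (Neg \<phi>) \<Psi>. holds A a \<psi>)"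
    if "\<exists>a. \<forall>\<psi>\<in>\<Psi>. holds A a \<psi>" for \<phi> and \<Psi> :: "('f, 'r, 'x + 'a) fo_formula set"
    using that by (metis holds_Neg insertE)
  note split = this
  obtain p where "\<Phi> \<subseteq> p" "p \<subseteq> formulas L V C"
    "\<And>\<Psi>. finite \<Psi> \<Longrightarrow> \<Psi> \<subseteq> p \<Longrightarrow> \<exists>a. \<forall>\<psi>\<in>\<Psi>. holds A a \<psi>"
    "\<And>\<phi>. \<phi> \<in> formulas L V C \<Longrightarrow> \<phi> \<in> p \<or> Neg \<phi> \<in> p"
  proof (rule lindenbaum[of \<Phi> "formulas L V C" "\<lambda>\<Psi>. \<exists>a. \<forall>\<psi>\<in>\<Psi>. holds A a \<psi>" Neg])
    show "\<exists>a. \<forall>\<psi>\<in>\<Psi>'. holds A a \<psi>" if "\<exists>a. \<forall>\<psi>\<in>\<Psi>. holds A a \<psi>" "\<Psi>' \<subseteq> \<Psi>" for \<Psi> \<Psi>'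
      using that by blast
  qed (use assms split in \<open>simp_all add: consistent_def\<close>)
  then show thesis using that by (auto simp: type_over_def consistent_def)
qed

lemma type_over_Neg:
  assumes "type_over L A C V p" "\<phi> \<in> formulas L V C"
  shows "Neg \<phi> \<in> p \<longleftrightarrow> \<phi> \<notin> p"
proof -
  have "\<not> (\<phi> \<in> p \<and> Neg \<phi> \<in> p)"
  proof
    assume "\<phi> \<in> p \<and> Neg \<phi> \<in> p"
    then obtain a where "\<forall>\<psi>\<in>{\<phi>, Neg \<phi>}. holds A a \<psi>"
      using assms unfolding type_over_def consistent_def by (metis empty_subsetI finite.simps insert_subset)
    then show False by simp
  qed
  then show ?thesis using assms by (auto simp: type_over_def)
qed

lemma type_over_closed:
  assumes p: "type_over L A C V p" and "finite \<Psi>" "\<Psi> \<subseteq> p" "\<phi> \<in> formulas L V C"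
    and "\<And>a. (\<forall>\<psi>\<in>\<Psi>. holds A a \<psi>) \<Longrightarrow> holds A a \<phi>"
  shows "\<phi> \<in> p"
proof (rule ccontr)
  assume "\<phi> \<notin> p"
  then have "Neg \<phi> \<in> p" using assms type_over_Neg by blast
  then have "insert (Neg \<phi>) \<Psi> \<subseteq> p" using assms by auto
  then obtain a where "\<forall>\<psi>\<in>insert (Neg \<phi>) \<Psi>. holds A a \<psi>"
    using p \<open>finite \<Psi>\<close> unfolding type_over_def consistent_def by (meson finite.insertI)
  then show False using assms(5) by auto
qed

lemma type_over_eqI:
  assumes "type_over L A C V p" "type_over L A C V q" "p \<subseteq> q"
  shows "p = q"
  using assms type_over_Neg[OF assms(1)] type_over_Neg[OF assms(2)]
  by (auto simp: type_over_def) blast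

lemma type_over_tp [simp]: "type_over L A C V (tp L A C V a)"
  unfolding type_over_def consistent_def by (auto simp: tp_def)

lemma type_over_restrict:
  assumes "type_over L A C V p" "D \<subseteq> C"
  shows "type_over L A D V (p \<inter> formulas L V D)"
  using assms formulas_mono[of _ L V D V C] unfolding type_over_def consistent_def
  by (auto simp: subset_iff)

text \<open>Complete types are equal as soon as one contains the other, so equalities of types below
  are usually obtained from a single inclusion.\<close>

lemma tp_eq_type: "type_over L A C V p \<Longrightarrow> p \<subseteq> tp L A C V a \<Longrightarrow> p = tp L A C V a"
  by (rule type_over_eqI) auto

lemma tp_restrict_mono:
  assumes "p \<subseteq> formulas L V UNIV" "tp L A C V a = restrict_type p C" "D \<subseteq> C"
  shows "tp L A D V a = restrict_type p D"
  using assms unfolding restrict_type_formulas[OF assms(1)] tp_def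
  using formulas_mono[of _ L V D V C] by auto

lemma finite_max_Linear_order:
  assumes "Linear_order R" "finite F" "F \<noteq> {}" "F \<subseteq> Field R"
  shows "\<exists>m\<in>F. \<forall>x\<in>F. (x, m) \<in> R"
  using assms(2-4)
proof (induction rule: finite_ne_induct)
  case (singleton x)
  then show ?case using assms(1)
    by (auto simp: linear_order_on_def partial_order_on_def preorder_on_def refl_on_def)
next
  case (insert x F)
  then obtain m where m: "m \<in> F" "\<forall>x\<in>F. (x, m) \<in> R" by auto
  have R: "trans R" "total_on (Field R) R" "refl_on (Field R) R"
    using assms(1) by (auto simp: linear_order_on_def partial_order_on_def preorder_on_def)
  show ?case
  proof (cases "(x, m) \<in> R")
    case True
    then show ?thesis using m by auto
  next
    case False
    moreover have "x = m \<Longrightarrow> (x, m) \<in> R" using R(3) m insert by (auto simp: refl_on_def)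
    ultimately have "(m, x) \<in> R" using R(2) m insert by (auto simp: total_on_def)
    moreover have "(x, x) \<in> R" using R(3) insert by (auto simp: refl_on_def)
    ultimately show ?thesis using m R(1) by (auto elim: transE)
  qed
qed

section \<open>Cardinality of sets of formulas\<close>

text \<open>Sizes are compared with one infinite set instead of \<kappa>: as \<kappa> is not assumed
  regular, smallness is not known to be closed under countable unions, whereas \<open>le\<close>
  is.\<close>

locale infinite_bound =
  fixes \<Lambda> :: "'l set"
  assumes inf: "infinite \<Lambda>"
begin

abbreviation le :: "'b set \<Rightarrow> bool" where
  "le S \<equiv> |S| \<le>o |\<Lambda>|"

lemma le_subset: "le S \<Longrightarrow> S' \<subseteq> S \<Longrightarrow> le S'"
  using card_of_mono1 ordLeq_transitive by blast

lemma le_image: "le S \<Longrightarrow> le (f ` S)"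
  using card_of_image ordLeq_transitive by blast

lemma le_Un: "le S \<Longrightarrow> le S' \<Longrightarrow> le (S \<union> S')"
  by (rule card_of_Un_ordLeq_infinite_Field) (simp_all add: inf card_of_card_order_on Field_card_of)

lemma le_Times: "le S \<Longrightarrow> le S' \<Longrightarrow> le (S \<times> S')"
  by (rule card_of_Times_ordLeq_infinite_Field) (simp_all add: inf card_of_card_order_on Field_card_of)

lemma le_nat: "le (UNIV :: nat set)"
  using inf infinite_iff_card_of_nat by blast

lemma le_UN: "le I \<Longrightarrow> (\<And>i. i \<in> I \<Longrightarrow> le (S i)) \<Longrightarrow> le (\<Union>i\<in>I. S i)"
  using card_of_UNION_ordLeq_infinite[of \<Lambda> I S] inf by blast

lemma le_lists: 
  assumes "le S"
  shows "le (lists S)"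
proof -
  have *: "le {xs \<in> lists S. length xs = n}" for n
  proof (induction n)
    case 0
    have "{xs \<in> lists S. length xs = 0} \<subseteq> (\<lambda>_. []) ` (UNIV :: nat set)" by auto
    then show ?case by (rule le_subset[OF le_image[OF le_nat]])
  next
    case (Suc n)
    have "{xs \<in> lists S. length xs = Suc n} \<subseteq> (\<lambda>(x, xs). x # xs) ` (S \<times> {xs \<in> lists S. length xs = n})"
      by (auto simp: length_Suc_conv image_iff)
    then show ?case by (rule le_subset[OF le_image[OF le_Times[OF assms Suc]]])
  qed
  show ?thesis by (rule le_subset[OF le_UN[OF le_nat *]]) auto
qed

text \<open>Well-formedness at some level confines the symbols to the language, whose set of
  function symbols may be smaller than the type \<open>'f\<close>.\<close>

definition terms_over :: "('f, 'r) lang \<Rightarrow> 'v set \<Rightarrow> ('f, 'v) fo_term set" where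
  "terms_over L H = {t. (\<exists>n. wf_term L n t) \<and> fv_term t \<subseteq> H}"

lemma le_terms_over:
  fixes H :: "'v set" and L :: "('f, 'r) lang"
  assumes "le (funs L)" "le H"
  shows "le (terms_over L H)"
proof -
  let ?S = "\<lambda>n. {t \<in> terms_over L H. size t \<le> n}"
  have *: "le (?S n)" for n
  proof (induction n)
    case 0
    have "?S 0 \<subseteq> Bound ` UNIV \<union> Free ` H"
    proof
      fix t assume "t \<in> ?S 0"
      then show "t \<in> Bound ` UNIV \<union> Free ` H" by (cases t) (auto simp: terms_over_def)
    qed
    then show ?case by (rule le_subset[OF le_Un[OF le_image[OF le_nat] le_image[OF assms(2)]]])
  next
    case (Suc n)
    \<comment> \<open>Terms are counted by size: one of size at most \<open>Suc n\<close> is an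
      index, a variable, or a symbol applied to a list of terms of size at most
      \<open>n\<close>.\<close>
    have "?S (Suc n) \<subseteq> Bound ` UNIV \<union> Free ` H \<union> (\<lambda>(f, ts). App f ts) ` (funs L \<times> lists (?S n))"
    proof
      fix t assume t: "t \<in> ?S (Suc n)"
      show "t \<in> Bound ` UNIV \<union> Free ` H \<union> (\<lambda>(f, ts). App f ts) ` (funs L \<times> lists (?S n))"
      proof (cases t)
        case (App f ts)
        have "u \<in> ?S n" if "u \<in> set ts" for u
        proof -
          have "size u \<le> size_list size ts" using that by (rule size_list_estimation') simp
          then show ?thesis using t that App by (auto simp: terms_over_def)
        qed
        then have "ts \<in> lists (?S n)" by blast
        moreover have "f \<in> funs L" using t App by (auto simp: terms_over_def)
        ultimately show ?thesis using App by force
      qed (use t in \<open>auto simp: terms_over_def\<close>)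
    qed
    then show ?case
      by (rule le_subset[OF le_Un[OF le_Un[OF le_image[OF le_nat] le_image[OF assms(2)]]
              le_image[OF le_Times[OF assms(1) le_lists[OF Suc]]]]])
  qed
  show ?thesis by (rule le_subset[OF le_UN[OF le_nat *]]) auto
qed

lemma le_formulas_over:
  fixes H :: "'v set" and L :: "('f, 'r) lang"
  assumes "le (funs L)" "le (rels L)" "le H"
  shows "le {\<phi> :: ('f, 'r, 'v) fo_formula. (\<exists>n. wf_formula L n \<phi>) \<and> fv \<phi> \<subseteq> H}" (is "le ?F")
proof -
  let ?S = "\<lambda>n. {\<phi> \<in> ?F. size \<phi> < n}"
  let ?T = "terms_over L H"
  have T: "le ?T" using le_terms_over assms by blast
  have *: "le (?S n)" for n
  proof (induction n)
    case 0
    then show ?case by (simp add: card_of_empty)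
  next
    case (Suc n)
    let ?R = "(\<lambda>(s, t). Equal s t) ` (?T \<times> ?T) \<union> (\<lambda>(r, ts). Rel r ts) ` (rels L \<times> lists ?T) \<union>
      Neg ` ?S n \<union> (\<lambda>(\<phi>, \<psi>). Conj \<phi> \<psi>) ` (?S n \<times> ?S n) \<union> Ex ` ?S n"
    have "?S (Suc n) \<subseteq> ?R"
    proof
      fix \<phi> assume \<phi>: "\<phi> \<in> ?S (Suc n)"
      then obtain k where k: "wf_formula L k \<phi>" by auto
      show "\<phi> \<in> ?R"
      proof (cases \<phi>)
        case (Equal s t)
        then have "s \<in> ?T" "t \<in> ?T" using \<phi> k by (auto simp: terms_over_def)
        then show ?thesis using Equal by force
      next
        case (Rel r ts)
        then have "ts \<in> lists ?T" "r \<in> rels L" using \<phi> k by (auto simp: terms_over_def)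
        then show ?thesis using Rel by force
      next
        case (Neg \<psi>)
        then show ?thesis using \<phi> by force
      next
        case (Conj \<psi> \<chi>)
        then have "\<psi> \<in> ?S n" "\<chi> \<in> ?S n" using \<phi> k by auto
        then show ?thesis using Conj by force
      next
        case (Ex \<psi>)
        then have "\<psi> \<in> ?S n" using \<phi> k by auto
        then show ?thesis using Ex by force
      qed
    qed
    moreover have "le ?R"
      by (intro le_Un le_image le_Times T le_lists assms Suc)
    ultimately show ?case using le_subset by blast
  qed
  show ?thesis by (rule le_subset[OF le_UN[OF le_nat *]]) auto
qed

end

section \<open>Small sets, automorphisms and saturation\<close>

context monster
begin

lemma infinite_Field_\<kappa>: "infinite (Field \<kappa>)"
proof -
  have "natLeq \<le>o |Field \<kappa>|"
    using \<kappa>_uncountable card_of_Field_ordIso[OF Card_order_\<kappa>]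
    by (meson ordIso_symmetric ordLeq_ordIso_trans ordLess_imp_ordLeq)
  then show ?thesis using infinite_iff_natLeq_ordLeq by blast
qed

lemma small_finite [simp]: "finite A \<Longrightarrow> small A"
  unfolding small_def using \<kappa>_uncountable by (meson finite_iff_ordLess_natLeq ordLess_transitive)

lemma small_nat [simp]: "small (A :: nat set)"
  unfolding small_def using \<kappa>_uncountable card_of_nat card_of_mono1[of A UNIV]
  by (meson ordIso_ordLess_trans ordLeq_ordLess_trans subset_UNIV)

lemma small_subset: "small A \<Longrightarrow> B \<subseteq> A \<Longrightarrow> small B"
  unfolding small_def using card_of_mono1 ordLeq_ordLess_trans by blast

lemma small_image [simp]: "small A \<Longrightarrow> small (f ` A)"
  unfolding small_def using card_of_image ordLeq_ordLess_trans by blast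

lemma small_Un [simp]: "small (A \<union> B) \<longleftrightarrow> small A \<and> small B"
  using small_subset[of "A \<union> B"] card_of_Un_ordLess_infinite_Field[OF infinite_Field_\<kappa> Card_order_\<kappa>]
  unfolding small_def by blast

lemma small_Plus: "small A \<Longrightarrow> small B \<Longrightarrow> small (A <+> B)"
  unfolding Plus_def by simp

lemma small_le: "small A \<Longrightarrow> |B| \<le>o |A| \<Longrightarrow> small B"
  unfolding small_def using ordLeq_ordLess_trans by blast

lemma small_Times [simp]:
  assumes "small A" "small B"
  shows "small (A \<times> B)"
proof -
  \<comment> \<open>The natural numbers are added so that the bound is infinite even when both sets
    are finite.\<close>
  let ?D = "(A <+> B) <+> (UNIV :: nat set)"
  interpret infinite_bound ?D by unfold_locales simp
  have "le A" "le B"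
    by (rule ordLeq_transitive[OF card_of_Plus1 card_of_Plus1], rule ordLeq_transitive[OF card_of_Plus2 card_of_Plus1])
  then have "le (A \<times> B)" by (rule le_Times)
  then show ?thesis by (rule small_le[rotated]) (intro small_Plus assms small_nat)
qed

lemma small_UN_image: "small I \<Longrightarrow> small V \<Longrightarrow> small (\<Union>i\<in>I. s i ` V)"
  by (rule small_subset[of "(\<lambda>(i, v). s i v) ` (I \<times> V)"]) auto

lemma small_inj:
  assumes "small B"
  obtains f :: "'b \<Rightarrow> 'k" where "inj_on f B"
proof -
  have "|B| \<le>o |Field \<kappa>|"
    using assms card_of_Field_ordIso[OF Card_order_\<kappa>] unfolding small_def
    by (meson ordIso_symmetric ordLeq_ordIso_trans ordLess_imp_ordLeq)
  then show thesis using that card_of_ordLeq[of B "Field \<kappa>"] by blast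
qed

text \<open>A small set is no larger than the field of \<kappa>, which consists of labels. This is
  the passage between Kim-independence, stated for sets, and Kim-dividing, stated for labelled
  tuples.\<close>

lemma small_enum:
  assumes "small B"
  obtains V :: "'k set" and b where "small V" "b ` V = B" "inj_on b V"
proof -
  obtain f :: "'b \<Rightarrow> 'k" where "inj_on f B" using small_inj[OF assms] .
  then show thesis using that[of "f ` B" "inv_into B f"] assms by (auto simp: inj_on_inv_into image_image)
qed

section \<open>Pointwise stabilizers and orbits\<close>

definition stab :: "'a set \<Rightarrow> ('a \<Rightarrow> 'a) set" where
  "stab C = {\<sigma>. automorphism L \<MM> \<sigma> \<and> (\<forall>x\<in>C. \<sigma> x = x)}"

lemma stab_fix: "\<sigma> \<in> stab C \<Longrightarrow> x \<in> C \<Longrightarrow> \<sigma> x = x"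
  by (simp add: stab_def)

lemma stab_mono: "\<sigma> \<in> stab C \<Longrightarrow> D \<subseteq> C \<Longrightarrow> \<sigma> \<in> stab D"
  by (auto simp: stab_def)

lemma stab_image: "\<sigma> \<in> stab C \<Longrightarrow> A \<subseteq> C \<Longrightarrow> \<sigma> ` A = A"
  by (force simp: stab_def)

lemma stab_bij: "\<sigma> \<in> stab C \<Longrightarrow> bij \<sigma>"
  using universe by (auto simp: stab_def automorphism_def)

lemma stab_id [simp]: "id \<in> stab C"
  by (simp add: stab_def automorphism_def)

lemma stab_ifun: "\<sigma> \<in> stab C \<Longrightarrow> f \<in> funs L \<Longrightarrow> length xs = fun_ar L f \<Longrightarrow> \<sigma> (ifun \<MM> f xs) = ifun \<MM> f (map \<sigma> xs)"
  unfolding stab_def automorphism_def universe by blast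

lemma stab_irel: "\<sigma> \<in> stab C \<Longrightarrow> r \<in> rels L \<Longrightarrow> length xs = rel_ar L r \<Longrightarrow> irel \<MM> r (map \<sigma> xs) = irel \<MM> r xs"
  unfolding stab_def automorphism_def universe by blast

lemma stabI:
  assumes "bij \<sigma>" "\<And>f xs. f \<in> funs L \<Longrightarrow> length xs = fun_ar L f \<Longrightarrow> \<sigma> (ifun \<MM> f xs) = ifun \<MM> f (map \<sigma> xs)"
    "\<And>r xs. r \<in> rels L \<Longrightarrow> length xs = rel_ar L r \<Longrightarrow> irel \<MM> r (map \<sigma> xs) = irel \<MM> r xs"
    "\<And>x. x \<in> C \<Longrightarrow> \<sigma> x = x"
  shows "\<sigma> \<in> stab C"
  unfolding stab_def automorphism_def universe using assms by blast

lemma stab_comp: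
  assumes "\<sigma> \<in> stab C" "\<tau> \<in> stab C"
  shows "\<sigma> \<circ> \<tau> \<in> stab C"
proof (rule stabI)
  show "bij (\<sigma> \<circ> \<tau>)" using assms stab_bij bij_comp by blast
  show "(\<sigma> \<circ> \<tau>) (ifun \<MM> f xs) = ifun \<MM> f (map (\<sigma> \<circ> \<tau>) xs)"
    if "f \<in> funs L" "length xs = fun_ar L f" for f xs
    using stab_ifun[OF assms(1), of f "map \<tau> xs"] stab_ifun[OF assms(2) that] that by simp
  show "irel \<MM> r (map (\<sigma> \<circ> \<tau>) xs) = irel \<MM> r xs" if "r \<in> rels L" "length xs = rel_ar L r" for r xs
    using stab_irel[OF assms(1), of r "map \<tau> xs"] stab_irel[OF assms(2) that] that by simp
  show "(\<sigma> \<circ> \<tau>) x = x" if "x \<in> C" for x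
    using that stab_fix[OF assms(1)] stab_fix[OF assms(2)] by simp
qed

lemma stab_inv:
  assumes "\<sigma> \<in> stab C"
  shows "inv \<sigma> \<in> stab C"
proof (rule stabI)
  have b: "bij \<sigma>" using assms by (rule stab_bij)
  have m: "map \<sigma> (map (inv \<sigma>) xs) = xs" for xs
    using b by (simp add: bij_is_surj surj_f_inv_f map_idI)
  show "bij (inv \<sigma>)" using b by (rule bij_imp_bij_inv)
  show "inv \<sigma> (ifun \<MM> f xs) = ifun \<MM> f (map (inv \<sigma>) xs)" if "f \<in> funs L" "length xs = fun_ar L f" for f xs
    using stab_ifun[OF assms that(1), of "map (inv \<sigma>) xs"] that(2) b m[of xs]
    by (metis bij_inv_eq_iff length_map)
  show "irel \<MM> r (map (inv \<sigma>) xs) = irel \<MM> r xs" if "r \<in> rels L" "length xs = rel_ar L r" for r xs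
    using stab_irel[OF assms that(1), of "map (inv \<sigma>) xs"] that(2) m[of xs] by (metis length_map)
  show "inv \<sigma> x = x" if "x \<in> C" for x
    using assms that b by (metis bij_inv_eq_iff stab_fix)
qed

lemma sat_stab: "\<sigma> \<in> stab C \<Longrightarrow> wf_formula L 0 \<phi> \<Longrightarrow> sat \<MM> (\<sigma> \<circ> \<rho>) [] \<phi> = sat \<MM> \<rho> [] \<phi>"
  using sat_automorphism[of L \<MM> \<sigma> "[]" \<phi> \<rho>] universe by (simp add: stab_def)

lemma holds_stab:
  assumes "\<sigma> \<in> stab C" "\<phi> \<in> formulas L V C"
  shows "holds \<MM> (\<sigma> \<circ> a) \<phi> = holds \<MM> a \<phi>"
proof -
  have "sat \<MM> (case_sum (\<sigma> \<circ> a) id) [] \<phi> = sat \<MM> (\<sigma> \<circ> case_sum a id) [] \<phi>"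
    by (rule sat_cong) (use assms in \<open>auto simp: formulas_def stab_def split: sum.split\<close>)
  then show ?thesis using sat_stab[OF assms(1), of \<phi> "case_sum a id"] assms(2) by (simp add: holds_def formulas_def del: o_apply)
qed

text \<open>Moving variables and parameters together preserves truth; the parameters of the formula
  need not be fixed by \<sigma>.\<close>

lemma holds_push:
  assumes "\<sigma> \<in> stab C" "wf_formula L 0 \<phi>"
  shows "holds \<MM> (\<sigma> \<circ> a) (map_fo_formula (map_sum id \<sigma>) \<phi>) = holds \<MM> a \<phi>"
proof -
  have "case_sum (\<sigma> \<circ> a) id \<circ> map_sum id \<sigma> = \<sigma> \<circ> case_sum a id"
    by (auto simp: fun_eq_iff split: sum.split)
  then show ?thesis using sat_stab[OF assms, of "case_sum a id"] by (simp add: holds_map del: o_apply) (simp add: holds_def)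
qed

lemma tp_stabI:
  assumes "\<sigma> \<in> stab C" "\<And>v. v \<in> V \<Longrightarrow> a' v = \<sigma> (a v)"
  shows "tp L \<MM> C V a' = tp L \<MM> C V a"
proof -
  have "tp L \<MM> C V a' = tp L \<MM> C V (\<sigma> \<circ> a)" by (rule tp_cong) (use assms in auto)
  then show ?thesis using holds_stab[OF assms(1)] by (auto simp: tp_eq_iff)
qed

text \<open>Homogeneity is available for sets with their identity enumeration, so the two tuples are
  first turned into one map on the union of \<open>C\<close> and the entries of \<open>a\<close>.
  Equality formulas in the type show that this map respects repeated entries and entries lying in
  \<open>C\<close>.\<close>

lemma tp_stabD:
  assumes C: "small C" "small V" and eq: "tp L \<MM> C V a = tp L \<MM> C V a'"
  obtains \<sigma> where "\<sigma> \<in> stab C" "\<And>v. v \<in> V \<Longrightarrow> \<sigma> (a v) = a' v"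
proof -
  define pick where "pick y = (SOME v. v \<in> V \<and> a v = y)" for y
  have pick: "pick (a v) \<in> V \<and> a (pick (a v)) = a v" if "v \<in> V" for v
    unfolding pick_def by (rule someI[of _ v]) (use that in auto)
  define f where "f y = (if y \<in> C then y else a' (pick y))" for y
  let ?A = "C \<union> a ` V"
  have "holds \<MM> id \<phi> = holds \<MM> f \<phi>" if \<phi>: "\<phi> \<in> formulas L ?A {}" for \<phi>
  proof -
    define g where "g = case_sum (\<lambda>y. if y \<in> C then Inr y else Inl (pick y)) Inr"
    have g: "map_fo_formula g \<phi> \<in> formulas L V C"
      using \<phi> by (rule formulas_map) (use pick in \<open>auto simp: g_def\<close>)
    have fv: "\<exists>y\<in>?A. u = Inl y" if "u \<in> fv \<phi>" for u
      using that \<phi> by (auto simp: formulas_def)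
    have "holds \<MM> a (map_fo_formula g \<phi>) = holds \<MM> id \<phi>"
      unfolding holds_map unfolding holds_def by (rule sat_cong) (use fv pick in \<open>fastforce simp: g_def\<close>)
    moreover have "holds \<MM> a' (map_fo_formula g \<phi>) = holds \<MM> f \<phi>"
      unfolding holds_map unfolding holds_def by (rule sat_cong) (use fv in \<open>fastforce simp: g_def f_def\<close>)
    ultimately show ?thesis using tp_eqD[OF eq g] by simp
  qed
  then have "tp L \<MM> {} ?A id = tp L \<MM> {} ?A f" by (simp add: tp_eq_iff)
  moreover have "|?A| <o \<kappa>" using C by (simp flip: small_def)
  ultimately obtain \<sigma> where \<sigma>: "automorphism L \<MM> \<sigma>" "\<And>x. x \<in> ?A \<Longrightarrow> \<sigma> x = f x"
    using strongly_homogeneous by metis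
  have "\<sigma> (a v) = a' v" if v: "v \<in> V" for v
  proof (cases "a v \<in> C")
    case True
    have "Equal (Free (Inl v)) (Free (Inr (a v))) \<in> formulas L V C"
      using v True by (auto simp: formulas_def)
    from tp_eqD[OF eq this] show ?thesis using True \<sigma>(2)[of "a v"] by (simp add: holds_def f_def)
  next
    case False
    have "Equal (Free (Inl (pick (a v)))) (Free (Inl v)) \<in> formulas L V C"
      using v pick[OF v] by (auto simp: formulas_def)
    from tp_eqD[OF eq this] show ?thesis using False \<sigma>(2)[of "a v"] v pick[OF v] by (simp add: holds_def f_def)
  qed
  moreover have "\<sigma> \<in> stab C" using \<sigma> by (auto simp: stab_def f_def)
  ultimately show thesis using that by blast
qed

lemma tp_conjugate:
  assumes "small C" "small V" "\<sigma> \<in> stab D" "tp L \<MM> C V a = tp L \<MM> C V a'"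
  shows "tp L \<MM> (\<sigma> ` C) V (\<sigma> \<circ> a) = tp L \<MM> (\<sigma> ` C) V (\<sigma> \<circ> a')"
proof -
  obtain \<tau> where \<tau>: "\<tau> \<in> stab C" "\<And>v. v \<in> V \<Longrightarrow> \<tau> (a v) = a' v"
    using tp_stabD[OF assms(1,2,4)] by blast
  have i: "inv \<sigma> (\<sigma> x) = x" for x using stab_bij[OF assms(3)] by (simp add: bij_is_inj inv_f_f)
  \<comment> \<open>Conjugation by \<sigma> carries an automorphism fixing \<open>C\<close> to one
    fixing the image of \<open>C\<close>.\<close>
  have "\<sigma> \<circ> \<tau> \<circ> inv \<sigma> \<in> stab {}"
    using stab_comp stab_mono stab_inv assms(3) \<tau>(1) empty_subsetI by metis
  then have "\<sigma> \<circ> \<tau> \<circ> inv \<sigma> \<in> stab (\<sigma> ` C)" using \<tau>(1) i by (auto simp: stab_def)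
  then show ?thesis by (intro tp_stabI[symmetric]) (auto simp: i \<tau>(2))
qed

lemma conj_formula:
  assumes "finite \<Psi>" "\<Psi> \<subseteq> formulas L V C"
  obtains \<chi> where "\<chi> \<in> formulas L V C" "\<And>a. holds \<MM> a \<chi> \<longleftrightarrow> (\<forall>\<psi>\<in>\<Psi>. holds \<MM> a \<psi>)"
proof -
  obtain \<chi> where \<chi>: "wf_formula L 0 \<chi>" "fv \<chi> \<subseteq> (\<Union>\<psi>\<in>\<Psi>. fv \<psi>)"
    "\<forall>\<rho>. sat \<MM> \<rho> [] \<chi> \<longleftrightarrow> (\<forall>\<psi>\<in>\<Psi>. sat \<MM> \<rho> [] \<psi>)"
    using ex_conj[OF assms(1), of L \<MM>] assms(2) universe by (auto simp: formulas_def)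
  have "\<chi> \<in> formulas L V C" using \<chi>(1,2) assms(2) by (auto simp: formulas_def)
  then show thesis using that \<chi>(3) by (auto simp: holds_def)
qed

section \<open>Realizing types in small tuples of variables\<close>

lemma type_ex_formula:
  fixes v :: 'x
  assumes p: "type_over L \<MM> C V p" and \<chi>: "\<chi> \<in> p" and v: "v \<in> V"
  obtains \<chi>' where "\<chi>' \<in> p" "fv \<chi>' = fv \<chi> - {Inl v}" "\<And>a. holds \<MM> a \<chi>' \<longleftrightarrow> (\<exists>x. holds \<MM> (a(v := x)) \<chi>)"
proof -
  let ?\<chi> = "Ex (bind_formula (Inl v) 0 \<chi>)"
  have wf: "wf_formula L 0 \<chi>" "\<chi> \<in> formulas L V C" using p \<chi> by (auto simp: type_over_def formulas_def)
  have F: "?\<chi> \<in> formulas L V C" using wf by (auto simp: formulas_def wf_bind_formula fv_bind_formula)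
  have h: "holds \<MM> a ?\<chi> \<longleftrightarrow> (\<exists>x. holds \<MM> (a(v := x)) \<chi>)" for a
  proof -
    have "(case_sum a id)(Inl v := x) = case_sum (a(v := x)) id" for x :: 'a
      by (auto simp: fun_eq_iff split: sum.split)
    then show ?thesis
      using sat_bind_formula[of L "[]" \<chi> \<MM> "case_sum a id" _ "Inl v"] wf(1) universe by (simp add: holds_def)
  qed
  have "?\<chi> \<in> p"
  proof (rule type_over_closed[OF p, of "{\<chi>}"])
    show "holds \<MM> a ?\<chi>" if "\<forall>\<psi>\<in>{\<chi>}. holds \<MM> a \<psi>" for a
      unfolding h using that by (intro exI[of _ "a v"]) simp
  qed (use \<chi> F in auto)
  then show thesis using that[of ?\<chi>] h by (simp add: fv_bind_formula)
qed

lemma type_over_sat: "type_over L A C V p \<Longrightarrow> \<phi> \<in> p \<Longrightarrow> \<exists>b. holds A b \<phi>"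
  unfolding type_over_def consistent_def by (drule conjunct2, drule conjunct1, drule spec[of _ "{\<phi>}"]) auto

text \<open>Saturation is given for one variable only. The variables are well-ordered and their
  values chosen by transfinite recursion so that, at stage \<open>v\<close>, all formulas of
  \<open>p\<close> in variables up to \<open>v\<close> hold.\<close>

lemma realize_type:
  fixes p :: "('f, 'r, 'x + 'a) fo_formula set"
  assumes p: "type_over L \<MM> C V p" and C: "small C" and V: "small V"
  obtains a where "tp L \<MM> C V a = p"
proof -
  let ?r = "|V|"
  have W: "Well_order ?r" "Field ?r = V" by (simp_all add: card_of_well_order_on Field_card_of)
  then have Lin: "Linear_order ?r" by (simp add: well_order_on_def)
  define S where "S v = underS ?r v" for v
  have SV: "S v \<subseteq> V" for v unfolding S_def using W(2) by (auto simp: underS_def Field_def)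
  define P where "P f v x \<longleftrightarrow> (v \<in> V \<longrightarrow> (\<forall>\<phi>\<in>p. fv \<phi> \<subseteq> insert v (S v) <+> C \<longrightarrow> holds \<MM> (f(v := x)) \<phi>))" for f v x
  have "\<exists>f. \<forall>v. P f v (f v)"
  proof (rule dependent_wf_choice)
    show "wf (?r - Id)" using W(1) by (simp add: well_order_on_def)
    show "P f v x = P g v x" if fg: "\<And>w. (w, v) \<in> ?r - Id \<Longrightarrow> f w = g w" for f g v x
    proof -
      have "holds \<MM> (f(v := x)) \<phi> = holds \<MM> (g(v := x)) \<phi>" if "fv \<phi> \<subseteq> insert v (S v) <+> C" for \<phi> :: "('f, 'r, 'x + 'a) fo_formula"
        by (rule holds_cong) (use that fg in \<open>auto simp: S_def underS_def\<close>)
      then show ?thesis by (auto simp: P_def)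
    qed
    show "\<exists>x. P f v x" if IH: "\<And>w. (w, v) \<in> ?r - Id \<Longrightarrow> P f w (f w)" for f v
    proof (cases "v \<in> V")
      case v: True
      \<comment> \<open>A formula in earlier variables was secured at the stage of its largest
        variable; one without variables has a truth value independent of the assignment.\<close>
      have below: "holds \<MM> f \<phi>" if "\<phi> \<in> p" "fv \<phi> \<subseteq> S v <+> C" for \<phi>
      proof (cases "Inl -` fv \<phi> = {}")
        case True
        obtain b where "holds \<MM> b \<phi>"
          using type_over_sat[OF p \<open>\<phi> \<in> p\<close>] by blast
        moreover have "holds \<MM> b \<phi> = holds \<MM> f \<phi>" by (rule holds_cong) (use True in auto)
        ultimately show ?thesis by simp
      next
        case False
        have F: "finite (Inl -` fv \<phi>)" "Inl -` fv \<phi> \<subseteq> S v" using that(2) by (auto simp: finite_vimageI)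
        obtain w where w: "w \<in> Inl -` fv \<phi>" "\<forall>x\<in>Inl -` fv \<phi>. (x, w) \<in> ?r"
          using finite_max_Linear_order[OF Lin F(1) False] F(2) SV W(2) by blast
        have "w \<in> S v" using w F by auto
        then have "P f w (f w)" using IH by (auto simp: S_def underS_def)
        moreover have "fv \<phi> \<subseteq> insert w (S w) <+> C" using w that(2) by (fastforce simp: S_def underS_def)
        ultimately show ?thesis using that(1) SV[of v] \<open>w \<in> S v\<close> by (auto simp: P_def)
      qed
      \<comment> \<open>Variable \<open>v\<close> becomes the single variable, and the earlier ones
        are replaced by the values already chosen.\<close>
      define g where "g = case_sum (\<lambda>w. if w = v then Inl () else Inr (f w)) (Inr :: 'a \<Rightarrow> unit + 'a)"
      have g: "holds \<MM> c (map_fo_formula g \<phi>) = holds \<MM> (f(v := c ())) \<phi>" for c and \<phi> :: "('f, 'r, 'x + 'a) fo_formula"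
      proof -
        have "case_sum c id \<circ> g = case_sum (f(v := c ())) id" by (auto simp: fun_eq_iff g_def split: sum.split)
        then show ?thesis by (simp add: holds_map) (simp add: holds_def)
      qed
      define \<Phi> where "\<Phi> = map_fo_formula g ` {\<phi> \<in> p. fv \<phi> \<subseteq> insert v (S v) <+> C}"
      have "\<Phi> \<subseteq> formulas L UNIV (C \<union> f ` S v)"
      proof
        fix \<psi> assume "\<psi> \<in> \<Phi>"
        then obtain \<phi> where \<phi>: "\<phi> \<in> p" "fv \<phi> \<subseteq> insert v (S v) <+> C" "\<psi> = map_fo_formula g \<phi>"
          by (auto simp: \<Phi>_def)
        then have "\<phi> \<in> formulas L (insert v (S v)) C" using p by (auto simp: type_over_def formulas_def)
        then show "\<psi> \<in> formulas L UNIV (C \<union> f ` S v)"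
          unfolding \<phi>(3) by (rule formulas_map) (auto simp: g_def)
      qed
      moreover have "consistent \<MM> \<Phi>"
        unfolding consistent_def
      proof (intro allI impI)
        fix \<Psi> assume "\<Psi> \<subseteq> \<Phi>" "finite \<Psi>"
        then obtain \<Psi>' where \<Psi>': "finite \<Psi>'" "\<Psi>' \<subseteq> {\<phi> \<in> p. fv \<phi> \<subseteq> insert v (S v) <+> C}" "\<Psi> = map_fo_formula g ` \<Psi>'"
          unfolding \<Phi>_def by (meson finite_subset_image)
        then have "\<Psi>' \<subseteq> formulas L (insert v (S v)) C" using p by (auto simp: type_over_def formulas_def)
        then obtain \<chi> where \<chi>: "\<chi> \<in> formulas L (insert v (S v)) C" "\<And>a. holds \<MM> a \<chi> \<longleftrightarrow> (\<forall>\<psi>\<in>\<Psi>'. holds \<MM> a \<psi>)"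
          using conj_formula \<Psi>'(1) by blast
        have "\<chi> \<in> p"
        proof (rule type_over_closed[OF p \<Psi>'(1)])
          show "\<chi> \<in> formulas L V C" by (rule formulas_mono[OF \<chi>(1)]) (use v SV in auto)
        qed (use \<Psi>'(2) \<chi>(2) in auto)
        \<comment> \<open>Quantifying \<open>v\<close> away leaves a formula of \<open>p\<close> in
          earlier variables, which already holds; its witness satisfies the finite part.\<close>
        then obtain \<chi>' where \<chi>': "\<chi>' \<in> p" "fv \<chi>' = fv \<chi> - {Inl v}" "\<And>a. holds \<MM> a \<chi>' \<longleftrightarrow> (\<exists>x. holds \<MM> (a(v := x)) \<chi>)"
          using type_ex_formula[OF p _ v] by blast
        have "holds \<MM> f \<chi>'" by (rule below) (use \<chi>' \<chi>(1) in \<open>auto simp: formulas_def\<close>)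
        then obtain x where "\<forall>\<psi>\<in>\<Psi>'. holds \<MM> (f(v := x)) \<psi>" using \<chi>' \<chi> by auto
        then have "\<forall>\<psi>\<in>\<Psi>. holds \<MM> (\<lambda>_. x) \<psi>" unfolding \<Psi>'(3) by (auto simp: g)
        then show "\<exists>a. \<forall>\<psi>\<in>\<Psi>. holds \<MM> a \<psi>" by blast
      qed
      moreover have "|C \<union> f ` S v| <o \<kappa>" using C small_subset[OF V SV] by (simp flip: small_def)
      ultimately obtain c where "\<forall>\<phi>\<in>\<Phi>. holds \<MM> c \<phi>" using saturated by blast
      then show ?thesis by (auto simp: P_def \<Phi>_def g)
    qed (auto simp: P_def)
  qed
  then obtain f where f: "\<And>v. P f v (f v)" by blast
  have "holds \<MM> f \<phi>" if \<phi>: "\<phi> \<in> p" for \<phi>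
  proof (cases "Inl -` fv \<phi> = {}")
    case True
    obtain b where "holds \<MM> b \<phi>"
      using type_over_sat[OF p \<open>\<phi> \<in> p\<close>] by blast
    moreover have "holds \<MM> b \<phi> = holds \<MM> f \<phi>" by (rule holds_cong) (use True in auto)
    ultimately show ?thesis by simp
  next
    case False
    have fv: "fv \<phi> \<subseteq> V <+> C" using p \<phi> by (auto simp: type_over_def formulas_def)
    have F: "finite (Inl -` fv \<phi>)" "Inl -` fv \<phi> \<subseteq> V" using fv by (auto simp: finite_vimageI)
    obtain w where w: "w \<in> Inl -` fv \<phi>" "\<forall>x\<in>Inl -` fv \<phi>. (x, w) \<in> ?r"
      using finite_max_Linear_order[OF Lin F(1) False] F(2) W(2) by blast
    have "fv \<phi> \<subseteq> insert w (S w) <+> C" using w fv by (fastforce simp: S_def underS_def)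
    then show ?thesis using \<phi> f[of w] w F by (auto simp: P_def)
  qed
  then have "p \<subseteq> tp L \<MM> C V f" using p by (auto simp: tp_def type_over_def)
  then show thesis using that tp_eq_type[OF p] by metis
qed

lemma realize_consistent:
  assumes "\<Phi> \<subseteq> formulas L V C" "consistent \<MM> \<Phi>" "small C" "small V"
  obtains a where "\<And>\<phi>. \<phi> \<in> \<Phi> \<Longrightarrow> holds \<MM> a \<phi>"
proof -
  obtain p where p: "\<Phi> \<subseteq> p" "type_over L \<MM> C V p" using consistent_extend[OF assms(1,2)] .
  obtain a where "tp L \<MM> C V a = p" using realize_type[OF p(2) assms(3,4)] .
  then show thesis using that[of a] p(1) by (auto simp: tp_def)
qed

end

section \<open>Small elementary submodels\<close>

lemma finite_subset_chain:
  fixes N :: "nat \<Rightarrow> 'b set"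
  assumes "mono N" "finite F" "F \<subseteq> (\<Union>n. N n)"
  obtains n where "F \<subseteq> N n"
proof -
  have "\<exists>n. F \<subseteq> N n" using assms(2,3)
  proof (induction rule: finite_induct)
    case (insert x F)
    then obtain m n where "F \<subseteq> N m" "x \<in> N n" by auto
    moreover have "N m \<subseteq> N (max m n)" "N n \<subseteq> N (max m n)" using assms(1) by (simp_all add: monoD)
    ultimately show ?case by blast
  qed simp
  then show thesis using that by blast
qed

context monster
begin

text \<open>Parameters occur in two ways: as free variables evaluated by \<open>id\<close>, and as
  values \<open>bs\<close> of indices. The latter make the test applicable under quantifiers in the
  induction for \<open>sat_sub\<close>.\<close>

definition Tarski_Vaught :: "'a set \<Rightarrow> bool" where
  "Tarski_Vaught N \<longleftrightarrow> (\<forall>(\<phi> :: ('f, 'r, 'a) fo_formula) bs. wf_formula L (Suc (length bs)) \<phi> \<longrightarrow> fv \<phi> \<subseteq> N \<longrightarrow>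
     set bs \<subseteq> N \<longrightarrow> (\<exists>x. sat \<MM> id (x # bs) \<phi>) \<longrightarrow> (\<exists>x\<in>N. sat \<MM> id (x # bs) \<phi>))"

lemma Tarski_VaughtD:
  assumes "Tarski_Vaught N" "wf_formula L (Suc (length bs)) \<phi>" "\<rho> ` fv \<phi> \<subseteq> N" "set bs \<subseteq> N" "sat \<MM> \<rho> (x # bs) \<phi>"
  shows "\<exists>x\<in>N. sat \<MM> \<rho> (x # bs) \<phi>"
  using assms(1)[unfolded Tarski_Vaught_def, rule_format, of bs "map_fo_formula \<rho> \<phi>"] assms(2-)
  by (auto simp: sat_map fo_formula.set_map)

lemma eval_sub: "eval (sub N) \<rho> bs t = eval \<MM> \<rho> bs t"
  by (induction t) (auto simp: sub_def intro!: arg_cong[where f = "ifun \<MM> _"])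

lemma sat_sub:
  assumes "Tarski_Vaught N"
  shows "wf_formula L (length bs) \<phi> \<Longrightarrow> \<rho> ` fv \<phi> \<subseteq> N \<Longrightarrow> set bs \<subseteq> N \<Longrightarrow> sat (sub N) \<rho> bs \<phi> = sat \<MM> \<rho> bs \<phi>"
proof (induction \<phi> arbitrary: bs)
  case (Equal s t)
  then show ?case by (simp add: eval_sub)
next
  case (Rel r ts)
  have "map (eval (sub N) \<rho> bs) ts = map (eval \<MM> \<rho> bs) ts" by (simp add: eval_sub)
  moreover have "irel (sub N) = irel \<MM>" by (simp add: sub_def)
  ultimately show ?case by (simp only: sat.simps)
next
  case (Ex \<phi>)
  have "sat (sub N) \<rho> (x # bs) \<phi> = sat \<MM> \<rho> (x # bs) \<phi>" if "x \<in> N" for x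
    using Ex that by simp
  moreover have "univ (sub N) = N" by (simp add: sub_def)
  ultimately show ?case using Tarski_VaughtD[OF assms, of bs \<phi> \<rho>] Ex.prems universe by auto
qed auto

lemma Tarski_Vaught_small_model:
  assumes "Tarski_Vaught N" "small N"
  shows "small_model N"
proof -
  have "\<exists>x\<in>N. True"
    using Tarski_VaughtD[OF assms(1), of "[]" "Equal (Bound 0) (Bound 0)"] by simp
  then have ne: "N \<noteq> {}" by blast
  have cl: "ifun \<MM> f xs \<in> N" if "f \<in> funs L" "length xs = fun_ar L f" "set xs \<subseteq> N" for f xs
  proof -
    have e: "map (eval \<MM> id [x]) (map Free xs) = xs" for x by (simp add: map_idI)
    \<comment> \<open>Closure under \<open>f\<close> is the test for the formula saying that the new
      element is the value of \<open>f\<close> at \<open>xs\<close>.\<close>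
    have "\<exists>x\<in>N. sat \<MM> id [x] (Equal (Bound 0) (App f (map Free xs)))"
      by (rule Tarski_VaughtD[OF assms(1), of "[]" _ _ "ifun \<MM> f xs"]) (use that e in \<open>auto simp del: map_map\<close>)
    then show ?thesis by (auto simp: map_idI comp_def)
  qed
  have "sat (sub N) \<rho> [] \<phi> = sat \<MM> \<rho> [] \<phi>" if "wf_formula L 0 \<phi>" "range \<rho> \<subseteq> N"
    for \<phi> :: "('f, 'r, nat) fo_formula" and \<rho>
    by (rule sat_sub[OF assms(1)]) (use that in auto)
  then have "elem_substruct L (sub N) \<MM>"
    using ne cl universe by (auto simp: elem_substruct_def is_struct_def sub_def)
  then show ?thesis using assms(2) by (simp add: small_model_def)
qed

lemma small_model_elem:
  assumes "small_model M" "small_model M'" "M \<subseteq> M'"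
  shows "elem_substruct L (sub M) (sub M')"
proof -
  have 1: "elem_substruct L (sub M) \<MM>" "elem_substruct L (sub M') \<MM>"
    using assms by (auto simp: small_model_def)
  have "sat (sub M) \<rho> [] \<phi> = sat (sub M') \<rho> [] \<phi>" if "wf_formula L 0 \<phi>" "range \<rho> \<subseteq> M"
    for \<phi> :: "('f, 'r, nat) fo_formula" and \<rho>
  proof -
    have "sat (sub M) \<rho> [] \<phi> = sat \<MM> \<rho> [] \<phi>"
      using 1(1) that unfolding elem_substruct_def by (simp add: sub_def)
    moreover have "sat (sub M') \<rho> [] \<phi> = sat \<MM> \<rho> [] \<phi>"
      using 1(2) that assms(3) unfolding elem_substruct_def by (simp add: sub_def)
    ultimately show ?thesis by simp
  qed
  then show ?thesis using 1 assms(3) by (auto simp: elem_substruct_def sub_def)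
qed

lemma Tarski_Vaught_stab:
  assumes "\<sigma> \<in> stab C" "Tarski_Vaught N"
  shows "Tarski_Vaught (\<sigma> ` N)"
  unfolding Tarski_Vaught_def
proof (intro allI impI)
  fix \<phi> :: "('f, 'r, 'a) fo_formula" and bs
  assume wf: "wf_formula L (Suc (length bs)) \<phi>" and fv: "fv \<phi> \<subseteq> \<sigma> ` N" and bs: "set bs \<subseteq> \<sigma> ` N"
    and ex: "\<exists>x. sat \<MM> id (x # bs) \<phi>"
  let ?\<tau> = "inv \<sigma>"
  have \<tau>: "automorphism L \<MM> ?\<tau>" using stab_inv[OF assms(1)] by (simp add: stab_def)
  have b: "bij \<sigma>" using assms(1) by (rule stab_bij)
  have i: "?\<tau> (\<sigma> x) = x" "\<sigma> (?\<tau> x) = x" for x using b by (simp_all add: bij_is_inj bij_is_surj surj_f_inv_f)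
  have s: "sat \<MM> ?\<tau> (?\<tau> x # map ?\<tau> bs) \<phi> = sat \<MM> id (x # bs) \<phi>" for x
    using sat_automorphism[OF \<tau> universe, of "x # bs" \<phi> id] wf by simp
  obtain x where "sat \<MM> ?\<tau> (?\<tau> x # map ?\<tau> bs) \<phi>" using ex s by blast
  moreover have "?\<tau> ` fv \<phi> \<subseteq> N" "set (map ?\<tau> bs) \<subseteq> N" using fv bs i by fastforce+
  ultimately obtain y where y: "y \<in> N" "sat \<MM> ?\<tau> (y # map ?\<tau> bs) \<phi>"
    using Tarski_VaughtD[OF assms(2), of "map ?\<tau> bs" \<phi> ?\<tau>] wf by fastforce
  then have "sat \<MM> id (\<sigma> y # bs) \<phi>" using s[of "\<sigma> y"] i by simp
  then show "\<exists>x\<in>\<sigma> ` N. sat \<MM> id (x # bs) \<phi>" using y by blast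
qed

lemma Tarski_Vaught_chain:
  fixes N :: "nat \<Rightarrow> 'a set"
  assumes "mono N" "\<And>n. Tarski_Vaught (N n)"
  shows "Tarski_Vaught (\<Union>n. N n)"
  unfolding Tarski_Vaught_def
proof (intro allI impI)
  fix \<phi> :: "('f, 'r, 'a) fo_formula" and bs
  assume *: "wf_formula L (Suc (length bs)) \<phi>" "fv \<phi> \<subseteq> (\<Union>n. N n)" "set bs \<subseteq> (\<Union>n. N n)"
    and ex: "\<exists>x. sat \<MM> id (x # bs) \<phi>"
  obtain n where "fv \<phi> \<union> set bs \<subseteq> N n"
    by (rule finite_subset_chain[OF assms(1), of "fv \<phi> \<union> set bs"]) (use * in auto)
  then have "\<exists>x\<in>N n. sat \<MM> id (x # bs) \<phi>" using assms(2)[of n] * ex unfolding Tarski_Vaught_def by auto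
  then show "\<exists>x\<in>(\<Union>n. N n). sat \<MM> id (x # bs) \<phi>" by blast
qed

text \<open>A Skolem hull with Hilbert choice supplying the Skolem functions. The witness depends
  only on the formula and its parameters, which makes the hull monotone; that is what turns hulls of
  growing sets into a chain of models. A value chosen for an unsatisfiable formula is just an
  arbitrary extra element.\<close>

primrec hull_level :: "'a set \<Rightarrow> nat \<Rightarrow> 'a set" where
  "hull_level A 0 = A"
| "hull_level A (Suc n) = hull_level A n \<union> (\<lambda>(\<phi>, bs). SOME x. sat \<MM> id (x # bs) \<phi>) `
     ({\<phi>. (\<exists>k. wf_formula L k \<phi>) \<and> fv \<phi> \<subseteq> hull_level A n} \<times> lists (hull_level A n))"

definition hull :: "'a set \<Rightarrow> 'a set" where
  "hull A = (\<Union>n. hull_level A n)"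

lemma hull_level_mono: "A \<subseteq> B \<Longrightarrow> hull_level A n \<subseteq> hull_level B n"
proof (induction n)
  case (Suc n)
  then have "hull_level A n \<subseteq> hull_level B n" by blast
  then have "{\<phi> :: ('f, 'r, 'a) fo_formula. (\<exists>k. wf_formula L k \<phi>) \<and> fv \<phi> \<subseteq> hull_level A n} \<times> lists (hull_level A n)
      \<subseteq> {\<phi>. (\<exists>k. wf_formula L k \<phi>) \<and> fv \<phi> \<subseteq> hull_level B n} \<times> lists (hull_level B n)"
    by (intro Sigma_mono lists_mono) auto
  then show ?case unfolding hull_level.simps
    by (rule Un_mono[OF \<open>hull_level A n \<subseteq> hull_level B n\<close> image_mono])
qed simp

lemma hull_mono: "A \<subseteq> B \<Longrightarrow> hull A \<subseteq> hull B"
  unfolding hull_def by (intro UN_mono order_refl hull_level_mono)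

lemma subset_hull: "A \<subseteq> hull A"
  unfolding hull_def by (rule order_trans[OF _ UN_upper[of 0]]) auto

lemma mono_hull_level: "mono (hull_level A)"
  unfolding mono_iff_le_Suc by simp

lemma Tarski_Vaught_hull: "Tarski_Vaught (hull A)"
  unfolding Tarski_Vaught_def
proof (intro allI impI)
  fix \<phi> :: "('f, 'r, 'a) fo_formula" and bs
  assume *: "wf_formula L (Suc (length bs)) \<phi>" "fv \<phi> \<subseteq> hull A" "set bs \<subseteq> hull A"
    and ex: "\<exists>x. sat \<MM> id (x # bs) \<phi>"
  obtain n where n: "fv \<phi> \<union> set bs \<subseteq> hull_level A n"
    by (rule finite_subset_chain[OF mono_hull_level, of "fv \<phi> \<union> set bs" A]) (use * in \<open>auto simp: hull_def\<close>)
  let ?x = "SOME x. sat \<MM> id (x # bs) \<phi>"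
  have "?x \<in> hull_level A (Suc n)"
    using n * by (auto intro!: image_eqI[of _ _ "(\<phi>, bs)"])
  then have "?x \<in> hull A" unfolding hull_def by blast
  then show "\<exists>x\<in>hull A. sat \<MM> id (x # bs) \<phi>" using someI_ex[OF ex] by blast
qed

lemma le_hull:
  assumes "infinite \<Lambda>" "|funs L| \<le>o |\<Lambda>|" "|rels L| \<le>o |\<Lambda>|" "|A| \<le>o |\<Lambda>|"
  shows "|hull A| \<le>o |\<Lambda>|"
proof -
  interpret infinite_bound \<Lambda> by unfold_locales fact
  have "le (hull_level A n)" for n
    by (induction n) (use assms in \<open>auto intro!: le_Un le_image le_Times le_lists le_formulas_over\<close>)
  then show ?thesis unfolding hull_def by (rule le_UN[OF le_nat])
qed

lemma small_bound:
  assumes "small A"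
  obtains \<Lambda> :: "(('b + 'f) + ('r + nat)) set" where "infinite \<Lambda>" "small \<Lambda>" "|funs L| \<le>o |\<Lambda>|" "|rels L| \<le>o |\<Lambda>|" "|A :: 'b set| \<le>o |\<Lambda>|"
proof
  let ?\<Lambda> = "(A <+> funs L) <+> (rels L <+> (UNIV :: nat set))"
  show "infinite ?\<Lambda>" by simp
  show "small ?\<Lambda>" using assms funs_small rels_small by (intro small_Plus) (auto simp: small_def[symmetric])
  show "|funs L| \<le>o |?\<Lambda>|" by (rule ordLeq_transitive[OF card_of_Plus2 card_of_Plus1])
  show "|rels L| \<le>o |?\<Lambda>|" by (rule ordLeq_transitive[OF card_of_Plus1 card_of_Plus2])
  show "|A| \<le>o |?\<Lambda>|" by (rule ordLeq_transitive[OF card_of_Plus1 card_of_Plus1])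
qed

lemma small_hull [simp]: "small A \<Longrightarrow> small (hull A)"
  using small_bound[of A] le_hull small_le by metis

section \<open>Invariant types and their Morley sequences\<close>

text \<open>The orbit form of \<open>M\<close>-invariance. One inclusion suffices because
  \<open>stab M\<close> is closed under inverses.\<close>

definition stab_invariant :: "'a set \<Rightarrow> ('f, 'r, 'x + 'a) fo_formula set \<Rightarrow> bool" where
  "stab_invariant M P \<longleftrightarrow> (\<forall>\<sigma>\<in>stab M. \<forall>\<phi>\<in>P. map_fo_formula (map_sum id \<sigma>) \<phi> \<in> P)"

lemma map_inst_stab:
  assumes "\<phi> \<in> formulas L X (V <+> M)" "\<sigma> \<in> stab M" "\<And>v. v \<in> V \<Longrightarrow> b' v = \<sigma> (b v)"
  shows "map_fo_formula (map_sum id \<sigma>) (inst b \<phi>) = inst b' \<phi>"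
  unfolding inst_def fo_formula.map_comp
  by (rule fo_formula.map_cong0) (use assms in \<open>auto simp: formulas_def stab_def\<close>)

lemma holds_inst_stab:
  assumes "\<phi> \<in> formulas L X (V <+> M)" "\<sigma> \<in> stab M" "\<And>v. v \<in> V \<Longrightarrow> b' v = \<sigma> (b v)"
  shows "holds \<MM> (\<sigma> \<circ> x) (inst b' \<phi>) = holds \<MM> x (inst b \<phi>)"
  using holds_push[OF assms(2) formulas_wf[OF inst_formulas[OF assms(1)]], of x b] map_inst_stab[OF assms] by simp

lemma invariant_global_type_iff:
  fixes V :: "'k set"
  assumes M: "small M"
  shows "invariant_global_type L \<MM> M V P \<longleftrightarrow> global_type L \<MM> V P \<and> stab_invariant M P"
proof
  assume inv: "invariant_global_type L \<MM> M V P"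
  then have P: "global_type L \<MM> V P" by (simp add: invariant_global_type_def)
  have "map_fo_formula (map_sum id \<sigma>) \<phi> \<in> P" if \<sigma>: "\<sigma> \<in> stab M" and \<phi>: "\<phi> \<in> P" for \<sigma> \<phi>
  proof -
    let ?F = "Inr -` fv \<phi>"
    have "finite ?F" by (simp add: finite_vimageI)
    then obtain J :: "'k set" and b where J: "b ` J = ?F" using small_enum small_finite by metis
    have "\<phi> \<in> formulas L V ({} \<union> b ` J)" unfolding J Un_empty_left
    proof (rule formulasI)
      have \<phi>': "\<phi> \<in> formulas L V UNIV" using P \<phi> by (auto simp: type_over_def)
      then show "wf_formula L 0 \<phi>" by (rule formulas_wf)
      show "fv \<phi> \<subseteq> V <+> Inr -` fv \<phi>"
      proof
        fix u assume "u \<in> fv \<phi>"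
        then show "u \<in> V <+> Inr -` fv \<phi>" using \<phi>' by (cases u) (auto simp: formulas_def)
      qed
    qed
    then obtain \<phi>0 where \<phi>0: "\<phi>0 \<in> formulas L V (J <+> {})" "inst b \<phi>0 = \<phi>" using ex_inst by blast
    have "tp L \<MM> M J (\<sigma> \<circ> b) = tp L \<MM> M J b" by (rule tp_stabI[OF \<sigma>]) simp
    then have "inst (\<sigma> \<circ> b) \<phi>0 \<in> P" using inv \<phi>0 \<phi> unfolding invariant_global_type_def by blast
    moreover have "map_fo_formula (map_sum id \<sigma>) (inst b \<phi>0) = inst (\<sigma> \<circ> b) \<phi>0"
      by (rule map_inst_stab[OF \<phi>0(1) stab_mono[OF \<sigma>]]) auto
    ultimately show ?thesis using \<phi>0 by simp
  qed
  then show "global_type L \<MM> V P \<and> stab_invariant M P" using P by (simp add: stab_invariant_def)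
next
  assume P: "global_type L \<MM> V P \<and> stab_invariant M P"
  have *: "inst b' \<phi> \<in> P" if \<phi>: "\<phi> \<in> formulas L V (J <+> {})" and eq: "tp L \<MM> M J b = tp L \<MM> M J b'" and in_P: "inst b \<phi> \<in> P"
    for J :: "'k set" and b b' \<phi>
  proof -
    \<comment> \<open>The index set \<open>J\<close> need not be small, so it is cut down to the
      finitely many labels occurring in \<open>\<phi>\<close> before homogeneity is applied.\<close>
    let ?J = "(\<lambda>j. Inr (Inl j)) -` fv \<phi>"
    have fin: "finite ?J" by (rule finite_vimageI) (auto intro: injI)
    have J: "?J \<subseteq> J" "\<phi> \<in> formulas L V (?J <+> {})" using \<phi> by (fastforce simp: formulas_def)+
    obtain \<sigma> where \<sigma>: "\<sigma> \<in> stab M" "\<And>v. v \<in> ?J \<Longrightarrow> \<sigma> (b v) = b' v"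
      using tp_stabD[OF M small_finite[OF fin] tp_mono[OF eq order_refl J(1)]] by blast
    have "map_fo_formula (map_sum id \<sigma>) (inst b \<phi>) = inst b' \<phi>"
      by (rule map_inst_stab[OF J(2) stab_mono[OF \<sigma>(1)]]) (use \<sigma>(2) in auto)
    then show ?thesis using P \<sigma>(1) in_P by (metis stab_invariant_def)
  qed
  then show "invariant_global_type L \<MM> M V P"
    unfolding invariant_global_type_def using P by (metis (no_types, lifting))
qed

lemma stab_invariant_push:
  assumes P: "global_type L \<MM> V P" "stab_invariant M P" and \<sigma>: "\<sigma> \<in> stab M" and eq: "tp L \<MM> D V a = restrict_type P D"
  shows "tp L \<MM> (\<sigma> ` D) V (\<sigma> \<circ> a) = restrict_type P (\<sigma> ` D)"
proof -
  have Pf: "P \<subseteq> formulas L V UNIV" using P by (simp add: type_over_def)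
  have b: "bij \<sigma>" using \<sigma> by (rule stab_bij)
  have "restrict_type P (\<sigma> ` D) = tp L \<MM> (\<sigma> ` D) V (\<sigma> \<circ> a)"
  proof (rule tp_eq_type)
    show "type_over L \<MM> (\<sigma> ` D) V (restrict_type P (\<sigma> ` D))"
      unfolding restrict_type_formulas[OF Pf] using type_over_restrict[OF P(1)] by simp
    show "restrict_type P (\<sigma> ` D) \<subseteq> tp L \<MM> (\<sigma> ` D) V (\<sigma> \<circ> a)"
    proof
      fix \<phi> assume "\<phi> \<in> restrict_type P (\<sigma> ` D)"
      then have \<phi>: "\<phi> \<in> P" "\<phi> \<in> formulas L V (\<sigma> ` D)" using restrict_type_formulas[OF Pf] by auto
      let ?\<phi> = "map_fo_formula (map_sum id (inv \<sigma>)) \<phi>"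
      have "?\<phi> \<in> formulas L V D"
        using \<phi>(2) by (rule formulas_map) (auto simp: inv_f_f[OF bij_is_inj[OF b]])
      moreover have "?\<phi> \<in> P" using P(2) \<phi>(1) stab_inv[OF \<sigma>] by (simp add: stab_invariant_def)
      ultimately have "?\<phi> \<in> tp L \<MM> D V a" using eq restrict_type_formulas[OF Pf] by auto
      then have "holds \<MM> a ?\<phi>" by (simp add: tp_def)
      then have "holds \<MM> (\<sigma> \<circ> a) (map_fo_formula (map_sum id \<sigma>) ?\<phi>)"
        using holds_push[OF \<sigma>, of ?\<phi> a] formulas_wf[OF \<phi>(2)] by simp
      moreover have "map_fo_formula (map_sum id \<sigma>) ?\<phi> = \<phi>"
        unfolding fo_formula.map_comp
      proof (rule map_fo_formula_id_on)
        show "(map_sum id \<sigma> \<circ> map_sum id (inv \<sigma>)) v = v" for v :: "'b + 'a"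
          by (cases v) (simp_all add: surj_f_inv_f[OF bij_is_surj[OF b]])
      qed
      ultimately show "\<phi> \<in> tp L \<MM> (\<sigma> ` D) V (\<sigma> \<circ> a)" using \<phi>(2) by (simp add: tp_def)
    qed
  qed
  then show ?thesis by simp
qed

text \<open>The realization condition alone, for any index type and over a base \<open>C\<close>
  that may exceed the set over which \<open>P\<close> is invariant. Constructions use
  \<open>natLeq\<close>; orders on labels enter only to meet the official definitions.\<close>

definition Morley :: "('f, 'r, 'x + 'a) fo_formula set \<Rightarrow> 'a set \<Rightarrow> 'x set \<Rightarrow> 'i rel \<Rightarrow> ('i \<Rightarrow> 'x \<Rightarrow> 'a) \<Rightarrow> bool" where
  "Morley P C V R s \<longleftrightarrow> (\<forall>i\<in>Field R. tp L \<MM> (C \<union> before R V s i) V (s i) = restrict_type P (C \<union> before R V s i))"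

section \<open>Uniqueness and existence of Morley sequences\<close>

lemma increasing_Suc:
  "increasing R (Suc n) e \<Longrightarrow> increasing R n e \<and> e n \<in> Field R \<and> (\<forall>k<n. e k \<in> underS R (e n))"
  by (auto simp: increasing_def)

text \<open>Once \<sigma> matches the first \<open>n\<close> terms, invariance makes the
  \<sigma>-image of the next term realize \<open>P\<close> over the matched terms on the other side.
  The target term realizes the same restriction, so an automorphism \<tau> fixing the matched terms
  corrects the last entry.\<close>

lemma Morley_stab_eq:
  assumes P: "global_type L \<MM> V P" "stab_invariant M P" and M: "M \<subseteq> C" and small: "small C" "small V"
    and s: "Morley P C V R s" and s': "Morley P C V R' s'"
  shows "increasing R n e \<Longrightarrow> increasing R' n e' \<Longrightarrow> \<exists>\<sigma>\<in>stab C. \<forall>k<n. \<forall>v\<in>V. \<sigma> (s (e k) v) = s' (e' k) v"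
proof (induction n)
  case 0
  then show ?case using stab_id by blast
next
  case (Suc n)
  have Pf: "P \<subseteq> formulas L V UNIV" using P by (simp add: type_over_def)
  note inc = increasing_Suc[OF Suc.prems(1)] increasing_Suc[OF Suc.prems(2)]
  then obtain \<sigma> where \<sigma>: "\<sigma> \<in> stab C" "\<And>k v. k < n \<Longrightarrow> v \<in> V \<Longrightarrow> \<sigma> (s (e k) v) = s' (e' k) v"
    using Suc.IH by blast
  let ?D = "C \<union> (\<Union>k<n. s (e k) ` V)" and ?D' = "C \<union> (\<Union>k<n. s' (e' k) ` V)"
  have D': "\<sigma> ` ?D = ?D'"
    using \<sigma> stab_image[OF \<sigma>(1), of C] by (auto simp: image_Un image_UN) (metis (no_types, lifting) UN_iff image_iff lessThan_iff)+
  have "tp L \<MM> ?D V (s (e n)) = restrict_type P ?D"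
    by (rule tp_restrict_mono[OF Pf s[unfolded Morley_def, rule_format, of "e n"]]) (use inc in \<open>auto simp: before_def\<close>)
  then have 1: "tp L \<MM> ?D' V (\<sigma> \<circ> s (e n)) = restrict_type P ?D'"
    using stab_invariant_push[OF P stab_mono[OF \<sigma>(1) M]] D' by metis
  have 2: "tp L \<MM> ?D' V (s' (e' n)) = restrict_type P ?D'"
    by (rule tp_restrict_mono[OF Pf s'[unfolded Morley_def, rule_format, of "e' n"]]) (use inc in \<open>auto simp: before_def\<close>)
  have "small ?D'" using small small_UN_image[of "{..<n}" V "\<lambda>k. s' (e' k)"] by simp
  then obtain \<tau> where \<tau>: "\<tau> \<in> stab ?D'" "\<And>v. v \<in> V \<Longrightarrow> \<tau> ((\<sigma> \<circ> s (e n)) v) = s' (e' n) v"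
    using tp_stabD[of ?D' V "\<sigma> \<circ> s (e n)" "s' (e' n)"] small(2) 1 2 by metis
  have "(\<tau> \<circ> \<sigma>) (s (e k) v) = s' (e' k) v" if "k < Suc n" "v \<in> V" for k v
  proof (cases "k = n")
    case False
    then have "k < n" using that by simp
    then show ?thesis using \<sigma>(2) that stab_fix[OF \<tau>(1), of "s' (e' k) v"] by auto
  qed (use \<tau> that in auto)
  moreover have "\<tau> \<circ> \<sigma> \<in> stab C" by (rule stab_comp[OF stab_mono[OF \<tau>(1)] \<sigma>(1)]) auto
  ultimately show ?case by blast
qed

lemma Morley_tp_eq:
  assumes "global_type L \<MM> V P" "stab_invariant M P" "M \<subseteq> C" "small C" "small V"
    "Morley P C V R s" "Morley P C V R' s'" "increasing R n e" "increasing R' n e'"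
  shows "tp L \<MM> C ({..<n} \<times> V) (\<lambda>(k, v). s (e k) v) = tp L \<MM> C ({..<n} \<times> V) (\<lambda>(k, v). s' (e' k) v)"
proof -
  obtain \<sigma> where "\<sigma> \<in> stab C" "\<forall>k<n. \<forall>v\<in>V. \<sigma> (s (e k) v) = s' (e' k) v"
    using Morley_stab_eq[OF assms] by blast
  then show ?thesis by (intro tp_stabI[symmetric]) auto
qed

lemma Morley_indiscernible:
  assumes "global_type L \<MM> V P" "stab_invariant M P" "M \<subseteq> C" "small C" "small V" "Morley P C V R s"
  shows "indiscernible L \<MM> C V R s"
  unfolding indiscernible_def using Morley_tp_eq[OF assms assms(6)] by blast

lemma tp_subset: "V \<subseteq> V' \<Longrightarrow> C \<subseteq> C' \<Longrightarrow> tp L \<MM> C V a \<subseteq> tp L \<MM> C' V' a"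
  using formulas_mono[of _ L V C V' C'] by (auto simp: tp_def)

lemma indiscernible_mono:
  assumes "indiscernible L \<MM> C V R s" "C' \<subseteq> C"
  shows "indiscernible L \<MM> C' V R s"
  unfolding indiscernible_def
proof (intro allI impI)
  fix n e e' assume "increasing R n e \<and> increasing R n e'"
  then have "tp L \<MM> C ({..<n} \<times> V) (\<lambda>(k, v). s (e k) v) = tp L \<MM> C ({..<n} \<times> V) (\<lambda>(k, v). s (e' k) v)"
    using assms(1) unfolding indiscernible_def by blast
  then show "tp L \<MM> C' ({..<n} \<times> V) (\<lambda>(k, v). s (e k) v) = tp L \<MM> C' ({..<n} \<times> V) (\<lambda>(k, v). s (e' k) v)"
    by (rule tp_mono[OF _ assms(2) order_refl])
qed

lemma indiscernibleD:
  assumes "indiscernible L \<MM> C V R s" "increasing R n e" "increasing R n e'"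
  shows "tp L \<MM> C ({..<n} \<times> V) (\<lambda>(k, v). s (e k) v) = tp L \<MM> C ({..<n} \<times> V) (\<lambda>(k, v). s (e' k) v)"
  using assms unfolding indiscernible_def by blast

lemma before_nat [simp]: "before natLeq V s i = (\<Union>j<i. s j ` V)"
  by (auto simp: before_def natLeq_underS_less)

lemma Field_natLeq [simp]: "Field natLeq = UNIV"
  by (auto simp: Field_def natLeq_def)

lemma increasing_nat: "increasing natLeq n e \<longleftrightarrow> (\<forall>l<n. \<forall>k<l. e k < e l)"
  by (simp add: increasing_def natLeq_underS_less)

lemma nat_seq_tpI:
  assumes "\<And>n. tp L \<MM> C ({..<n} \<times> V) (\<lambda>(i, v). s i v) = tp L \<MM> C ({..<n} \<times> V) (\<lambda>(i, v). s' i v)"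
  shows "tp L \<MM> C (UNIV \<times> V) (\<lambda>(i, v). s i v) = tp L \<MM> C (UNIV \<times> V) (\<lambda>(i :: nat, v). s' i v)"
proof (rule tp_local)
  fix V0 :: "(nat \<times> 'b) set" assume V0: "V0 \<subseteq> UNIV \<times> V" "finite V0"
  then have "fst ` V0 \<subseteq> {..<Suc (Max (fst ` V0))}"
    unfolding lessThan_Suc_atMost by (intro subsetI) (simp only: atMost_iff Max_ge finite_imageI)
  then have "V0 \<subseteq> {..<Suc (Max (fst ` V0))} \<times> V" using V0 by force
  then show "tp L \<MM> C V0 (\<lambda>(i, v). s i v) = tp L \<MM> C V0 (\<lambda>(i, v). s' i v)"
    by (rule tp_mono[OF assms order_refl])
qed

lemma Morley_nat_eq:
  assumes "global_type L \<MM> V P" "stab_invariant M P" "M \<subseteq> C" "small C" "small V" "Morley P C V natLeq s" "Morley P C V natLeq s'"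
  obtains \<sigma> where "\<sigma> \<in> stab C" "\<And>i v. v \<in> V \<Longrightarrow> \<sigma> (s i v) = s' i v"
proof -
  have "tp L \<MM> C (UNIV \<times> V) (\<lambda>(i, v). s i v) = tp L \<MM> C (UNIV \<times> V) (\<lambda>(i, v). s' i v)"
    by (rule nat_seq_tpI) (use Morley_tp_eq[OF assms, of _ id id] in \<open>simp add: increasing_nat\<close>)
  moreover have "small ((UNIV :: nat set) \<times> V)" using assms by simp
  ultimately obtain \<sigma> where "\<sigma> \<in> stab C" "\<And>u. u \<in> UNIV \<times> V \<Longrightarrow> \<sigma> ((\<lambda>(i, v). s i v) u) = (\<lambda>(i, v). s' i v) u"
    using tp_stabD[OF assms(4)] by metis
  then show thesis using that[of \<sigma>] by force
qed

lemma Morley_push: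
  assumes P: "global_type L \<MM> V P" "stab_invariant M P" and s: "Morley P C V R s" and \<sigma>: "\<sigma> \<in> stab M"
    and s': "\<And>i v. i \<in> Field R \<Longrightarrow> v \<in> V \<Longrightarrow> s' i v = \<sigma> (s i v)"
  shows "Morley P (\<sigma> ` C) V R s'"
  unfolding Morley_def
proof
  fix i assume i: "i \<in> Field R"
  have "before R V s' i = \<sigma> ` before R V s i"
    using s' unfolding before_def image_UN image_image by (intro SUP_cong refl image_cong) (auto simp: underS_def Field_def)
  then have b: "\<sigma> ` C \<union> before R V s' i = \<sigma> ` (C \<union> before R V s i)" by (simp add: image_Un)
  have "tp L \<MM> (\<sigma> ` C \<union> before R V s' i) V (s' i) = tp L \<MM> (\<sigma> ` C \<union> before R V s' i) V (\<sigma> \<circ> s i)"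
    by (rule tp_cong) (use s' i in auto)
  also have "\<dots> = restrict_type P (\<sigma> ` C \<union> before R V s' i)"
    unfolding b by (rule stab_invariant_push[OF P \<sigma>]) (use s i in \<open>simp add: Morley_def\<close>)
  finally show "tp L \<MM> (\<sigma> ` C \<union> before R V s' i) V (s' i) = restrict_type P (\<sigma> ` C \<union> before R V s' i)" .
qed

lemma Morley_stab:
  assumes "global_type L \<MM> V P" "stab_invariant M P" "M \<subseteq> C" "Morley P C V R s" "\<sigma> \<in> stab C"
    "\<And>i v. i \<in> Field R \<Longrightarrow> v \<in> V \<Longrightarrow> s' i v = \<sigma> (s i v)"
  shows "Morley P C V R s'"
  using Morley_push[OF assms(1,2,4) stab_mono[OF assms(5,3)] assms(6)] stab_image[OF assms(5) order_refl] by simp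

lemma Morley_mono:
  assumes "P \<subseteq> formulas L V UNIV" "Morley P C V R s" "D \<subseteq> C"
  shows "Morley P D V R s"
  unfolding Morley_def
proof
  fix i assume "i \<in> Field R"
  then have "tp L \<MM> (C \<union> before R V s i) V (s i) = restrict_type P (C \<union> before R V s i)"
    using assms(2) by (simp add: Morley_def)
  then show "tp L \<MM> (D \<union> before R V s i) V (s i) = restrict_type P (D \<union> before R V s i)"
    by (rule tp_restrict_mono[OF assms(1)]) (use assms(3) in auto)
qed

lemma realize_restrict:
  assumes "global_type L \<MM> V P" "small C" "small V"
  obtains a where "tp L \<MM> C V a = restrict_type P C"
proof -
  have Pf: "P \<subseteq> formulas L V UNIV" using assms by (simp add: type_over_def)
  show thesis using realize_type[OF type_over_restrict[OF assms(1), of C] assms(2,3)] that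
    unfolding restrict_type_formulas[OF Pf] by blast
qed

text \<open>The base \<open>H\<close> is a parameter because two bases are needed: adding the
  earlier terms to a fixed set gives Morley sequences, and taking Skolem hulls gives a chain of
  models, each followed by a realization of \<open>q\<close> over it.\<close>

lemma ex_realizing_sequence:
  assumes q: "global_type L \<MM> V q" and V: "small V" and H: "\<And>A. small A \<Longrightarrow> small (H A)"
  shows "\<exists>s. \<forall>i::nat. tp L \<MM> (H (\<Union>j<i. s j ` V)) V (s i) = restrict_type q (H (\<Union>j<i. s j ` V))"
proof (rule dependent_wellorder_choice)
  fix f g :: "nat \<Rightarrow> 'b \<Rightarrow> 'a" and i r
  assume "\<And>j. j < i \<Longrightarrow> f j = g j"
  then have "(\<Union>j<i. f j ` V) = (\<Union>j<i. g j ` V)" by auto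
  then show "(tp L \<MM> (H (\<Union>j<i. f j ` V)) V r = restrict_type q (H (\<Union>j<i. f j ` V))) =
    (tp L \<MM> (H (\<Union>j<i. g j ` V)) V r = restrict_type q (H (\<Union>j<i. g j ` V)))" by simp
next
  fix f :: "nat \<Rightarrow> 'b \<Rightarrow> 'a" and i :: nat
  have "small (H (\<Union>j<i. f j ` V))" by (intro H small_UN_image V) simp
  then show "\<exists>r. tp L \<MM> (H (\<Union>j<i. f j ` V)) V r = restrict_type q (H (\<Union>j<i. f j ` V))"
    using realize_restrict[OF q _ V] by blast
qed

lemma ex_Morley:
  assumes "global_type L \<MM> V P" "small V" "small C"
  obtains s where "Morley P C V natLeq s"
  using ex_realizing_sequence[OF assms(1,2), of "\<lambda>A. C \<union> A"] assms(3) that by (auto simp: Morley_def)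

lemma ex_Morley_start:
  assumes "global_type L \<MM> V P" "stab_invariant M P" "M \<subseteq> C" "small V" "small C" "tp L \<MM> C V b = restrict_type P C"
  obtains s where "Morley P C V natLeq s" "\<And>v. v \<in> V \<Longrightarrow> s 0 v = b v"
proof -
  obtain s where s: "Morley P C V natLeq s" using ex_Morley assms by blast
  then have "tp L \<MM> C V (s 0) = tp L \<MM> C V b" using s assms(6) unfolding Morley_def Field_natLeq
    by (metis UNIV_I before_nat lessThan_0 UN_empty Un_empty_right)
  then obtain \<sigma> where \<sigma>: "\<sigma> \<in> stab C" "\<And>v. v \<in> V \<Longrightarrow> \<sigma> (s 0 v) = b v" using tp_stabD[OF assms(5,4)] by blast
  show thesis by (rule that[of "\<lambda>i. \<sigma> \<circ> s i"]) (use Morley_stab[OF assms(1-3) s \<sigma>(1)] \<sigma>(2) in auto)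
qed

lemma consistent_along_iff:
  "consistent_along \<MM> R s \<phi> \<longleftrightarrow> (\<forall>F\<subseteq>Field R. finite F \<longrightarrow> (\<exists>x. \<forall>i\<in>F. holds \<MM> x (inst (s i) \<phi>)))"
  unfolding consistent_along_def consistent_def
proof (intro iffI allI impI)
  fix F assume "\<forall>\<Psi>\<subseteq>(\<lambda>i. inst (s i) \<phi>) ` Field R. finite \<Psi> \<longrightarrow> (\<exists>a. \<forall>\<psi>\<in>\<Psi>. holds \<MM> a \<psi>)" "F \<subseteq> Field R" "finite F"
  then have "\<exists>a. \<forall>\<psi>\<in>(\<lambda>i. inst (s i) \<phi>) ` F. holds \<MM> a \<psi>" by (meson finite_imageI image_mono)
  then show "\<exists>x. \<forall>i\<in>F. holds \<MM> x (inst (s i) \<phi>)" by simp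
next
  fix \<Psi> assume *: "\<forall>F\<subseteq>Field R. finite F \<longrightarrow> (\<exists>x. \<forall>i\<in>F. holds \<MM> x (inst (s i) \<phi>))"
    "\<Psi> \<subseteq> (\<lambda>i. inst (s i) \<phi>) ` Field R" "finite \<Psi>"
  then obtain F where "F \<subseteq> Field R" "finite F" "\<Psi> = (\<lambda>i. inst (s i) \<phi>) ` F" by (meson finite_subset_image)
  then show "\<exists>a. \<forall>\<psi>\<in>\<Psi>. holds \<MM> a \<psi>" using * by auto
qed

lemma ex_increasing:
  assumes R: "Linear_order R"
  shows "finite F \<Longrightarrow> F \<subseteq> Field R \<Longrightarrow> \<exists>e. increasing R (card F) e \<and> e ` {..<card F} = F"
proof (induction "card F" arbitrary: F)
  case 0
  then show ?case by (auto simp: increasing_def)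
next
  case (Suc n)
  then have "F \<noteq> {}" by auto
  then obtain m where m: "m \<in> F" "\<forall>x\<in>F. (x, m) \<in> R"
    using finite_max_Linear_order[OF R Suc.prems(1) _ Suc.prems(2)] by blast
  have n: "n = card (F - {m})" using Suc m by simp
  then obtain e where e: "increasing R n e" "e ` {..<n} = F - {m}" using Suc.hyps(1)[OF n] Suc.prems by auto
  have "increasing R (Suc n) (e(n := m))"
    using e m Suc.prems(2) unfolding increasing_def by (auto simp: less_Suc_eq underS_def)
  moreover have "(e(n := m)) ` {..<Suc n} = F" using e(2) m by (auto simp: lessThan_Suc)
  ultimately show ?case using Suc.hyps(2) by metis
qed

text \<open>A finite part of one sequence is conjugate to any equally long part of the other.
  Consistency is asked on an infinite set \<open>I\<close> of indices only, which is what a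
  pigeonhole argument provides.\<close>

lemma consistent_transfer:
  assumes P: "global_type L \<MM> V P" "stab_invariant M P" "M \<subseteq> C" "small C" "small V"
    and s: "Morley P C V R s" "Linear_order R" and s': "Morley P C V R' s'" "Linear_order R'"
    and I: "I \<subseteq> Field R'" "infinite I" and \<phi>: "\<phi> \<in> formulas L X (V <+> C)"
    and con: "\<And>F. F \<subseteq> I \<Longrightarrow> finite F \<Longrightarrow> \<exists>x. \<forall>i\<in>F. holds \<MM> x (inst (s' i) \<phi>)"
  shows "consistent_along \<MM> R s \<phi>"
  unfolding consistent_along_iff
proof (intro allI impI)
  fix F assume F: "F \<subseteq> Field R" "finite F"
  obtain e where e: "increasing R (card F) e" "e ` {..<card F} = F" using ex_increasing[OF s(2) F(2,1)] by blast
  obtain F' where F': "F' \<subseteq> I" "finite F'" "card F' = card F" using infinite_arbitrarily_large[OF I(2)] by blast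
  obtain e' where e': "increasing R' (card F) e'" "e' ` {..<card F} = F'"
    using ex_increasing[OF s'(2) F'(2)] F' I(1) by fastforce
  obtain \<sigma> where \<sigma>: "\<sigma> \<in> stab C" "\<forall>k<card F. \<forall>v\<in>V. \<sigma> (s' (e' k) v) = s (e k) v"
    using Morley_stab_eq[OF P s'(1) s(1) e'(1) e(1)] by blast
  obtain x where x: "\<forall>i\<in>F'. holds \<MM> x (inst (s' i) \<phi>)" using con F' by blast
  have "holds \<MM> (\<sigma> \<circ> x) (inst (s i) \<phi>)" if "i \<in> F" for i
  proof -
    have "i \<in> e ` {..<card F}" using e(2) that by simp
    then obtain k where k: "k < card F" "i = e k" by blast
    have "holds \<MM> x (inst (s' (e' k)) \<phi>)" using x e'(2) k by auto
    then show ?thesis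
      using holds_inst_stab[OF \<phi> \<sigma>(1), of "s i" "s' (e' k)" x] \<sigma>(2) k by metis
  qed
  then show "\<exists>x. \<forall>i\<in>F. holds \<MM> x (inst (s i) \<phi>)" by blast
qed

section \<open>Average types and indiscernible sequences\<close>

text \<open>The limit of the sequence along a nonprincipal ultrafilter on the indices, described
  without the ultrafilter. Infinitely many terms, rather than one, ensure that a formula of
  \<open>q\<close> is met beyond any given index.\<close>

definition average_type :: "(nat \<Rightarrow> 'x \<Rightarrow> 'a) \<Rightarrow> 'x set \<Rightarrow> ('f, 'r, 'x + 'a) fo_formula set \<Rightarrow> bool" where
  "average_type b V q \<longleftrightarrow> global_type L \<MM> V q \<and> (\<forall>\<Psi>\<subseteq>q. finite \<Psi> \<longrightarrow> infinite {i. \<forall>\<psi>\<in>\<Psi>. holds \<MM> (b i) \<psi>})"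

lemma ex_average_type:
  fixes b :: "nat \<Rightarrow> 'x \<Rightarrow> 'a"
  obtains q where "average_type b V q"
proof -
  define good where "good \<Psi> \<longleftrightarrow> infinite {i. \<forall>\<psi>\<in>\<Psi>. holds \<MM> (b i) \<psi>}" for \<Psi>
  obtain q where q: "q \<subseteq> formulas L V UNIV" "\<And>\<Psi>. finite \<Psi> \<Longrightarrow> \<Psi> \<subseteq> q \<Longrightarrow> good \<Psi>"
    "\<And>\<phi>. \<phi> \<in> formulas L V UNIV \<Longrightarrow> \<phi> \<in> q \<or> Neg \<phi> \<in> q"
  proof (rule lindenbaum[of "{}" "formulas L V UNIV" good Neg])
    show "good \<Psi>" if "\<Psi> \<subseteq> {}" for \<Psi> using that by (simp add: good_def)
    show "good \<Psi>'" if "good \<Psi>" "\<Psi>' \<subseteq> \<Psi>" for \<Psi> \<Psi>'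
    proof -
      have "{i. \<forall>\<psi>\<in>\<Psi>. holds \<MM> (b i) \<psi>} \<subseteq> {i. \<forall>\<psi>\<in>\<Psi>'. holds \<MM> (b i) \<psi>}" using that(2) by auto
      then show ?thesis using that(1) infinite_super unfolding good_def by blast
    qed
    show "good (insert \<phi> \<Psi>) \<or> good (insert (Neg \<phi>) \<Psi>)" if "good \<Psi>" for \<phi> \<Psi>
    proof -
      \<comment> \<open>An infinite set of indices split by the truth of \<phi> has an infinite
        part.\<close>
      have "{i. \<forall>\<psi>\<in>\<Psi>. holds \<MM> (b i) \<psi>} = {i. \<forall>\<psi>\<in>insert \<phi> \<Psi>. holds \<MM> (b i) \<psi>} \<union> {i. \<forall>\<psi>\<in>insert (Neg \<phi>) \<Psi>. holds \<MM> (b i) \<psi>}"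
        by auto
      then show ?thesis using that unfolding good_def by (simp only: finite_Un) blast
    qed
  qed auto
  have "consistent \<MM> q" unfolding consistent_def
  proof (intro allI impI)
    fix \<Psi> assume "\<Psi> \<subseteq> q" "finite \<Psi>"
    then have "infinite {i. \<forall>\<psi>\<in>\<Psi>. holds \<MM> (b i) \<psi>}" using q(2) by (simp add: good_def)
    then have "{i. \<forall>\<psi>\<in>\<Psi>. holds \<MM> (b i) \<psi>} \<noteq> {}" by (metis finite.emptyI)
    then show "\<exists>a. \<forall>\<psi>\<in>\<Psi>. holds \<MM> a \<psi>" by blast
  qed
  then have "average_type b V q" using q unfolding average_type_def type_over_def good_def by blast
  then show thesis using that by blast
qed

lemma average_type_global: "average_type b V q \<Longrightarrow> global_type L \<MM> V q"
  by (simp add: average_type_def)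

lemma average_typeD: "average_type b V q \<Longrightarrow> \<phi> \<in> q \<Longrightarrow> infinite {i. holds \<MM> (b i) \<phi>}"
  unfolding average_type_def by (drule conjunct2, drule spec[of _ "{\<phi>}"]) simp

lemma average_type_obtain:
  assumes "average_type b V q" "\<phi> \<in> q"
  obtains i where "N < i" "holds \<MM> (b i) \<phi>"
  using average_typeD[OF assms] that unfolding finite_nat_set_iff_bounded_le by (auto simp: not_le)

lemma average_type_eventually:
  assumes q: "average_type b V q" and \<phi>: "\<phi> \<in> formulas L V UNIV" "\<And>i. N < i \<Longrightarrow> holds \<MM> (b i) \<phi>"
  shows "\<phi> \<in> q"
proof (rule ccontr)
  assume "\<phi> \<notin> q"
  then have "Neg \<phi> \<in> q" using type_over_Neg[OF average_type_global[OF q] \<phi>(1)] by simp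
  then obtain i where "N < i" "holds \<MM> (b i) (Neg \<phi>)" by (rule average_type_obtain[OF q])
  then show False using \<phi>(2) by simp
qed

text \<open>If \<open>q\<close> contained a formula together with the negation of its
  \<sigma>-translate, some \<open>b i\<close> would satisfy both; but \<sigma> fixes the entries of
  \<open>b i\<close>, so the formula and its translate agree there.\<close>

lemma average_type_invariant:
  assumes q: "average_type b V q" and b: "(\<Union>i. b i ` V) \<subseteq> M"
  shows "stab_invariant M q"
  unfolding stab_invariant_def
proof (intro ballI)
  fix \<sigma> \<phi> assume \<sigma>: "\<sigma> \<in> stab M" and \<phi>: "\<phi> \<in> q"
  let ?\<phi> = "map_fo_formula (map_sum id \<sigma>) \<phi>"
  have F: "\<phi> \<in> formulas L V UNIV" using q \<phi> by (auto simp: average_type_def type_over_def)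
  then have F': "?\<phi> \<in> formulas L V UNIV" by (rule formulas_map) auto
  have eq: "holds \<MM> (b i) ?\<phi> = holds \<MM> (b i) \<phi>" for i
  proof -
    have "holds \<MM> (b i) ?\<phi> = holds \<MM> (\<sigma> \<circ> b i) ?\<phi>"
    proof (rule holds_cong_on[OF F'])
      fix v assume "v \<in> V"
      then have "b i v \<in> M" using b by auto
      then show "b i v = (\<sigma> \<circ> b i) v" using stab_fix[OF \<sigma>] by simp
    qed
    then show ?thesis using holds_push[OF \<sigma> formulas_wf[OF F]] by simp
  qed
  show "?\<phi> \<in> q"
  proof (rule ccontr)
    assume "?\<phi> \<notin> q"
    then have "Neg ?\<phi> \<in> q" using type_over_Neg[OF average_type_global[OF q] F'] by simp
    then have "Conj \<phi> (Neg ?\<phi>) \<in> q"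
      using \<phi> F F' by (intro type_over_closed[OF average_type_global[OF q], of "{\<phi>, Neg ?\<phi>}"]) auto
    from average_typeD[OF q this] show False by (simp add: eq)
  qed
qed

text \<open>Replacing the elements of the Morley sequence by members of \<open>b\<close> from the top down
  is what reverses the order.\<close>

lemma average_Morley_formula:
  fixes b :: "nat \<Rightarrow> 'x \<Rightarrow> 'a"
  assumes q: "average_type b V q" and b: "(\<Union>i. b i ` V) \<subseteq> C" and s: "Morley q C V R s" and e: "increasing R n e"
    and \<psi>: "\<psi> \<in> formulas L ({..<n} \<times> V) C" "holds \<MM> (\<lambda>(k, v). s (e k) v) \<psi>"
  obtains d where "\<And>k l. k < l \<Longrightarrow> l < n \<Longrightarrow> d l < d k" "holds \<MM> (\<lambda>(k, v). b (d k) v) \<psi>"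
proof -
  have qf: "q \<subseteq> formulas L V UNIV" using average_type_global[OF q] by (simp add: type_over_def)
  \<comment> \<open>Induction on \<open>j\<close>, the number of final positions whose terms have
    been replaced by members of \<open>b\<close>.\<close>
  have "\<exists>d. (\<forall>k l. n - j \<le> k \<longrightarrow> k < l \<longrightarrow> l < n \<longrightarrow> d l < d k) \<and>
      holds \<MM> (\<lambda>(k, v). if k < n - j then s (e k) v else b (d k) v) \<psi>" if "j \<le> n" for j
    using that
  proof (induction j)
    case 0
    have "holds \<MM> (\<lambda>(k, v). if k < n then s (e k) v else b (d k) v) \<psi>" for d
      by (rule holds_cong_on[OF \<psi>(1), THEN iffD1, OF _ \<psi>(2)]) auto
    then show ?case by auto
  next
    case (Suc j)
    then obtain d where d: "\<And>k l. n - j \<le> k \<Longrightarrow> k < l \<Longrightarrow> l < n \<Longrightarrow> d l < d k"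
      and h: "holds \<MM> (\<lambda>(k, v). if k < n - j then s (e k) v else b (d k) v) \<psi>" by force
    define m where "m = n - Suc j"
    have m: "n - j = Suc m" "m < n" using Suc.prems by (auto simp: m_def)
    \<comment> \<open>Position \<open>m\<close> is the only variable left: lower positions become
      parameters among the terms before \<open>s (e m)\<close>, higher ones already lie in
      \<open>C\<close>. Hence \<open>q\<close> decides the resulting formula.\<close>
    define g where "g = case_sum (\<lambda>(k, v). if k = m then Inl v else Inr (if k < m then s (e k) v else b (d k) v)) (Inr :: 'a \<Rightarrow> 'x + 'a)"
    have hg: "holds \<MM> c (map_fo_formula g \<psi>) = holds \<MM> (\<lambda>(k, v). if k < m then s (e k) v else if k = m then c v else b (d k) v) \<psi>" for c
    proof -
      have "case_sum c id \<circ> g = case_sum (\<lambda>(k, v). if k < m then s (e k) v else if k = m then c v else b (d k) v) id"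
        by (auto simp: g_def fun_eq_iff split: sum.split)
      then show ?thesis by (simp add: holds_map) (simp add: holds_def)
    qed
    have "(\<lambda>(k, v). if k < m then s (e k) v else if k = m then s (e m) v else b (d k) v) =
      (\<lambda>(k, v). if k < n - j then s (e k) v else b (d k) v)"
      using m by (auto simp: fun_eq_iff less_Suc_eq)
    then have hm: "holds \<MM> (s (e m)) (map_fo_formula g \<psi>)" using hg h by simp
    have em: "e m \<in> Field R" "\<And>k. k < m \<Longrightarrow> e k \<in> underS R (e m)" using e m(2) by (auto simp: increasing_def)
    have "map_fo_formula g \<psi> \<in> formulas L V (C \<union> before R V s (e m))"
    proof (rule formulas_map[OF \<psi>(1)])
      fix u assume "u \<in> {..<n} \<times> V"
      then obtain k v where u: "u = (k, v)" "k < n" "v \<in> V" by auto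
      have "s (e k) v \<in> before R V s (e m)" if "k < m" using em(2)[OF that] u by (auto simp: before_def)
      then show "g (Inl u) \<in> V <+> (C \<union> before R V s (e m))" using u b by (auto simp: g_def)
    qed (auto simp: g_def)
    then have "map_fo_formula g \<psi> \<in> tp L \<MM> (C \<union> before R V s (e m)) V (s (e m))" using hm by (simp add: tp_def)
    then have "map_fo_formula g \<psi> \<in> q"
      using s em(1) unfolding Morley_def restrict_type_def by blast
    \<comment> \<open>The new index exceeds every value of \<open>d\<close> so far and is assigned
      to a lower position, so \<open>d\<close> comes out decreasing.\<close>
    then obtain i where i: "Max (insert 0 (d ` {..<n})) < i" "holds \<MM> (b i) (map_fo_formula g \<psi>)"
      by (rule average_type_obtain[OF q])
    have di: "d l < i" if "l < n" for l using i(1) that by (subst (asm) Max_less_iff) auto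
    have "(d(m := i)) l < (d(m := i)) k" if "n - Suc j \<le> k" "k < l" "l < n" for k l
      using that di[of l] d[of k l] m by (auto simp: m_def[symmetric])
    moreover have "(\<lambda>(k, v). if k < n - Suc j then s (e k) v else b ((d(m := i)) k) v) =
      (\<lambda>(k, v). if k < m then s (e k) v else if k = m then b i v else b (d k) v)"
      by (auto simp: fun_eq_iff m_def)
    ultimately show ?case using i(2) hg by (intro exI[of _ "d(m := i)"]) simp
  qed
  from this[of n] show thesis using that by auto
qed

text \<open>Reversed initial segments of different lengths have compatible types, because shifting a
  block of an indiscernible sequence does not change its type. The union of these types is therefore
  consistent, and a realization is the reversed sequence.\<close>

lemma ex_reversed_sequence:
  fixes s :: "nat \<Rightarrow> 'x \<Rightarrow> 'a"
  assumes s: "indiscernible L \<MM> A V natLeq s" and small: "small A" "small V"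
  shows "\<exists>c. \<forall>n. tp L \<MM> A ({..<n} \<times> V) (\<lambda>(k, v). c k v) = tp L \<MM> A ({..<n} \<times> V) (\<lambda>(k, v). s (n - Suc k) v)"
proof -
  define rv where "rv n = (\<lambda>(k, v). s (n - Suc k) v)" for n
  have shift: "tp L \<MM> A ({..<n} \<times> V) (rv n) = tp L \<MM> A ({..<n} \<times> V) (rv m)" if "n \<le> m" for n m
  proof -
    \<comment> \<open>Both \<open>rv n\<close> and the first \<open>n\<close> entries of
      \<open>rv m\<close> are reversed blocks of \<open>n\<close> consecutive terms, starting at
      position 0 and at position \<open>m - n\<close>.\<close>
    have "increasing natLeq n (\<lambda>k. k)" "increasing natLeq n (\<lambda>k. m - n + k)" by (auto simp: increasing_nat)
    then have "tp L \<MM> A ({..<n} \<times> V) (\<lambda>(k, v). s k v) = tp L \<MM> A ({..<n} \<times> V) (\<lambda>(k, v). s (m - n + k) v)"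
      by (rule indiscernibleD[OF s])
    from tp_reindex[OF this, of "\<lambda>(k, v). (n - Suc k, v)" "{..<n} \<times> V"]
    have "tp L \<MM> A ({..<n} \<times> V) ((\<lambda>(k, v). s k v) \<circ> (\<lambda>(k, v). (n - Suc k, v))) =
      tp L \<MM> A ({..<n} \<times> V) ((\<lambda>(k, v). s (m - n + k) v) \<circ> (\<lambda>(k, v). (n - Suc k, v)))" by force
    moreover have "tp L \<MM> A ({..<n} \<times> V) (rv n) = tp L \<MM> A ({..<n} \<times> V) ((\<lambda>(k, v). s k v) \<circ> (\<lambda>(k, v). (n - Suc k, v)))"
      by (rule tp_cong) (auto simp: rv_def)
    moreover have "tp L \<MM> A ({..<n} \<times> V) (rv m) = tp L \<MM> A ({..<n} \<times> V) ((\<lambda>(k, v). s (m - n + k) v) \<circ> (\<lambda>(k, v). (n - Suc k, v)))"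
    proof (rule tp_cong)
      fix u assume "u \<in> {..<n} \<times> V"
      then obtain k v where "u = (k, v)" "k < n" by auto
      moreover have "m - Suc k = m - n + (n - Suc k)" using that \<open>k < n\<close> by simp
      ultimately show "rv m u = ((\<lambda>(k, v). s (m - n + k) v) \<circ> (\<lambda>(k, v). (n - Suc k, v))) u" by (simp add: rv_def)
    qed
    ultimately show ?thesis by simp
  qed
  define \<Sigma> where "\<Sigma> = (\<Union>n. tp L \<MM> A ({..<n} \<times> V) (rv n))"
  have "tp L \<MM> A ({..<n} \<times> V) (rv n) \<subseteq> formulas L (UNIV \<times> V) A" for n
    using formulas_mono[of _ L "{..<n} \<times> V" A "UNIV \<times> V" A] by (auto simp: tp_def)
  then have "\<Sigma> \<subseteq> formulas L (UNIV \<times> V) A" unfolding \<Sigma>_def by blast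
  moreover have "consistent \<MM> \<Sigma>" unfolding consistent_def
  proof (intro allI impI)
    fix \<Psi> assume \<Psi>: "\<Psi> \<subseteq> \<Sigma>" "finite \<Psi>"
    have "mono (\<lambda>n. tp L \<MM> A ({..<n} \<times> V) (rv n))"
    proof (rule monoI)
      fix n m :: nat assume nm: "n \<le> m"
      have "tp L \<MM> A ({..<n} \<times> V) (rv m) \<subseteq> tp L \<MM> A ({..<m} \<times> V) (rv m)"
        by (rule tp_subset) (use nm in auto)
      then show "tp L \<MM> A ({..<n} \<times> V) (rv n) \<subseteq> tp L \<MM> A ({..<m} \<times> V) (rv m)" using shift[OF nm] by simp
    qed
    then obtain n where "\<Psi> \<subseteq> tp L \<MM> A ({..<n} \<times> V) (rv n)"
      using finite_subset_chain[of "\<lambda>n. tp L \<MM> A ({..<n} \<times> V) (rv n)" \<Psi>] \<Psi> unfolding \<Sigma>_def by blast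
    then show "\<exists>a. \<forall>\<psi>\<in>\<Psi>. holds \<MM> a \<psi>" by (auto simp: tp_def)
  qed
  ultimately obtain c where c: "\<And>\<phi>. \<phi> \<in> \<Sigma> \<Longrightarrow> holds \<MM> c \<phi>"
    using realize_consistent[of \<Sigma> "UNIV \<times> V" A] small by auto
  show ?thesis
  proof (intro exI allI)
    fix n
    have "tp L \<MM> A ({..<n} \<times> V) (rv n) = tp L \<MM> A ({..<n} \<times> V) c"
      by (rule tp_eq_type[OF type_over_tp]) (use c in \<open>auto simp: \<Sigma>_def tp_def\<close>)
    then show "tp L \<MM> A ({..<n} \<times> V) (\<lambda>(k, v). curry c k v) = tp L \<MM> A ({..<n} \<times> V) (\<lambda>(k, v). s (n - Suc k) v)"
      by (simp add: rv_def)
  qed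
qed

text \<open>An increasing tuple of \<open>c\<close> lies below some \<open>m\<close>, so it has the
  type of a decreasing tuple among the first \<open>m\<close> terms of \<open>s\<close>; read
  backwards, that is an increasing tuple of \<open>s\<close>.\<close>

lemma reversed_indiscernible:
  fixes s :: "nat \<Rightarrow> 'x \<Rightarrow> 'a"
  assumes s: "indiscernible L \<MM> A V natLeq s"
    and c: "\<And>n. tp L \<MM> A ({..<n} \<times> V) (\<lambda>(k, v). c k v) = tp L \<MM> A ({..<n} \<times> V) (\<lambda>(k, v). s (n - Suc k) v)"
  shows "indiscernible L \<MM> A V natLeq c"
  unfolding indiscernible_def
proof (intro allI impI, elim conjE)
  have *: "tp L \<MM> A ({..<n} \<times> V) (\<lambda>(k, v). c (e k) v) = tp L \<MM> A ({..<n} \<times> V) (\<lambda>(k, v). s (n - Suc k) v)"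
    if e: "increasing natLeq n e" for n e
  proof -
    obtain m where m: "\<And>k. k < n \<Longrightarrow> e k < m" using finite_nat_set_iff_bounded[of "e ` {..<n}"] by auto
    let ?f = "\<lambda>(k, v). (e k, v)"
    have "tp L \<MM> A ({..<n} \<times> V) ((\<lambda>(k, v). c k v) \<circ> ?f) = tp L \<MM> A ({..<n} \<times> V) ((\<lambda>(k, v). s (m - Suc k) v) \<circ> ?f)"
      by (rule tp_reindex[OF c]) (use m in auto)
    moreover have "(\<lambda>(k, v). c k v) \<circ> ?f = (\<lambda>(k, v). c (e k) v)" "(\<lambda>(k, v). s (m - Suc k) v) \<circ> ?f = (\<lambda>(k, v). s (m - Suc (e k)) v)"
      by auto
    moreover have "tp L \<MM> A ({..<n} \<times> V) (\<lambda>(k, v). s (m - Suc (e k)) v) = tp L \<MM> A ({..<n} \<times> V) (\<lambda>(k, v). s (n - Suc k) v)"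
    proof -
      let ?e = "\<lambda>k. m - Suc (e (n - Suc k))" and ?g = "\<lambda>(k, v). (n - Suc k, v)"
      have "increasing natLeq n ?e" unfolding increasing_nat
      proof (intro allI impI)
        fix l k assume kl: "l < n" "k < l"
        then have "e (n - Suc l) < e (n - Suc k)" using e unfolding increasing_nat by (simp add: diff_less_mono2)
        moreover have "e (n - Suc k) < m" using m kl by simp
        ultimately show "?e k < ?e l" by (simp add: diff_less_mono2)
      qed
      moreover have "increasing natLeq n (\<lambda>k. k)" by (simp add: increasing_nat)
      ultimately have "tp L \<MM> A ({..<n} \<times> V) (\<lambda>(k, v). s (?e k) v) = tp L \<MM> A ({..<n} \<times> V) (\<lambda>(k, v). s k v)"
        by (rule indiscernibleD[OF s])
      then have "tp L \<MM> A ({..<n} \<times> V) ((\<lambda>(k, v). s (?e k) v) \<circ> ?g) = tp L \<MM> A ({..<n} \<times> V) ((\<lambda>(k, v). s k v) \<circ> ?g)"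
        by (rule tp_reindex) auto
      moreover have "tp L \<MM> A ({..<n} \<times> V) (\<lambda>(k, v). s (m - Suc (e k)) v) = tp L \<MM> A ({..<n} \<times> V) ((\<lambda>(k, v). s (?e k) v) \<circ> ?g)"
        by (rule tp_cong) (auto simp: Suc_diff_Suc)
      moreover have "tp L \<MM> A ({..<n} \<times> V) (\<lambda>(k, v). s (n - Suc k) v) = tp L \<MM> A ({..<n} \<times> V) ((\<lambda>(k, v). s k v) \<circ> ?g)"
        by (rule tp_cong) auto
      ultimately show ?thesis by simp
    qed
    ultimately show ?thesis by simp
  qed
  fix n e e' assume "increasing natLeq n e" "increasing natLeq n e'"
  then show "tp L \<MM> A ({..<n} \<times> V) (\<lambda>(k, v). c (e k) v) = tp L \<MM> A ({..<n} \<times> V) (\<lambda>(k, v). c (e' k) v)"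
    using * by simp
qed

text \<open>Ramsey-free extraction: a Morley sequence of an average type, read backwards, realizes the
  Ehrenfeucht--Mostowski type of the given sequence.\<close>

lemma ex_indiscernible:
  fixes b :: "nat \<Rightarrow> 'x \<Rightarrow> 'a"
  assumes small: "small A" "small V"
  obtains c where "indiscernible L \<MM> A V natLeq c"
    "\<And>n \<psi>. \<psi> \<in> formulas L ({..<n} \<times> V) A \<Longrightarrow>
       (\<And>d. increasing natLeq n d \<Longrightarrow> holds \<MM> (\<lambda>(k, v). b (d k) v) \<psi>) \<Longrightarrow> holds \<MM> (\<lambda>(k, v). c k v) \<psi>"
proof -
  let ?B = "\<Union>i. b i ` V"
  let ?C = "A \<union> ?B"
  have C: "small ?C" using small by (simp add: small_UN_image)
  obtain q where q: "average_type b V q" by (rule ex_average_type)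
  note inv = average_type_invariant[OF q order_refl] and glob = average_type_global[OF q]
  obtain s where s: "Morley q ?C V natLeq s" using ex_Morley[OF glob small(2) C] .
  have ind: "indiscernible L \<MM> ?C V natLeq s" by (rule Morley_indiscernible[OF glob inv _ C small(2) s]) auto
  then have indA: "indiscernible L \<MM> A V natLeq s" by (rule indiscernible_mono) auto
  obtain c where c: "\<And>n. tp L \<MM> A ({..<n} \<times> V) (\<lambda>(k, v). c k v) = tp L \<MM> A ({..<n} \<times> V) (\<lambda>(k, v). s (n - Suc k) v)"
    using ex_reversed_sequence[OF indA small] by blast
  show thesis
  proof
    show "indiscernible L \<MM> A V natLeq c" by (rule reversed_indiscernible[OF indA c])
    fix n \<psi> assume \<psi>: "\<psi> \<in> formulas L ({..<n} \<times> V) A"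
      and h: "\<And>d. increasing natLeq n d \<Longrightarrow> holds \<MM> (\<lambda>(k, v). b (d k) v) \<psi>"
    show "holds \<MM> (\<lambda>(k, v). c k v) \<psi>"
    proof (rule ccontr)
      assume "\<not> ?thesis"
      then have "\<not> holds \<MM> (\<lambda>(k, v). s (n - Suc k) v) \<psi>" using tp_eqD[OF c \<psi>] by simp
      moreover have f: "(\<lambda>(k, v). t (n - Suc k) v) = (\<lambda>(k, v). t k v) \<circ> (\<lambda>(k, v). (n - Suc k, v))" for t :: "nat \<Rightarrow> 'x \<Rightarrow> 'a"
        by auto
      \<comment> \<open>A formula failing on \<open>c\<close> fails on the reversed
        \<open>s\<close>. Its negation with positions reversed then holds on \<open>s\<close> and
        descends to a decreasing tuple of \<open>b\<close>, which becomes increasing when the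
        positions are reversed again.\<close>
      ultimately have N: "holds \<MM> (\<lambda>(k, v). s (id k) v) (Neg (map_fo_formula (map_sum (\<lambda>(k, v). (n - Suc k, v)) id) \<psi>))"
        by (simp add: holds_reindex)
      have F: "Neg (map_fo_formula (map_sum (\<lambda>(k, v). (n - Suc k, v)) id) \<psi>) \<in> formulas L ({..<n} \<times> V) ?C"
        unfolding formulas_Neg by (rule formulas_map[OF \<psi>]) auto
      have "increasing natLeq n id" by (simp add: increasing_nat)
      then obtain d where d: "\<And>k l. k < l \<Longrightarrow> l < n \<Longrightarrow> d l < d k"
        and hd: "holds \<MM> (\<lambda>(k, v). b (d k) v) (Neg (map_fo_formula (map_sum (\<lambda>(k, v). (n - Suc k, v)) id) \<psi>))"
        using average_Morley_formula[OF q _ s _ F N] by blast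
      have "\<not> holds \<MM> (\<lambda>(k, v). b (d (n - Suc k)) v) \<psi>"
        using hd f[of "\<lambda>k. b (d k)"] by (simp add: holds_reindex)
      moreover have "increasing natLeq n (\<lambda>k. d (n - Suc k))" using d by (auto simp: increasing_nat)
      ultimately show False using h by blast
    qed
  qed
qed

text \<open>For \<open>b\<close> already indiscernible over \<open>B\<close>, every formula of its
  type over \<open>B\<close> holds along all increasing tuples, so the Ehrenfeucht--Mostowski
  condition fixes the type of \<open>c\<close> over \<open>B\<close>. An automorphism over
  \<open>B\<close> can then carry \<open>c\<close> to \<open>b\<close>, trading indiscernibility
  over \<open>A\<close> for indiscernibility over a conjugate of \<open>A\<close>. The last clause
  is the case of single terms.\<close>

lemma ex_indiscernible_over:
  fixes b :: "nat \<Rightarrow> 'x \<Rightarrow> 'a"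
  assumes "small A" "small V"
  obtains c where "indiscernible L \<MM> A V natLeq c"
    "\<And>B. B \<subseteq> A \<Longrightarrow> indiscernible L \<MM> B V natLeq b \<Longrightarrow> tp L \<MM> B (UNIV \<times> V) (\<lambda>(k, v). c k v) = tp L \<MM> B (UNIV \<times> V) (\<lambda>(k, v). b k v)"
    "\<And>B. B \<subseteq> A \<Longrightarrow> (\<And>i. tp L \<MM> B V (b i) = tp L \<MM> B V (b 0)) \<Longrightarrow> tp L \<MM> B V (c 0) = tp L \<MM> B V (b 0)"
proof -
  obtain c where c: "indiscernible L \<MM> A V natLeq c"
    and EM: "\<And>n \<psi>. \<psi> \<in> formulas L ({..<n} \<times> V) A \<Longrightarrow>
       (\<And>d. increasing natLeq n d \<Longrightarrow> holds \<MM> (\<lambda>(k, v). b (d k) v) \<psi>) \<Longrightarrow> holds \<MM> (\<lambda>(k, v). c k v) \<psi>"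
    using ex_indiscernible[OF assms] by blast
  show thesis
  proof
    fix B assume B: "B \<subseteq> A" and b: "indiscernible L \<MM> B V natLeq b"
    show "tp L \<MM> B (UNIV \<times> V) (\<lambda>(k, v). c k v) = tp L \<MM> B (UNIV \<times> V) (\<lambda>(k, v). b k v)"
    proof (rule nat_seq_tpI)
      fix n
      have "tp L \<MM> B ({..<n} \<times> V) (\<lambda>(k, v). b k v) \<subseteq> tp L \<MM> B ({..<n} \<times> V) (\<lambda>(k, v). c k v)"
      proof
        fix \<psi> assume \<psi>: "\<psi> \<in> tp L \<MM> B ({..<n} \<times> V) (\<lambda>(k, v). b k v)"
        then have F: "\<psi> \<in> formulas L ({..<n} \<times> V) B" by (simp add: tp_def)
        have "holds \<MM> (\<lambda>(k, v). c k v) \<psi>"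
        proof (rule EM)
          show "\<psi> \<in> formulas L ({..<n} \<times> V) A" using F B formulas_mono by blast
          fix d assume "increasing natLeq n d"
          moreover have "increasing natLeq n id" by (simp add: increasing_nat)
          ultimately have "tp L \<MM> B ({..<n} \<times> V) (\<lambda>(k, v). b (id k) v) = tp L \<MM> B ({..<n} \<times> V) (\<lambda>(k, v). b (d k) v)"
            using b unfolding indiscernible_def by blast
          from tp_eqD[OF this F] show "holds \<MM> (\<lambda>(k, v). b (d k) v) \<psi>" using \<psi> by (simp add: tp_def)
        qed
        then show "\<psi> \<in> tp L \<MM> B ({..<n} \<times> V) (\<lambda>(k, v). c k v)" using F by (simp add: tp_def)
      qed
      then show "tp L \<MM> B ({..<n} \<times> V) (\<lambda>(k, v). c k v) = tp L \<MM> B ({..<n} \<times> V) (\<lambda>(k, v). b k v)"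
        using tp_eq_type type_over_tp by metis
    qed
  next
    fix B assume B: "B \<subseteq> A" and b: "\<And>i. tp L \<MM> B V (b i) = tp L \<MM> B V (b 0)"
    have "tp L \<MM> B V (b 0) \<subseteq> tp L \<MM> B V (c 0)"
    proof
      fix \<psi> assume \<psi>: "\<psi> \<in> tp L \<MM> B V (b 0)"
      let ?\<psi> = "map_fo_formula (map_sum (\<lambda>v. (0 :: nat, v)) id) \<psi>"
      have F: "\<psi> \<in> formulas L V B" using \<psi> by (simp add: tp_def)
      have r: "holds \<MM> (\<lambda>(k, v). t k v) ?\<psi> = holds \<MM> (t 0) \<psi>" for t :: "nat \<Rightarrow> 'x \<Rightarrow> 'a"
        unfolding holds_reindex[symmetric] by (simp add: comp_def)
      have "holds \<MM> (\<lambda>(k, v). c k v) ?\<psi>"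
      proof (rule EM[of _ 1])
        show "?\<psi> \<in> formulas L ({..<1} \<times> V) A" using F by (rule formulas_map) (use B in auto)
        fix d :: "nat \<Rightarrow> nat"
        show "holds \<MM> (\<lambda>(k, v). b (d k) v) ?\<psi>"
          using r[of "\<lambda>k. b (d k)"] tp_eqD[OF b F, of "d 0"] \<psi> by (simp add: tp_def)
      qed
      then show "\<psi> \<in> tp L \<MM> B V (c 0)" using r F by (simp add: tp_def)
    qed
    then show "tp L \<MM> B V (c 0) = tp L \<MM> B V (b 0)" using tp_eq_type type_over_tp by metis
  qed (rule c)
qed

end

section \<open>Sequences indexed by labels\<close>

context monster
begin

text \<open>The definitions index sequences by orders on labels. A copy of the natural numbers among
  the labels presents sequences of length \<omega> in that form.\<close>

definition nat_label :: "nat \<Rightarrow> 'k" where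
  "nat_label = (SOME f. inj f)"

definition label_order :: "'k rel" where
  "label_order = (\<lambda>(m, n). (nat_label m, nat_label n)) ` natLeq"

definition label_seq :: "(nat \<Rightarrow> 'b) \<Rightarrow> 'k \<Rightarrow> 'b" where
  "label_seq s = s \<circ> inv nat_label"

lemma inj_nat_label: "inj nat_label"
proof -
  obtain f :: "nat \<Rightarrow> 'k" where "inj f" using small_inj[OF small_nat, of UNIV] .
  then have "\<exists>f :: nat \<Rightarrow> 'k. inj f" by blast
  then show ?thesis unfolding nat_label_def by (rule someI_ex)
qed

lemma label_seq [simp]: "label_seq s (nat_label n) = s n"
  by (simp add: label_seq_def inv_f_f[OF inj_nat_label])

lemma label_order_iff [simp]: "(nat_label m, nat_label n) \<in> label_order \<longleftrightarrow> m \<le> n"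
  using inj_nat_label by (auto simp: label_order_def natLeq_def inj_eq)

lemma label_orderE: 
  assumes "(x, y) \<in> label_order" 
  obtains m n where "x = nat_label m" "y = nat_label n" "m \<le> n"
  using assms by (auto simp: label_order_def natLeq_def)

lemma Field_label_order: "Field label_order = range nat_label"
proof
  show "Field label_order \<subseteq> range nat_label" by (auto simp: Field_def elim!: label_orderE)
  show "range nat_label \<subseteq> Field label_order"
    unfolding Field_def using label_order_iff[of _ _] by blast
qed

lemma underS_label_order: "underS label_order (nat_label n) = nat_label ` {..<n}"
  using inj_nat_label by (fastforce simp: underS_def inj_eq elim!: label_orderE)

lemma sequence_order_label: "sequence_order label_order"
proof -
  have "Refl label_order" unfolding refl_on_def Field_label_order by (auto elim!: label_orderE)
  moreover have "trans label_order"
    using inj_nat_label by (intro transI) (auto simp: inj_eq elim!: label_orderE)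
  moreover have "antisym label_order"
    using inj_nat_label by (intro antisymI) (auto simp: inj_eq elim!: label_orderE)
  moreover have "Total label_order" unfolding total_on_def Field_label_order by auto
  moreover have "label_order \<subseteq> Field label_order \<times> Field label_order" by (auto simp: Field_def)
  ultimately have "Linear_order label_order"
    by (simp add: linear_order_on_def partial_order_on_def preorder_on_def)
  moreover have "infinite (range nat_label)" using inj_nat_label finite_imageD by blast
  ultimately show ?thesis unfolding sequence_order_def Field_label_order by simp
qed

lemma before_label: "before label_order V (label_seq s) (nat_label n) = before natLeq V s n"
  by (simp add: before_def[of label_order] underS_label_order)

lemma Morley_label: "Morley P C V label_order (label_seq s) \<longleftrightarrow> Morley P C V natLeq s"
  by (simp add: Morley_def Field_label_order before_label del: before_nat)

lemma starts_with_label: "(\<And>v. v \<in> V \<Longrightarrow> s 0 v = b v) \<Longrightarrow> starts_with label_order V (label_seq s) b"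
  unfolding starts_with_def Field_label_order by (rule bexI[of _ "nat_label 0"]) auto

lemma consistent_along_label: "consistent_along \<MM> label_order (label_seq s) \<phi> \<longleftrightarrow> consistent_along \<MM> natLeq s \<phi>"
  by (simp add: consistent_along_def Field_label_order image_image)

lemma indiscernible_label:
  assumes "indiscernible L \<MM> C V natLeq s"
  shows "indiscernible L \<MM> C V label_order (label_seq s)"
  unfolding indiscernible_def label_seq_def comp_def
proof (intro allI impI, elim conjE)
  fix n e e'
  have *: "increasing natLeq n (\<lambda>k. inv nat_label (f k))" if f: "increasing label_order n f" for f
    unfolding increasing_nat
  proof (intro allI impI)
    fix l k assume l: "l < n" and k: "k < l"
    then have "f l \<in> range nat_label" using f Field_label_order by (simp add: increasing_def)
    then obtain m where m: "f l = nat_label m" by auto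
    have "f k \<in> underS label_order (f l)" using f l k by (simp add: increasing_def)
    then obtain j where "f k = nat_label j" "j < m" unfolding m underS_label_order by auto
    then show "inv nat_label (f k) < inv nat_label (f l)" using m by (simp add: inv_f_f[OF inj_nat_label])
  qed
  assume "increasing label_order n e" "increasing label_order n e'"
  then show "tp L \<MM> C ({..<n} \<times> V) (\<lambda>(k, v). s (inv nat_label (e k)) v) =
    tp L \<MM> C ({..<n} \<times> V) (\<lambda>(k, v). s (inv nat_label (e' k)) v)"
    using indiscernibleD[OF assms * *] by blast
qed

lemma small_model_small: "small_model M \<Longrightarrow> small M"
  by (simp add: small_model_def)

lemma small_before: "sequence_order R \<Longrightarrow> small V \<Longrightarrow> small (before R V s i)"
  unfolding before_def by (rule small_UN_image, rule small_subset[of "Field R"]) (auto simp: sequence_order_def underS_def Field_def)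

lemma small_before_nat: "small V \<Longrightarrow> small (before natLeq V s i)"
  unfolding before_nat by (rule small_UN_image) auto

lemma small_UN_finite: "finite I \<Longrightarrow> (\<And>i. i \<in> I \<Longrightarrow> small (S i)) \<Longrightarrow> small (\<Union>i\<in>I. S i)"
  by (induction rule: finite_induct) auto

lemma sequence_order_Linear: "sequence_order R \<Longrightarrow> Linear_order R"
  by (simp add: sequence_order_def)

lemma indiscernible_tp:
  assumes "indiscernible L \<MM> C V R s" "i \<in> Field R" "j \<in> Field R"
  shows "tp L \<MM> C V (s i) = tp L \<MM> C V (s j)"
proof -
  have "tp L \<MM> C ({..<1} \<times> V) (\<lambda>(k :: nat, v). s i v) = tp L \<MM> C ({..<1} \<times> V) (\<lambda>(k, v). s j v)"
    by (rule indiscernibleD[OF assms(1), of 1 "\<lambda>_. i" "\<lambda>_. j"]) (use assms in \<open>auto simp: increasing_def\<close>)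
  from tp_reindex[OF this, of "\<lambda>v. (0, v)" V] show ?thesis by (simp add: comp_def image_subset_iff)
qed

lemma indiscernible_push:
  fixes s :: "'i \<Rightarrow> 'x \<Rightarrow> 'a"
  assumes s: "indiscernible L \<MM> C V R s" and small: "small C" "small V" and \<sigma>: "\<sigma> \<in> stab D"
  shows "indiscernible L \<MM> (\<sigma> ` C) V R (\<lambda>i. \<sigma> \<circ> s i)"
  unfolding indiscernible_def
proof (intro allI impI, elim conjE)
  fix n e e' assume "increasing R n e" "increasing R n e'"
  then have "tp L \<MM> C ({..<n} \<times> V) (\<lambda>(k, v). s (e k) v) = tp L \<MM> C ({..<n} \<times> V) (\<lambda>(k, v). s (e' k) v)"
    by (rule indiscernibleD[OF s])
  from tp_conjugate[OF small(1) _ \<sigma> this]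
  have "tp L \<MM> (\<sigma> ` C) ({..<n} \<times> V) (\<sigma> \<circ> (\<lambda>(k, v). s (e k) v)) = tp L \<MM> (\<sigma> ` C) ({..<n} \<times> V) (\<sigma> \<circ> (\<lambda>(k, v). s (e' k) v))"
    using small by simp
  moreover have "\<sigma> \<circ> (\<lambda>(k, v). s (f k) v) = (\<lambda>(k, v). (\<sigma> \<circ> s (f k)) v)" for f :: "nat \<Rightarrow> 'i" by auto
  ultimately show "tp L \<MM> (\<sigma> ` C) ({..<n} \<times> V) (\<lambda>(k, v). (\<sigma> \<circ> s (e k)) v) = tp L \<MM> (\<sigma> ` C) ({..<n} \<times> V) (\<lambda>(k, v). (\<sigma> \<circ> s (e' k)) v)"
    by simp
qed

lemma indiscernible_cong:
  assumes s: "indiscernible L \<MM> C V R s" and eq: "\<And>i v. i \<in> Field R \<Longrightarrow> v \<in> V \<Longrightarrow> s' i v = s i v"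
  shows "indiscernible L \<MM> C V R s'"
  unfolding indiscernible_def
proof (intro allI impI, elim conjE)
  fix n e e' assume inc: "increasing R n e" "increasing R n e'"
  have *: "tp L \<MM> C ({..<n} \<times> V) (\<lambda>(k, v). s' (f k) v) = tp L \<MM> C ({..<n} \<times> V) (\<lambda>(k, v). s (f k) v)"
    if "increasing R n f" for f
    by (rule tp_cong) (use that eq in \<open>auto simp: increasing_def\<close>)
  show "tp L \<MM> C ({..<n} \<times> V) (\<lambda>(k, v). s' (e k) v) = tp L \<MM> C ({..<n} \<times> V) (\<lambda>(k, v). s' (e' k) v)"
    using indiscernibleD[OF s inc] *[OF inc(1)] *[OF inc(2)] by simp
qed

end

section \<open>The canonical invariant extension\<close>

locale independence = monster L T \<kappa> \<MM>
  for L :: "('f, 'r) lang" and T :: "('f, 'r, nat) fo_formula set" and \<kappa> :: "'k rel" and \<MM> :: "('f, 'r, 'a) struct" +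
  fixes ind :: "'a set \<Rightarrow> 'a set \<Rightarrow> 'a set \<Rightarrow> bool"
  assumes invariance: "invariance ind"
    and monotonicity: "monotonicity ind"
    and full_existence: "full_existence ind"
    and full_stationarity: "full_stationarity ind"
    and generalized_freedom: "generalized_freedom ind"
begin

lemma ind_mono: "ind A M B \<Longrightarrow> small_model M \<Longrightarrow> small A \<Longrightarrow> small B \<Longrightarrow> A0 \<subseteq> A \<Longrightarrow> B0 \<subseteq> B \<Longrightarrow> ind A0 M B0"
  using monotonicity unfolding monotonicity_def by blast

text \<open>Invariance compares joint enumerations of the three sets; a labelled tuple
  \<open>e\<close> for their union and its image \<open>\<sigma> \<circ> e\<close> are two such
  enumerations with equal types.\<close>

lemma ind_stab:
  assumes M: "small_model M" and AB: "small A" "small B" and \<sigma>: "\<sigma> \<in> stab M" and ind: "ind A M B"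
  shows "ind (\<sigma> ` A) M (\<sigma> ` B)"
proof -
  have "small (A \<union> M \<union> B)" using small_model_small[OF M] AB by simp
  then obtain W :: "'k set" and e where e: "small W" "e ` W = A \<union> M \<union> B" using small_enum by metis
  define I where "I S = {w \<in> W. e w \<in> S}" for S
  have im: "e ` I S = S" if "S \<subseteq> A \<union> M \<union> B" for S
  proof -
    have "S \<subseteq> e ` W" using e(2) that by simp
    then show ?thesis unfolding I_def by blast
  qed
  have im': "(\<sigma> \<circ> e) ` I S = \<sigma> ` S" if "S \<subseteq> A \<union> M \<union> B" for S using im[OF that] by (metis image_comp)
  have sm: "small (I S)" for S by (rule small_subset[OF e(1)]) (auto simp: I_def)
  have tp: "tp L \<MM> {} (I A \<union> I M \<union> I B) e = tp L \<MM> {} (I A \<union> I M \<union> I B) (\<sigma> \<circ> e)"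
    by (rule tp_stabI[OF stab_mono[OF \<sigma> empty_subsetI], symmetric]) simp
  have \<sigma>M: "\<sigma> ` M = M" using stab_image[OF \<sigma>] by simp
  have e1: "e ` I A = A" "e ` I M = M" "e ` I B = B" by (rule im, blast)+
  have e2: "(\<sigma> \<circ> e) ` I A = \<sigma> ` A" "(\<sigma> \<circ> e) ` I M = M" "(\<sigma> \<circ> e) ` I B = \<sigma> ` B"
    by (rule im', blast, subst im', blast, rule \<sigma>M, rule im', blast)
  have "ind (e ` I A) (e ` I M) (e ` I B) \<longleftrightarrow> ind ((\<sigma> \<circ> e) ` I A) ((\<sigma> \<circ> e) ` I M) ((\<sigma> \<circ> e) ` I B)"
    using invariance[unfolded invariance_def, rule_format, of "I A" "I B" "I M" e "\<sigma> \<circ> e"] sm tp M e1(2) e2(2) by metis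
  then show ?thesis using ind unfolding e1 e2 by simp
qed

lemma stationary:
  fixes V :: "'k set"
  assumes "small_model M" "small V" "small B" "ind (a ` V) M B" "ind (a' ` V) M B" "tp L \<MM> M V a = tp L \<MM> M V a'"
  shows "tp L \<MM> (M \<union> B) V a = tp L \<MM> (M \<union> B) V a'"
  using full_stationarity assms unfolding full_stationarity_def by blast

lemma ind_exists:
  fixes V :: "'k set"
  assumes "small_model M" "small V" "small B"
  obtains a' where "tp L \<MM> M V a' = tp L \<MM> M V a" "ind (a' ` V) M B"
  using full_existence assms unfolding full_existence_def by blast

text \<open>The intended \<open>p\<^sup>*\<close>, collected from all realizations of
  \<open>p\<close> that are independent from the parameters involved. Any small \<open>B\<close>
  covering the parameters may be used; stationarity makes the choice immaterial.\<close>

definition generic :: "'a set \<Rightarrow> 'k set \<Rightarrow> ('f, 'r, 'k + 'a) fo_formula set \<Rightarrow> ('f, 'r, 'k + 'a) fo_formula set" where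
  "generic M V p = {\<phi>. \<exists>B a. small B \<and> \<phi> \<in> formulas L V (M \<union> B) \<and> tp L \<MM> M V a = p \<and> ind (a ` V) M B \<and> holds \<MM> a \<phi>}"

lemma generic_tp:
  assumes M: "small_model M" "small V" and a: "tp L \<MM> M V a = p" and B: "small B" "ind (a ` V) M B"
  shows "tp L \<MM> (M \<union> B) V a = restrict_type (generic M V p) (M \<union> B)"
proof
  show "tp L \<MM> (M \<union> B) V a \<subseteq> restrict_type (generic M V p) (M \<union> B)"
  proof
    fix \<phi> assume "\<phi> \<in> tp L \<MM> (M \<union> B) V a"
    then have "\<phi> \<in> formulas L V (M \<union> B)" "holds \<MM> a \<phi>" by (auto simp: tp_def)
    moreover from this have "fv \<phi> \<subseteq> UNIV <+> (M \<union> B)" by (auto simp: formulas_def)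
    ultimately show "\<phi> \<in> restrict_type (generic M V p) (M \<union> B)"
      using a B unfolding restrict_type_def generic_def by blast
  qed
  show "restrict_type (generic M V p) (M \<union> B) \<subseteq> tp L \<MM> (M \<union> B) V a"
  proof
    fix \<phi> assume \<phi>: "\<phi> \<in> restrict_type (generic M V p) (M \<union> B)"
    then obtain B' a' where a': "small B'" "\<phi> \<in> formulas L V (M \<union> B')" "tp L \<MM> M V a' = p" "ind (a' ` V) M B'" "holds \<MM> a' \<phi>"
      unfolding restrict_type_def generic_def by blast
    have F: "\<phi> \<in> formulas L V (M \<union> B)" using \<phi> a'(2) by (auto simp: restrict_type_def formulas_def)
    have BB: "small (B \<union> B')" using a' B by simp
    \<comment> \<open>One realization independent from both parameter sets links \<open>a\<close>
      with \<open>a'\<close>: monotonicity and stationarity give it the type of \<open>a\<close>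
      over \<open>M \<union> B\<close> and that of \<open>a'\<close> over
      \<open>M \<union> B'\<close>.\<close>
    obtain a'' where a'': "tp L \<MM> M V a'' = tp L \<MM> M V a" "ind (a'' ` V) M (B \<union> B')"
      using ind_exists[OF M BB] .
    have "ind (a'' ` V) M B" "ind (a'' ` V) M B'" using ind_mono[OF a''(2) M(1) _ BB] M(2) by auto
    moreover have "tp L \<MM> M V a'' = tp L \<MM> M V a'" using a''(1) a a'(3) by simp
    ultimately have "tp L \<MM> (M \<union> B) V a'' = tp L \<MM> (M \<union> B) V a" "tp L \<MM> (M \<union> B') V a'' = tp L \<MM> (M \<union> B') V a'"
      using stationary[OF M B(1) _ B(2) a''(1)] stationary[OF M a'(1) _ a'(4)] by blast+
    then have "holds \<MM> a \<phi>" using a'(5) tp_eqD F a'(2) by metis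
    then show "\<phi> \<in> tp L \<MM> (M \<union> B) V a" using F by (simp add: tp_def)
  qed
qed

lemma formulas_params:
  assumes "\<phi> \<in> formulas L V C"
  shows "\<phi> \<in> formulas L V (M \<union> Inr -` fv \<phi>)"
proof (rule formulasI)
  show "fv \<phi> \<subseteq> V <+> (M \<union> Inr -` fv \<phi>)"
  proof
    fix u assume "u \<in> fv \<phi>"
    then show "u \<in> V <+> (M \<union> Inr -` fv \<phi>)" using assms by (cases u) (auto simp: formulas_def)
  qed
qed (rule formulas_wf[OF assms])

lemma generic_properties:
  assumes M: "small_model M" "small V" and p: "type_over L \<MM> M V p"
  shows "global_type L \<MM> V (generic M V p)" "restrict_type (generic M V p) M = p" "star ind M V p = generic M V p"
    "\<And>B a. small B \<Longrightarrow> tp L \<MM> (M \<union> B) V a = restrict_type (generic M V p) (M \<union> B) \<Longrightarrow> ind (a ` V) M B"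
proof -
  note sM = small_model_small[OF M(1)]
  obtain a0 where a0: "tp L \<MM> M V a0 = p" using realize_type[OF p sM M(2)] .
  have ex: "\<exists>a. tp L \<MM> M V a = p \<and> ind (a ` V) M B" if "small B" for B
    using ind_exists[OF M that, of a0] a0 by metis
  note params = formulas_params[where V = V and M = M]
  have sp: "small (Inr -` fv \<phi>)" for \<phi> :: "('f, 'r, 'k + 'a) fo_formula" by (simp add: finite_vimageI)
  show g: "global_type L \<MM> V (generic M V p)"
    unfolding type_over_def
  proof (intro conjI ballI)
    show sub: "generic M V p \<subseteq> formulas L V UNIV"
    proof
      fix \<phi> assume "\<phi> \<in> generic M V p"
      then obtain B where "\<phi> \<in> formulas L V (M \<union> B)" by (auto simp: generic_def)
      then show "\<phi> \<in> formulas L V UNIV" by (rule formulas_mono) auto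
    qed
    show "consistent \<MM> (generic M V p)" unfolding consistent_def
    proof (intro allI impI)
      fix \<Psi> assume \<Psi>: "\<Psi> \<subseteq> generic M V p" "finite \<Psi>"
      let ?B = "\<Union>\<psi>\<in>\<Psi>. Inr -` fv \<psi>"
      have B: "small ?B" using \<Psi>(2) by (simp add: finite_vimageI)
      obtain a where a: "tp L \<MM> M V a = p" "ind (a ` V) M ?B" using ex[OF B] by blast
      have "holds \<MM> a \<psi>" if \<psi>: "\<psi> \<in> \<Psi>" for \<psi>
      proof -
        have "\<psi> \<in> formulas L V (M \<union> Inr -` fv \<psi>)" using params \<psi> \<Psi>(1) sub by blast
        then have "\<psi> \<in> formulas L V (M \<union> ?B)" by (rule formulas_mono) (use \<psi> in auto)
        then have "\<psi> \<in> restrict_type (generic M V p) (M \<union> ?B)"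
          using \<psi> \<Psi>(1) by (auto simp: restrict_type_def formulas_def)
        then show ?thesis using generic_tp[OF M a(1) B a(2)] by (auto simp: tp_def)
      qed
      then show "\<exists>a. \<forall>\<psi>\<in>\<Psi>. holds \<MM> a \<psi>" by blast
    qed
    fix \<phi> :: "('f, 'r, 'k + 'a) fo_formula" assume \<phi>: "\<phi> \<in> formulas L V UNIV"
    obtain a where a: "tp L \<MM> M V a = p" "ind (a ` V) M (Inr -` fv \<phi>)" using ex[OF sp] by blast
    have "Neg \<phi> \<in> formulas L V (M \<union> Inr -` fv \<phi>)" using params[OF \<phi>] by simp
    then show "\<phi> \<in> generic M V p \<or> Neg \<phi> \<in> generic M V p"
      using a sp params[OF \<phi>] unfolding generic_def by (cases "holds \<MM> a \<phi>") force+
  qed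
  show r: "restrict_type (generic M V p) M = p"
  proof -
    obtain a where a: "tp L \<MM> M V a = p" "ind (a ` V) M {}" using ex[of "{}"] by auto
    show ?thesis using generic_tp[OF M a(1) _ a(2)] a(1) by simp
  qed
  show i: "ind (a ` V) M B" if B: "small B" and a: "tp L \<MM> (M \<union> B) V a = restrict_type (generic M V p) (M \<union> B)" for B a
  proof -
    \<comment> \<open>Some independent realization \<open>a'\<close> exists and has the same type
      over \<open>M \<union> B\<close> as \<open>a\<close>; invariance carries its independence to
      \<open>a\<close>.\<close>
    obtain a' where a': "tp L \<MM> M V a' = p" "ind (a' ` V) M B" using ex[OF B] by blast
    have "small (M \<union> B)" using sM B by simp
    then obtain \<sigma> where \<sigma>: "\<sigma> \<in> stab (M \<union> B)" "\<And>v. v \<in> V \<Longrightarrow> \<sigma> (a' v) = a v"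
      using tp_stabD[of "M \<union> B" V a' a] M(2) a generic_tp[OF M a'(1) B a'(2)] by metis
    have "ind (\<sigma> ` a' ` V) M (\<sigma> ` B)"
      by (rule ind_stab[OF M(1) _ B stab_mono[OF \<sigma>(1)] a'(2)]) (use M(2) in auto)
    moreover have "\<sigma> ` a' ` V = a ` V" using \<sigma>(2) by (auto simp: image_image)
    moreover have "\<sigma> ` B = B" using stab_image[OF \<sigma>(1), of B] by simp
    ultimately show ?thesis by simp
  qed
  show "star ind M V p = generic M V p"
    unfolding star_def
  proof (rule the_equality)
    show "global_type L \<MM> V (generic M V p) \<and> restrict_type (generic M V p) M = p \<and>
      (\<forall>B a. small B \<and> tp L \<MM> (M \<union> B) V a = restrict_type (generic M V p) (M \<union> B) \<longrightarrow> ind (a ` V) M B)"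
      using g r i by blast
    fix P assume P: "global_type L \<MM> V P \<and> restrict_type P M = p \<and>
      (\<forall>B a. small B \<and> tp L \<MM> (M \<union> B) V a = restrict_type P (M \<union> B) \<longrightarrow> ind (a ` V) M B)"
    then have Pf: "P \<subseteq> formulas L V UNIV" by (simp add: type_over_def)
    \<comment> \<open>Uniqueness: a realization of \<open>P\<close> over \<open>M\<close> and the
      parameters of a formula is independent from them by the assumption on \<open>P\<close>, hence
      witnesses membership in \<open>generic\<close>.\<close>
    have "P \<subseteq> generic M V p"
    proof
      fix \<phi> assume \<phi>: "\<phi> \<in> P"
      let ?B = "Inr -` fv \<phi>"
      have sB: "small ?B" "small (M \<union> ?B)" using sp sM by auto
      obtain a where a: "tp L \<MM> (M \<union> ?B) V a = restrict_type P (M \<union> ?B)"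
        using realize_restrict[of V P "M \<union> ?B"] P sB M(2) by blast
      then have "ind (a ` V) M ?B" using P sB by blast
      moreover have "tp L \<MM> M V a = p" using tp_restrict_mono[OF Pf a] P by simp
      moreover have "\<phi> \<in> tp L \<MM> (M \<union> ?B) V a"
        unfolding a restrict_type_formulas[OF Pf] using \<phi> Pf params by blast
      ultimately show "\<phi> \<in> generic M V p" using sB unfolding generic_def tp_def by blast
    qed
    then show "P = generic M V p" using type_over_eqI[OF _ g] P by blast
  qed
qed

abbreviation canon :: "'a set \<Rightarrow> 'k set \<Rightarrow> ('k \<Rightarrow> 'a) \<Rightarrow> ('f, 'r, 'k + 'a) fo_formula set" where
  "canon M V b \<equiv> star ind M V (tp L \<MM> M V b)"

lemma canon_global:
  assumes "small_model M" "small V"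
  shows "global_type L \<MM> V (canon M V b)"
  using generic_properties(1,3)[OF assms type_over_tp] by simp

lemma canon_restrict:
  assumes "small_model M" "small V"
  shows "restrict_type (canon M V b) M = tp L \<MM> M V b"
  using generic_properties(2,3)[OF assms type_over_tp] by simp

text \<open>This turns statements about \<open>ind\<close> into statements about one invariant
  global type, to which the general facts on Morley sequences apply.\<close>

lemma canon_iff:
  assumes M: "small_model M" "small V" and B: "small B"
  shows "tp L \<MM> (M \<union> B) V a = restrict_type (canon M V b) (M \<union> B) \<longleftrightarrow> tp L \<MM> M V a = tp L \<MM> M V b \<and> ind (a ` V) M B"
proof
  have Pf: "canon M V b \<subseteq> formulas L V UNIV" using canon_global[OF M] by (simp add: type_over_def)
  assume a: "tp L \<MM> (M \<union> B) V a = restrict_type (canon M V b) (M \<union> B)"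
  then have "tp L \<MM> M V a = restrict_type (canon M V b) M" by (rule tp_restrict_mono[OF Pf]) simp
  then show "tp L \<MM> M V a = tp L \<MM> M V b \<and> ind (a ` V) M B"
    using a canon_restrict[OF M] generic_properties(3,4)[OF M type_over_tp] B by metis
next
  assume a: "tp L \<MM> M V a = tp L \<MM> M V b \<and> ind (a ` V) M B"
  then show "tp L \<MM> (M \<union> B) V a = restrict_type (canon M V b) (M \<union> B)"
    using generic_tp[OF M _ B] generic_properties(3)[OF M type_over_tp] by metis
qed

lemma canon_stab_invariant:
  assumes M: "small_model M" "small V"
  shows "stab_invariant M (canon M V b)"
  unfolding stab_invariant_def generic_properties(3)[OF M type_over_tp]
proof (intro ballI)
  fix \<sigma> \<phi> assume \<sigma>: "\<sigma> \<in> stab M" and "\<phi> \<in> generic M V (tp L \<MM> M V b)"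
  then obtain B a where B: "small B" "\<phi> \<in> formulas L V (M \<union> B)" "tp L \<MM> M V a = tp L \<MM> M V b" "ind (a ` V) M B" "holds \<MM> a \<phi>"
    unfolding generic_def by blast
  have 1: "map_fo_formula (map_sum id \<sigma>) \<phi> \<in> formulas L V (M \<union> \<sigma> ` B)"
    using B(2) by (rule formulas_map) (use stab_fix[OF \<sigma>] in auto)
  have 2: "tp L \<MM> M V (\<sigma> \<circ> a) = tp L \<MM> M V b" using tp_stabI[OF \<sigma>, of V "\<sigma> \<circ> a" a] B(3) by simp
  have 3: "ind ((\<sigma> \<circ> a) ` V) M (\<sigma> ` B)"
    using ind_stab[OF M(1) _ B(1) \<sigma> B(4)] M(2) by (simp add: image_comp)
  have 4: "holds \<MM> (\<sigma> \<circ> a) (map_fo_formula (map_sum id \<sigma>) \<phi>)"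
    using holds_push[OF \<sigma> formulas_wf[OF B(2)]] B(5) by simp
  show "map_fo_formula (map_sum id \<sigma>) \<phi> \<in> generic M V (tp L \<MM> M V b)"
    unfolding generic_def using 1 2 3 4 small_image[OF B(1)] by blast
qed

lemma canon_Morley_iff:
  assumes M: "small_model M" "small V" and R: "sequence_order R"
  shows "Morley (canon M V b) M V R s \<longleftrightarrow>
    ind_Morley ind M V R s \<and> (\<forall>i\<in>Field R. tp L \<MM> M V (s i) = tp L \<MM> M V b)"
  unfolding Morley_def ind_Morley_def using canon_iff[OF M small_before[OF R M(2)]] R by metis

lemma canon_Morley_nat_iff:
  assumes M: "small_model M" "small V"
  shows "Morley (canon M V b) M V natLeq s \<longleftrightarrow>
    (\<forall>i. tp L \<MM> M V (s i) = tp L \<MM> M V b \<and> ind (s i ` V) M (before natLeq V s i))"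
  unfolding Morley_def using canon_iff[OF M small_before_nat[OF M(2)]] by simp

lemma canon_Morley_label:
  assumes M: "small_model M" "small V" and s: "Morley (canon M V b) M V natLeq s"
  shows "ind_Morley ind M V label_order (label_seq s)"
  using s canon_Morley_iff[OF M sequence_order_label] unfolding Morley_label[symmetric] by blast

lemma ind_Morley_canon:
  assumes M: "small_model M" "small V" and s: "ind_Morley ind M V R s" "starts_with R V s b"
  shows "Morley (canon M V b) M V R s"
proof -
  obtain i where i: "i \<in> Field R" "\<forall>v\<in>V. s i v = b v" using s(2) by (auto simp: starts_with_def)
  then have "tp L \<MM> M V (s i) = tp L \<MM> M V b" by (intro tp_cong) auto
  then have "\<forall>j\<in>Field R. tp L \<MM> M V (s j) = tp L \<MM> M V b" using s(1) i(1) unfolding ind_Morley_def by metis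
  then show ?thesis using canon_Morley_iff[OF M, of R] s(1) by (auto simp: ind_Morley_def)
qed

lemma ex_canon_Morley:
  assumes M: "small_model M" "small V"
  obtains s where "Morley (canon M V b) M V natLeq s" "\<And>v. v \<in> V \<Longrightarrow> s 0 v = b v"
  using ex_Morley_start[OF canon_global[OF M] canon_stab_invariant[OF M] order_refl M(2) small_model_small[OF M(1)]]
    canon_restrict[OF M] by metis

section \<open>Kim-dividing and Kim-independence\<close>

lemma canon_consistent_transfer:
  assumes M: "small_model M" "small V" and s: "Morley (canon M V b) M V R s" "Linear_order R"
    and s': "Morley (canon M V b) M V R' s'" "Linear_order R'" "infinite (Field R')" and \<phi>: "\<phi> \<in> formulas L X (V <+> M)"
    and con: "consistent_along \<MM> R' s' \<phi>"
  shows "consistent_along \<MM> R s \<phi>"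
  by (rule consistent_transfer[OF canon_global[OF M] canon_stab_invariant[OF M] order_refl small_model_small[OF M(1)] M(2) s s'(1,2)
      order_refl s'(3) \<phi>]) (use con in \<open>simp add: consistent_along_iff\<close>)

text \<open>All canonical Morley sequences in the type of \<open>b\<close> agree on consistency of
  \<open>\<phi>\<close>, so one sequence decides Kim-dividing even if it does not start with
  \<open>b\<close>.\<close>

lemma Kim_divides_iff:
  assumes M: "small_model M" "small V" and \<phi>: "\<phi> \<in> formulas L X (V <+> M)" and s: "Morley (canon M V b) M V natLeq s"
  shows "Kim_divides ind M V \<phi> b \<longleftrightarrow> \<not> consistent_along \<MM> natLeq s \<phi>"
proof
  have inf: "infinite (Field natLeq)" by simp
  {
    assume "Kim_divides ind M V \<phi> b"
    then obtain R s' where s': "ind_Morley ind M V R s'" "starts_with R V s' b" "\<not> consistent_along \<MM> R s' \<phi>"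
      by (auto simp: Kim_divides_def)
    then have "Linear_order R" using sequence_order_Linear by (auto simp: ind_Morley_def)
    then show "\<not> consistent_along \<MM> natLeq s \<phi>"
      using canon_consistent_transfer[OF M ind_Morley_canon[OF M s'(1,2)] _ s natLeq_Linear_order inf \<phi>] s'(3) by blast
  }
  assume n: "\<not> consistent_along \<MM> natLeq s \<phi>"
  obtain t where t: "Morley (canon M V b) M V natLeq t" "\<And>v. v \<in> V \<Longrightarrow> t 0 v = b v" using ex_canon_Morley[OF M] by blast
  have "\<not> consistent_along \<MM> natLeq t \<phi>"
    using canon_consistent_transfer[OF M s natLeq_Linear_order t(1) natLeq_Linear_order inf \<phi>] n by blast
  then show "Kim_divides ind M V \<phi> b"
    unfolding Kim_divides_def using canon_Morley_label[OF M t(1)] starts_with_label[of V t b] t(2) consistent_along_label by blast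
qed

lemma Kim_divides_cong:
  assumes M: "small_model M" "small V" and \<phi>: "\<phi> \<in> formulas L X (V <+> M)" and b: "tp L \<MM> M V b = tp L \<MM> M V b'"
  shows "Kim_divides ind M V \<phi> b \<longleftrightarrow> Kim_divides ind M V \<phi> b'"
proof -
  obtain s where s: "Morley (canon M V b) M V natLeq s" using ex_canon_Morley[OF M] by blast
  then show ?thesis using Kim_divides_iff[OF M \<phi> s] Kim_divides_iff[OF M \<phi>, of b' s] b by simp
qed

section \<open>Changing tuples and variables in Kim-dividing formulas\<close>

lemma inst_reindex: "inst c (map_fo_formula (map_sum id (map_sum f id)) \<phi>) = inst (c \<circ> f) \<phi>"
  unfolding inst_def fo_formula.map_comp
  by (rule fo_formula.map_cong0) (auto simp: map_sum_def split: sum.split)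

text \<open>Restricting each term of a canonical Morley sequence along \<open>f\<close> gives a
  canonical Morley sequence again, by monotonicity of \<open>ind\<close>. Hence the tuple through
  which the parameters are enumerated does not matter.\<close>

lemma Kim_divides_reindex:
  assumes M: "small_model M" "small V" "small W" and f: "f ` V \<subseteq> W" "\<And>v. v \<in> V \<Longrightarrow> c (f v) = b v"
    and \<phi>: "\<phi> \<in> formulas L X (V <+> M)"
  shows "Kim_divides ind M W (map_fo_formula (map_sum id (map_sum f id)) \<phi>) c \<longleftrightarrow> Kim_divides ind M V \<phi> b"
proof -
  obtain s where s: "Morley (canon M W c) M W natLeq s" using ex_canon_Morley[OF M(1,3)] by blast
  have tb: "tp L \<MM> M V (c \<circ> f) = tp L \<MM> M V b" by (rule tp_cong) (use f in auto)
  have "Morley (canon M V b) M V natLeq (\<lambda>i. s i \<circ> f)"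
    unfolding canon_Morley_nat_iff[OF M(1,2)]
  proof (intro allI conjI)
    fix i
    have i: "tp L \<MM> M W (s i) = tp L \<MM> M W c" "ind (s i ` W) M (before natLeq W s i)"
      using s canon_Morley_nat_iff[OF M(1,3)] by auto
    show "tp L \<MM> M V (s i \<circ> f) = tp L \<MM> M V b" using tp_reindex[OF i(1) f(1)] tb by simp
    show "ind ((s i \<circ> f) ` V) M (before natLeq V (\<lambda>i. s i \<circ> f) i)"
      by (rule ind_mono[OF i(2) M(1) _ small_before_nat[OF M(3)]]) (use f(1) M(3) in auto)
  qed
  from Kim_divides_iff[OF M(1,2) \<phi> this]
  have 1: "Kim_divides ind M V \<phi> b \<longleftrightarrow> \<not> consistent_along \<MM> natLeq (\<lambda>i. s i \<circ> f) \<phi>" .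
  have "map_fo_formula (map_sum id (map_sum f id)) \<phi> \<in> formulas L X (W <+> M)"
    using \<phi> by (rule formulas_map) (use f in auto)
  from Kim_divides_iff[OF M(1,3) this s] show ?thesis
    unfolding 1 by (simp add: consistent_along_def inst_reindex)
qed

lemma Kim_divides_mono:
  assumes M: "small_model M" "small W" "V \<subseteq> W" and \<phi>: "\<phi> \<in> formulas L X (V <+> M)"
  shows "Kim_divides ind M W \<phi> c \<longleftrightarrow> Kim_divides ind M V \<phi> c"
  using Kim_divides_reindex[OF M(1) small_subset[OF M(2,3)] M(2), of id c c \<phi> X] M(3) \<phi>
  by (simp add: map_sum.id fo_formula.map_id)

lemma holds_inst_rename: "holds \<MM> y (inst c (map_fo_formula (map_sum g id) \<phi>)) = holds \<MM> (y \<circ> g) (inst c \<phi>)"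
  unfolding holds_inst sat_map by (rule sat_cong) (auto split: sum.split)

text \<open>A solution after substitution yields one before it, so inconsistency persists for any
  \<open>g\<close>, even one identifying variables; the converse in
  \<open>Kim_divides_rename\<close> uses injectivity.\<close>

lemma Kim_divides_substitute:
  assumes "Kim_divides ind M V \<phi> b"
  shows "Kim_divides ind M V (map_fo_formula (map_sum g id) \<phi>) b"
  using assms unfolding Kim_divides_def consistent_along_iff holds_inst_rename by blast

lemma consistent_along_rename:
  assumes \<phi>: "\<phi> \<in> formulas L X (V <+> M)" and g: "inj_on g X"
  shows "consistent_along \<MM> R s (map_fo_formula (map_sum g id) \<phi>) \<longleftrightarrow> consistent_along \<MM> R s \<phi>"
proof -
  have "(\<exists>y. \<forall>i\<in>F. holds \<MM> (y \<circ> g) (inst (s i) \<phi>)) \<longleftrightarrow> (\<exists>x. \<forall>i\<in>F. holds \<MM> x (inst (s i) \<phi>))" for F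
  proof
    assume "\<exists>x. \<forall>i\<in>F. holds \<MM> x (inst (s i) \<phi>)"
    then obtain x where x: "\<forall>i\<in>F. holds \<MM> x (inst (s i) \<phi>)" by blast
    have "holds \<MM> ((x \<circ> inv_into X g) \<circ> g) (inst (s i) \<phi>) = holds \<MM> x (inst (s i) \<phi>)" for i
      by (rule holds_cong_on[OF inst_formulas[OF \<phi>]]) (simp add: inv_into_f_f[OF g])
    then show "\<exists>y. \<forall>i\<in>F. holds \<MM> (y \<circ> g) (inst (s i) \<phi>)" using x by blast
  qed blast
  then show ?thesis unfolding consistent_along_iff holds_inst_rename by blast
qed

lemma Kim_divides_rename:
  assumes "\<phi> \<in> formulas L X (V <+> M)" "inj_on g X"
  shows "Kim_divides ind M V (map_fo_formula (map_sum g id) \<phi>) b \<longleftrightarrow> Kim_divides ind M V \<phi> b"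
  unfolding Kim_divides_def consistent_along_rename[OF assms] ..

lemma tp_stab_obtain:
  assumes "small_model M" "small V" "tp L \<MM> M V a = tp L \<MM> M V b"
  obtains \<sigma> where "\<sigma> \<in> stab M" "\<And>v. v \<in> V \<Longrightarrow> \<sigma> (a v) = b v"
  using tp_stabD[OF small_model_small[OF assms(1)] assms(2,3)] by blast

lemma consistent_along_realize:
  assumes "small M" "small W" "small X" "\<phi> \<in> formulas L X (W <+> M)" "consistent_along \<MM> natLeq s \<phi>"
  shows "\<exists>x. \<forall>i. holds \<MM> x (inst (s i) \<phi>)"
proof -
  let ?\<Phi> = "(\<lambda>i. inst (s i) \<phi>) ` UNIV"
  have "?\<Phi> \<subseteq> formulas L X (M \<union> (\<Union>i. s i ` W))"
  proof clarify
    fix i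
    show "inst (s i) \<phi> \<in> formulas L X (M \<union> (\<Union>i. s i ` W))"
      by (rule formulas_mono[OF inst_formulas[OF assms(4)]]) auto
  qed
  moreover have "consistent \<MM> ?\<Phi>" using assms(5) by (simp add: consistent_along_def)
  moreover have "small (M \<union> (\<Union>i. s i ` W))" using assms by (simp add: small_UN_image)
  ultimately obtain x where "\<And>\<psi>. \<psi> \<in> ?\<Phi> \<Longrightarrow> holds \<MM> x \<psi>"
    by (rule realize_consistent[OF _ _ _ assms(3)]) (rule that)
  then show ?thesis by blast
qed

text \<open>Kim-forking is Kim-dividing: along a canonical Morley sequence one disjunct is satisfied infinitely often.\<close>

lemma Kim_divides_disj:
  assumes M: "small_model M" "small W" and X: "small X" and D: "finite D" "D \<subseteq> formulas L X (W <+> M)"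
    "\<And>\<phi>. \<phi> \<in> D \<Longrightarrow> Kim_divides ind M W \<phi> c"
    and \<chi>: "\<chi> \<in> formulas L X (W <+> M)" "\<And>x. holds \<MM> x (inst c \<chi>) \<Longrightarrow> \<exists>\<phi>\<in>D. holds \<MM> x (inst c \<phi>)"
  shows "Kim_divides ind M W \<chi> c"
proof -
  obtain s where s: "Morley (canon M W c) M W natLeq s" using ex_canon_Morley[OF M] by blast
  have "\<not> consistent_along \<MM> natLeq s \<chi>"
  proof
    assume con: "consistent_along \<MM> natLeq s \<chi>"
    then obtain x where x: "\<And>i. holds \<MM> x (inst (s i) \<chi>)"
      using consistent_along_realize[OF small_model_small[OF M(1)] M(2) X \<chi>(1)] by blast
    \<comment> \<open>The implication from \<chi> to the disjunction is known at \<open>c\<close>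
      and is carried to \<open>s i\<close> by an automorphism over \<open>M\<close>.\<close>
    have "\<exists>\<phi>\<in>D. holds \<MM> x (inst (s i) \<phi>)" for i
    proof -
      have "tp L \<MM> M W (s i) = tp L \<MM> M W c" using s canon_Morley_nat_iff[OF M] by auto
      then obtain \<sigma> where \<sigma>: "\<sigma> \<in> stab M" "\<And>v. v \<in> W \<Longrightarrow> \<sigma> (s i v) = c v" using tp_stab_obtain[OF M] by blast
      have "holds \<MM> (\<sigma> \<circ> x) (inst c \<chi>)" using holds_inst_stab[OF \<chi>(1) \<sigma>(1), of c "s i" x] \<sigma>(2) x by simp
      then obtain \<phi> where \<phi>: "\<phi> \<in> D" "holds \<MM> (\<sigma> \<circ> x) (inst c \<phi>)" using \<chi>(2) by blast
      have "\<phi> \<in> formulas L X (W <+> M)" using \<phi>(1) D(2) by blast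
      then have "holds \<MM> x (inst (s i) \<phi>)" using holds_inst_stab[OF _ \<sigma>(1), of \<phi> X W c "s i" x] \<sigma>(2) \<phi>(2) by simp
      then show ?thesis using \<phi>(1) by blast
    qed
    then obtain f where f: "\<And>i. f i \<in> D" "\<And>i. holds \<MM> x (inst (s i) (f i))" by metis
    have "finite (f ` UNIV)" using D(1) f(1) by (meson finite_subset image_subsetI)
    then obtain i0 where i0: "infinite {i. f i = f i0}" using pigeonhole_infinite[OF infinite_UNIV_nat] by auto
    have F: "f i0 \<in> formulas L X (W <+> M)" using f(1) D(2) by blast
    have "consistent_along \<MM> natLeq s (f i0)"
    proof (rule consistent_transfer[OF canon_global[OF M] canon_stab_invariant[OF M] order_refl small_model_small[OF M(1)] M(2)
          s natLeq_Linear_order s natLeq_Linear_order _ i0 F])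
      fix F assume F: "F \<subseteq> {i. f i = f i0}"
      have "\<forall>i\<in>F. holds \<MM> x (inst (s i) (f i0))"
      proof
        fix i assume "i \<in> F"
        then have "f i = f i0" using F by blast
        then show "holds \<MM> x (inst (s i) (f i0))" using f(2)[of i] by simp
      qed
      then show "\<exists>x. \<forall>i\<in>F. holds \<MM> x (inst (s i) (f i0))" by blast
    qed simp
    then show False using Kim_divides_iff[OF M F s] D(3)[OF f(1)] by blast
  qed
  then show ?thesis using Kim_divides_iff[OF M \<chi>(1) s] by blast
qed

text \<open>The formulas of a forking disjunction come with tuples of their own. One tuple
  \<open>c\<close> enumerates all of these jointly with \<open>b\<close>, so that \<chi> and the
  disjuncts become formulas along the same Morley sequence.\<close>

lemma Kim_ind_iff:
  assumes M: "small_model M" "small V" and A: "small A"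
  shows "Kim_ind ind A M (b ` V) \<longleftrightarrow> (\<forall>\<phi>\<in>formulas L A (V <+> M). holds \<MM> id (inst b \<phi>) \<longrightarrow> \<not> Kim_divides ind M V \<phi> b)"
proof
  assume K: "Kim_ind ind A M (b ` V)"
  show "\<forall>\<phi>\<in>formulas L A (V <+> M). holds \<MM> id (inst b \<phi>) \<longrightarrow> \<not> Kim_divides ind M V \<phi> b"
  proof (intro ballI impI notI)
    fix \<phi> assume \<phi>: "\<phi> \<in> formulas L A (V <+> M)" "holds \<MM> id (inst b \<phi>)" "Kim_divides ind M V \<phi> b"
    have "inst b \<phi> \<in> tp L \<MM> (M \<union> b ` V) A id" using \<phi> inst_formulas by (auto simp: tp_def)
    moreover have "Kim_forks ind M A (inst b \<phi>)"
      unfolding Kim_forks_def by (rule exI[of _ "{(V, \<phi>, b)}"]) (use \<phi> M in auto)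
    ultimately show False using K by (auto simp: Kim_ind_def)
  qed
next
  assume *: "\<forall>\<phi>\<in>formulas L A (V <+> M). holds \<MM> id (inst b \<phi>) \<longrightarrow> \<not> Kim_divides ind M V \<phi> b"
  show "Kim_ind ind A M (b ` V)" unfolding Kim_ind_def
  proof (intro ballI notI)
    fix \<chi> assume \<chi>: "\<chi> \<in> tp L \<MM> (M \<union> b ` V) A id" and "Kim_forks ind M A \<chi>"
    then obtain D :: "('k set \<times> ('f, 'r, 'a + ('k + 'a)) fo_formula \<times> ('k \<Rightarrow> 'a)) set" where D: "finite D"
      "\<forall>(V', \<phi>, b')\<in>D. small V' \<and> \<phi> \<in> formulas L A (V' <+> M) \<and> Kim_divides ind M V' \<phi> b'"
      "\<forall>a. holds \<MM> a \<chi> \<longrightarrow> (\<exists>(V', \<phi>, b')\<in>D. holds \<MM> a (inst b' \<phi>))"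
      unfolding Kim_forks_def by (elim exE conjE) (rule that)
    have D2: "small V'" "\<phi> \<in> formulas L A (V' <+> M)" "Kim_divides ind M V' \<phi> b'" if "(V', \<phi>, b') \<in> D" for V' \<phi> b'
      using D(2) that by blast+
    have D3: "\<exists>V' \<phi> b'. (V', \<phi>, b') \<in> D \<and> holds \<MM> a (inst b' \<phi>)" if "holds \<MM> a \<chi>" for a
      using D(3) that by blast
    let ?S = "b ` V \<union> (\<Union>(V', \<phi>, b')\<in>D. b' ` V')"
    have "small (\<Union>(V', \<phi>, b')\<in>D. b' ` V')" by (rule small_UN_finite[OF D(1)]) (use D2(1) in auto)
    then have "small ?S" using M(2) by simp
    then obtain W :: "'k set" and c where W: "small W" "c ` W = ?S" "inj_on c W" by (rule small_enum)
    define f where "f b' = (\<lambda>v. inv_into W c (b' v))" for b' :: "'k \<Rightarrow> 'a"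
    have f: "f b' ` V' \<subseteq> W" "\<And>v. v \<in> V' \<Longrightarrow> c (f b' v) = b' v" if "b' ` V' \<subseteq> ?S" for b' V'
    proof -
      have "b' v \<in> c ` W" if "v \<in> V'" for v using \<open>b' ` V' \<subseteq> ?S\<close> that W(2) by blast
      then show "f b' ` V' \<subseteq> W" "\<And>v. v \<in> V' \<Longrightarrow> c (f b' v) = b' v"
        by (auto simp: f_def inv_into_into f_inv_into_f)
    qed
    define r where "r b' \<phi> = map_fo_formula (map_sum id (map_sum (f b') id)) \<phi>" for b' and \<phi> :: "('f, 'r, 'a + ('k + 'a)) fo_formula"
    have sub: "b' ` V' \<subseteq> ?S" if "(V', \<phi>, b') \<in> D" for V' \<phi> b' using that by blast
    have r: "r b' \<phi> \<in> formulas L A (W <+> M)" "inst c (r b' \<phi>) = inst b' \<phi>"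
      if "b' ` V' \<subseteq> ?S" "\<phi> \<in> formulas L A (V' <+> M)" for b' V' and \<phi> :: "('f, 'r, 'a + ('k + 'a)) fo_formula"
    proof -
      show "r b' \<phi> \<in> formulas L A (W <+> M)"
        unfolding r_def using that(2) by (rule formulas_map) (use f(1)[OF that(1)] in auto)
      show "inst c (r b' \<phi>) = inst b' \<phi>"
        unfolding r_def inst_reindex by (rule inst_cong[OF that(2)]) (use f(2)[OF that(1)] in auto)
    qed
    have "\<chi> \<in> formulas L A (M \<union> b ` V)" using \<chi> by (simp add: tp_def)
    then obtain \<chi>0 where \<chi>0: "\<chi>0 \<in> formulas L A (V <+> M)" "inst b \<chi>0 = \<chi>" using ex_inst by blast
    let ?D = "(\<lambda>(V', \<phi>, b'). r b' \<phi>) ` D"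
    have "Kim_divides ind M W (r b \<chi>0) c"
    proof (rule Kim_divides_disj[OF M(1) W(1) A, of ?D])
      show "finite ?D" using D(1) by simp
      show "?D \<subseteq> formulas L A (W <+> M)" using r(1)[OF sub D2(2)] by auto
      show "Kim_divides ind M W \<phi> c" if "\<phi> \<in> ?D" for \<phi>
      proof -
        obtain V' \<phi>' b' where d: "(V', \<phi>', b') \<in> D" "\<phi> = r b' \<phi>'" using \<open>\<phi> \<in> ?D\<close> by auto
        show ?thesis unfolding d(2) r_def
          using Kim_divides_reindex[where f = "f b'" and c = c and b = b', OF M(1) D2(1)[OF d(1)] W(1) f[OF sub[OF d(1)]] D2(2)[OF d(1)]]
            D2(3)[OF d(1)] by blast
      qed
      show "r b \<chi>0 \<in> formulas L A (W <+> M)" by (rule r(1)[OF _ \<chi>0(1)]) blast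
      have "inst c (r b \<chi>0) = \<chi>" using r(2)[OF _ \<chi>0(1), of b] \<chi>0(2) by blast
      moreover fix x assume "holds \<MM> x (inst c (r b \<chi>0))"
      ultimately obtain V' \<phi> b' where d: "(V', \<phi>, b') \<in> D" "holds \<MM> x (inst b' \<phi>)" using D3[of x] by auto
      then have "holds \<MM> x (inst c (r b' \<phi>))" using r(2)[OF sub[OF d(1)] D2(2)[OF d(1)]] by simp
      then show "\<exists>\<phi>\<in>?D. holds \<MM> x (inst c \<phi>)" using d(1) by force
    qed
    moreover have "f b ` V \<subseteq> W" "\<And>v. v \<in> V \<Longrightarrow> c (f b v) = b v" using f[of b V] by blast+
    ultimately have "Kim_divides ind M V \<chi>0 b"
      unfolding r_def using Kim_divides_reindex[OF M W(1) _ _ \<chi>0(1), of "f b" c b] by blast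
    moreover have "holds \<MM> id (inst b \<chi>0)" using \<chi> \<chi>0(2) by (simp add: tp_def)
    ultimately show False using * \<chi>0(1) by blast
  qed
qed

lemma Kim_ind_mono:
  assumes "Kim_ind ind A M B" "A0 \<subseteq> A" "B0 \<subseteq> B"
  shows "Kim_ind ind A0 M B0"
  unfolding Kim_ind_def
proof (intro ballI notI)
  fix \<chi> assume \<chi>: "\<chi> \<in> tp L \<MM> (M \<union> B0) A0 id" "Kim_forks ind M A0 \<chi>"
  have "\<chi> \<in> tp L \<MM> (M \<union> B) A id" using tp_subset[OF assms(2), of "M \<union> B0" "M \<union> B" id] \<chi>(1) assms(3) by blast
  moreover have "Kim_forks ind M A \<chi>"
  proof -
    obtain D :: "('k set \<times> ('f, 'r, 'a + ('k + 'a)) fo_formula \<times> ('k \<Rightarrow> 'a)) set" where D: "finite D"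
      "\<forall>(V, \<phi>, b)\<in>D. small V \<and> \<phi> \<in> formulas L A0 (V <+> M) \<and> Kim_divides ind M V \<phi> b"
      "\<forall>a. holds \<MM> a \<chi> \<longrightarrow> (\<exists>(V, \<phi>, b)\<in>D. holds \<MM> a (inst b \<phi>))"
      using \<chi>(2) unfolding Kim_forks_def by blast
    have "\<forall>(V, \<phi>, b)\<in>D. small V \<and> \<phi> \<in> formulas L A (V <+> M) \<and> Kim_divides ind M V \<phi> b"
    proof clarify
      fix V \<phi> b assume "(V, \<phi>, b) \<in> D"
      then have "small V \<and> \<phi> \<in> formulas L A0 (V <+> M) \<and> Kim_divides ind M V \<phi> b" using D(2) by blast
      then show "small V \<and> \<phi> \<in> formulas L A (V <+> M) \<and> Kim_divides ind M V \<phi> b"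
        using formulas_mono[OF _ assms(2) order_refl] by blast
    qed
    then show ?thesis unfolding Kim_forks_def using D(1,3) by blast
  qed
  ultimately show False using assms(1) by (auto simp: Kim_ind_def)
qed

text \<open>Were the type of \<open>A\<close> over \<open>M \<union> B\<close> inconsistent with the
  negations of the Kim-dividing formulas over \<open>M \<union> B'\<close>, a formula of that type
  would imply a finite disjunction of them and hence Kim-divide itself. The extended type is
  returned as a conjugate of \<open>A\<close> over \<open>M \<union> B\<close>.\<close>

lemma Kim_ind_extend:
  assumes M: "small_model M" and small: "small A" "small B'" and B: "B \<subseteq> B'" and K: "Kim_ind ind A M B"
  obtains \<sigma> where "\<sigma> \<in> stab (M \<union> B)" "Kim_ind ind (\<sigma> ` A) M B'"
proof -
  obtain W :: "'k set" and c where W: "small W" "c ` W = B'" "inj_on c W" using small(2) by (rule small_enum)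
  define V where "V = {w \<in> W. c w \<in> B}"
  have V: "V \<subseteq> W" "c ` V = B" "small V" using B W(2) small_subset[OF W(1), of V] by (auto simp: V_def)
  note sM = small_model_small[OF M]
  have KV: "\<not> Kim_divides ind M V \<phi> c" if "\<phi> \<in> formulas L A (V <+> M)" "holds \<MM> id (inst c \<phi>)" for \<phi>
    using Kim_ind_iff[OF M V(3) small(1), of c] K that unfolding V(2) by blast
  define D where "D = {\<phi> \<in> formulas L A (W <+> M). Kim_divides ind M W \<phi> c}"
  let ?t = "tp L \<MM> (M \<union> B) A id"
  let ?\<Sigma> = "?t \<union> (\<lambda>\<phi>. Neg (inst c \<phi>)) ` D"
  have "?\<Sigma> \<subseteq> formulas L A (M \<union> B')"
  proof
    fix \<psi> assume "\<psi> \<in> ?\<Sigma>"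
    then show "\<psi> \<in> formulas L A (M \<union> B')"
    proof
      assume "\<psi> \<in> ?t"
      then have "\<psi> \<in> formulas L A (M \<union> B)" by (simp add: tp_def)
      then show ?thesis by (rule formulas_mono) (use B in auto)
    next
      assume "\<psi> \<in> (\<lambda>\<phi>. Neg (inst c \<phi>)) ` D"
      then obtain \<phi> where "\<phi> \<in> D" "\<psi> = Neg (inst c \<phi>)" by blast
      then show ?thesis using inst_formulas[of \<phi> L A W M c] W(2) by (simp add: D_def)
    qed
  qed
  moreover have "consistent \<MM> ?\<Sigma>" unfolding consistent_def
  proof (intro allI impI)
    fix \<Psi> assume \<Psi>: "\<Psi> \<subseteq> ?\<Sigma>" "finite \<Psi>"
    have "finite (\<Psi> - ?t)" "\<Psi> - ?t \<subseteq> (\<lambda>\<phi>. Neg (inst c \<phi>)) ` D" using \<Psi> by auto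
    then obtain D' where D': "D' \<subseteq> D" "finite D'" "\<Psi> - ?t = (\<lambda>\<phi>. Neg (inst c \<phi>)) ` D'"
      by (meson finite_subset_image)
    have "finite (\<Psi> \<inter> ?t)" "\<Psi> \<inter> ?t \<subseteq> formulas L A (M \<union> B)" using \<Psi> by (auto simp: tp_def)
    then obtain \<chi> where \<chi>: "\<chi> \<in> formulas L A (M \<union> B)" "\<And>a. holds \<MM> a \<chi> \<longleftrightarrow> (\<forall>\<psi>\<in>\<Psi> \<inter> ?t. holds \<MM> a \<psi>)"
      by (rule conj_formula) (rule that)
    obtain \<chi>0 where \<chi>0: "\<chi>0 \<in> formulas L A (V <+> M)" "inst c \<chi>0 = \<chi>" using ex_inst[of \<chi> L A M c V] \<chi>(1) V(2) by blast
    show "\<exists>a. \<forall>\<psi>\<in>\<Psi>. holds \<MM> a \<psi>"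
    proof (rule ccontr)
      assume no: "\<not> ?thesis"
      have \<chi>W: "\<chi>0 \<in> formulas L A (W <+> M)" by (rule formulas_mono[OF \<chi>0(1)]) (use V(1) in auto)
      have "Kim_divides ind M W \<chi>0 c"
      proof (rule Kim_divides_disj[OF M W(1) small(1) D'(2) _ _ \<chi>W])
        show "D' \<subseteq> formulas L A (W <+> M)" "\<And>\<phi>. \<phi> \<in> D' \<Longrightarrow> Kim_divides ind M W \<phi> c" using D'(1) by (auto simp: D_def)
        fix x assume "holds \<MM> x (inst c \<chi>0)"
        then have t: "\<forall>\<psi>\<in>\<Psi> \<inter> ?t. holds \<MM> x \<psi>" using \<chi>(2) \<chi>0(2) by simp
        obtain \<psi> where "\<psi> \<in> \<Psi>" "\<not> holds \<MM> x \<psi>" using no by blast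
        then have "\<psi> \<in> (\<lambda>\<phi>. Neg (inst c \<phi>)) ` D'" using t D'(3) by blast
        then show "\<exists>\<phi>\<in>D'. holds \<MM> x (inst c \<phi>)" using \<open>\<not> holds \<MM> x \<psi>\<close> by auto
      qed
      then have "Kim_divides ind M V \<chi>0 c" using Kim_divides_mono[OF M W(1) V(1) \<chi>0(1)] by blast
      moreover have "holds \<MM> id (inst c \<chi>0)" unfolding \<chi>0(2) \<chi>(2) by (simp add: tp_def)
      ultimately show False using KV[OF \<chi>0(1)] by blast
    qed
  qed
  moreover have "small (M \<union> B')" using sM small by simp
  ultimately obtain a where a: "\<And>\<psi>. \<psi> \<in> ?\<Sigma> \<Longrightarrow> holds \<MM> a \<psi>"
    by (rule realize_consistent[OF _ _ _ small(1)]) (rule that)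
  have "?t = tp L \<MM> (M \<union> B) A a" by (rule tp_eq_type[OF type_over_tp]) (use a in \<open>auto simp: tp_def\<close>)
  moreover have "small (M \<union> B)" using sM small_subset[OF small(2) B] by simp
  ultimately obtain \<sigma> where \<sigma>: "\<sigma> \<in> stab (M \<union> B)" "\<And>x. x \<in> A \<Longrightarrow> \<sigma> (id x) = a x"
    using tp_stabD[OF _ small(1)] by blast
  have bij: "bij \<sigma>" using \<sigma>(1) by (rule stab_bij)
  have sA: "small (\<sigma> ` A)" using small by simp
  have "Kim_ind ind (\<sigma> ` A) M (c ` W)"
    unfolding Kim_ind_iff[OF M W(1) sA]
  proof (intro ballI impI notI)
    fix \<phi> assume \<phi>: "\<phi> \<in> formulas L (\<sigma> ` A) (W <+> M)" "holds \<MM> id (inst c \<phi>)" "Kim_divides ind M W \<phi> c"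
    let ?\<phi> = "map_fo_formula (map_sum (inv \<sigma>) id) \<phi>"
    have i: "inv \<sigma> (\<sigma> x) = x" for x using bij by (simp add: bij_is_inj)
    have "inj_on (inv \<sigma>) (\<sigma> ` A)" using i by (auto intro: inj_onI)
    then have "Kim_divides ind M W ?\<phi> c" using Kim_divides_rename[OF \<phi>(1)] \<phi>(3) by blast
    moreover have "?\<phi> \<in> formulas L A (W <+> M)" using \<phi>(1) by (rule formulas_map) (use i in auto)
    ultimately have "Neg (inst c ?\<phi>) \<in> ?\<Sigma>" by (auto simp: D_def)
    then have "\<not> holds \<MM> a (inst c ?\<phi>)" using a by fastforce
    moreover have ai: "a (inv \<sigma> y) = y" if "y \<in> \<sigma> ` A" for y using that \<sigma>(2) i by (metis id_apply imageE)
    have "holds \<MM> a (inst c ?\<phi>) = holds \<MM> id (inst c \<phi>)"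
      unfolding holds_inst sat_map
      by (rule sat_cong) (use \<phi>(1) ai in \<open>auto simp: formulas_def split: sum.split\<close>)
    ultimately show False using \<phi>(2) by blast
  qed
  then show thesis using that[OF \<sigma>(1)] W(2) by simp
qed

text \<open>Exchange of roles: parameters from \<open>A\<close> become variables labelled by
  themselves, and the tuple \<open>t\<close> becomes the parameter. \<open>Kim_ind\<close> uses this
  second reading, types of terms of a sequence the first. Elements of both \<open>M\<close> and
  \<open>A\<close> stay parameters.\<close>

lemma formula_over_flip:
  assumes "\<psi> \<in> formulas L W (M \<union> A)"
  obtains \<phi> where "\<phi> \<in> formulas L A (W <+> M)" "\<And>t. holds \<MM> t \<psi> \<longleftrightarrow> holds \<MM> id (inst t \<phi>)"
proof
  let ?f = "case_sum (\<lambda>w. Inr (Inl w)) (\<lambda>y. if y \<in> M then Inr (Inr y) else Inl y)"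
  show "map_fo_formula ?f \<psi> \<in> formulas L A (W <+> M)" using assms by (rule formulas_map) auto
  show "holds \<MM> t \<psi> \<longleftrightarrow> holds \<MM> id (inst t (map_fo_formula ?f \<psi>))" for t
    unfolding holds_inst sat_map unfolding holds_def by (rule sat_cong) (auto split: sum.split)
qed

lemma formula_unflip:
  assumes "\<phi> \<in> formulas L A (W <+> M)"
  obtains \<psi> where "\<psi> \<in> formulas L W (M \<union> A)" "\<And>t. holds \<MM> t \<psi> \<longleftrightarrow> holds \<MM> id (inst t \<phi>)"
proof
  let ?f = "case_sum Inr (case_sum Inl Inr)"
  show "map_fo_formula ?f \<phi> \<in> formulas L W (M \<union> A)" using assms by (rule formulas_map) auto
  show "holds \<MM> t (map_fo_formula ?f \<phi>) \<longleftrightarrow> holds \<MM> id (inst t \<phi>)" for t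
    unfolding holds_inst holds_map by (rule sat_cong) (auto split: sum.split)
qed

section \<open>Kim-independence through indiscernible sequences\<close>

lemma conj_formula_params:
  assumes "finite \<Psi>" "\<Psi> \<subseteq> formulas L X (V <+> M)"
  obtains \<chi> where "\<chi> \<in> formulas L X (V <+> M)" "\<And>x b. holds \<MM> x (inst b \<chi>) \<longleftrightarrow> (\<forall>\<psi>\<in>\<Psi>. holds \<MM> x (inst b \<psi>))"
proof -
  obtain \<chi> where \<chi>: "wf_formula L 0 \<chi>" "fv \<chi> \<subseteq> (\<Union>\<psi>\<in>\<Psi>. fv \<psi>)"
    "\<forall>\<rho>. sat \<MM> \<rho> [] \<chi> \<longleftrightarrow> (\<forall>\<psi>\<in>\<Psi>. sat \<MM> \<rho> [] \<psi>)"
    using ex_conj[OF assms(1), of L \<MM>] assms(2) universe by (auto simp: formulas_def)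
  have "\<chi> \<in> formulas L X (V <+> M)" using \<chi>(1,2) assms(2) by (auto simp: formulas_def)
  then show thesis using that \<chi>(3) by (auto simp: holds_inst)
qed

text \<open>From left to right, no conjunction of formulas in the type of \<open>A\<close> over
  \<open>M\<close> and \<open>c\<close> Kim-divides, so this type can be satisfied along a whole
  Morley sequence at once; only then is the sequence made indiscernible over
  \<open>M \<union> A\<close>. Conversely, a formula that \<open>A\<close> satisfies at the first
  term is satisfied by \<open>A\<close> at all terms.\<close>

lemma Kim_ind_iff_indiscernible:
  assumes M: "small_model M" "small W" and A: "small A"
  shows "Kim_ind ind A M (c ` W) \<longleftrightarrow>
    (\<exists>s. Morley (canon M W c) M W natLeq s \<and> (\<forall>v\<in>W. s 0 v = c v) \<and> indiscernible L \<MM> (M \<union> A) W natLeq s)"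
proof
  assume K: "Kim_ind ind A M (c ` W)"
  note sM = small_model_small[OF M(1)] and P = canon_global[OF M, of c] canon_stab_invariant[OF M, of c]
  have sMA: "small (M \<union> A)" using sM A by simp
  obtain s0 where s0: "Morley (canon M W c) M W natLeq s0" "\<And>v. v \<in> W \<Longrightarrow> s0 0 v = c v"
    using ex_canon_Morley[OF M] by blast
  define F where "F = {\<phi> \<in> formulas L A (W <+> M). holds \<MM> id (inst c \<phi>)}"
  let ?g = "\<lambda>(i, \<phi>). inst (s0 i) \<phi>"
  let ?S = "\<Union>i. s0 i ` W"
  have "?g ` (UNIV \<times> F) \<subseteq> formulas L A (M \<union> ?S)"
  proof clarify
    fix i :: nat and \<phi> assume "\<phi> \<in> F"
    then have "inst (s0 i) \<phi> \<in> formulas L A (M \<union> s0 i ` W)" using inst_formulas by (auto simp: F_def)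
    then show "inst (s0 i) \<phi> \<in> formulas L A (M \<union> ?S)" by (rule formulas_mono) auto
  qed
  moreover have "consistent \<MM> (?g ` (UNIV \<times> F))" unfolding consistent_def
  proof (intro allI impI)
    fix \<Psi> assume "\<Psi> \<subseteq> ?g ` (UNIV \<times> F)" "finite \<Psi>"
    then obtain Z where Z: "Z \<subseteq> UNIV \<times> F" "finite Z" "\<Psi> = ?g ` Z" by (meson finite_subset_image)
    have "finite (snd ` Z)" "snd ` Z \<subseteq> formulas L A (W <+> M)" using Z by (auto simp: F_def)
    then obtain \<chi> where \<chi>: "\<chi> \<in> formulas L A (W <+> M)" "\<And>x b. holds \<MM> x (inst b \<chi>) \<longleftrightarrow> (\<forall>\<psi>\<in>snd ` Z. holds \<MM> x (inst b \<psi>))"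
      by (rule conj_formula_params) (rule that)
    have "holds \<MM> id (inst c \<chi>)" unfolding \<chi>(2) using Z(1) by (auto simp: F_def)
    then have "\<not> Kim_divides ind M W \<chi> c" using K Kim_ind_iff[OF M A] \<chi>(1) by blast
    then have "consistent_along \<MM> natLeq s0 \<chi>" using Kim_divides_iff[OF M \<chi>(1) s0(1)] by blast
    then obtain x where x: "\<forall>i\<in>fst ` Z. holds \<MM> x (inst (s0 i) \<chi>)"
      using Z(2) unfolding consistent_along_iff by (metis Field_natLeq finite_imageI subset_UNIV)
    have "holds \<MM> x (?g z)" if "z \<in> Z" for z
    proof -
      have "holds \<MM> x (inst (s0 (fst z)) \<chi>)" using x that by blast
      then have "holds \<MM> x (inst (s0 (fst z)) (snd z))" unfolding \<chi>(2) using that by blast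
      then show ?thesis by (simp add: case_prod_unfold)
    qed
    then show "\<exists>a. \<forall>\<psi>\<in>\<Psi>. holds \<MM> a \<psi>" unfolding Z(3) by blast
  qed
  moreover have "small (M \<union> ?S)" using sM M(2) by (simp add: small_UN_image)
  ultimately obtain a where a: "\<And>\<psi>. \<psi> \<in> ?g ` (UNIV \<times> F) \<Longrightarrow> holds \<MM> a \<psi>"
    by (rule realize_consistent[OF _ _ _ A]) (rule that)
  have aF: "holds \<MM> a (inst (s0 i) \<phi>)" if "\<phi> \<in> F" for i \<phi>
  proof -
    have "inst (s0 i) \<phi> \<in> ?g ` (UNIV \<times> F)" by (rule image_eqI[of _ _ "(i, \<phi>)"]) (use that in auto)
    then show ?thesis by (rule a)
  qed
  have "tp L \<MM> (M \<union> c ` W) A id \<subseteq> tp L \<MM> (M \<union> c ` W) A a"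
  proof
    fix \<psi> assume \<psi>: "\<psi> \<in> tp L \<MM> (M \<union> c ` W) A id"
    then obtain \<phi> where \<phi>: "\<phi> \<in> formulas L A (W <+> M)" "inst c \<phi> = \<psi>" using ex_inst[of \<psi> L A M c W] by (auto simp: tp_def)
    then have "\<phi> \<in> F" using \<psi> by (simp add: F_def tp_def)
    then have "holds \<MM> a (inst (s0 0) \<phi>)" by (rule aF)
    moreover have "inst (s0 0) \<phi> = \<psi>" using inst_cong[OF \<phi>(1) s0(2)] \<phi>(2) by simp
    ultimately show "\<psi> \<in> tp L \<MM> (M \<union> c ` W) A a" using \<psi> by (simp add: tp_def)
  qed
  then have "tp L \<MM> (M \<union> c ` W) A a = tp L \<MM> (M \<union> c ` W) A id" using tp_eq_type type_over_tp by metis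
  moreover have "small (M \<union> c ` W)" using sM M(2) by simp
  \<comment> \<open>Moving the solution \<open>a\<close> to \<open>A\<close> itself over
    \<open>M\<close> and \<open>c\<close> gives every term of the moved sequence the type of
    \<open>c\<close> over \<open>M \<union> A\<close>.\<close>
  ultimately obtain \<sigma> where \<sigma>: "\<sigma> \<in> stab (M \<union> c ` W)" "\<And>x. x \<in> A \<Longrightarrow> \<sigma> (a x) = id x"
    using tp_stabD[OF _ A] by blast
  have \<sigma>M: "\<sigma> \<in> stab M" using \<sigma>(1) by (rule stab_mono) auto
  define s1 where "s1 i = \<sigma> \<circ> s0 i" for i
  have s1: "Morley (canon M W c) M W natLeq s1" by (rule Morley_stab[OF P order_refl s0(1) \<sigma>M]) (simp add: s1_def)
  have tp1: "tp L \<MM> (M \<union> A) W (s1 i) = tp L \<MM> (M \<union> A) W c" for i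
  proof -
    have "tp L \<MM> (M \<union> A) W c \<subseteq> tp L \<MM> (M \<union> A) W (s1 i)"
    proof
      fix \<psi> assume \<psi>: "\<psi> \<in> tp L \<MM> (M \<union> A) W c"
      then obtain \<phi> where \<phi>: "\<phi> \<in> formulas L A (W <+> M)" "\<And>t. holds \<MM> t \<psi> \<longleftrightarrow> holds \<MM> id (inst t \<phi>)"
        using formula_over_flip[of \<psi> W M A] by (auto simp: tp_def)
      then have "\<phi> \<in> F" using \<psi> by (simp add: F_def tp_def)
      then have "holds \<MM> a (inst (s0 i) \<phi>)" by (rule aF)
      then have "holds \<MM> (\<sigma> \<circ> a) (inst (s1 i) \<phi>)" using holds_inst_stab[OF \<phi>(1) \<sigma>M, of "s1 i" "s0 i" a] by (simp add: s1_def)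
      moreover have "holds \<MM> (\<sigma> \<circ> a) (inst (s1 i) \<phi>) = holds \<MM> id (inst (s1 i) \<phi>)"
        by (rule holds_cong_on[OF inst_formulas[OF \<phi>(1)]]) (use \<sigma>(2) in simp)
      ultimately have "holds \<MM> (s1 i) \<psi>" using \<phi>(2) by blast
      then show "\<psi> \<in> tp L \<MM> (M \<union> A) W (s1 i)" using \<psi> by (simp add: tp_def)
    qed
    then show ?thesis using tp_eq_type type_over_tp by metis
  qed
  \<comment> \<open>Extraction keeps the type over \<open>M\<close> of the whole sequence and the
    type over \<open>M \<union> A\<close> of single terms, so the result is again Morley and can be
    moved over \<open>M \<union> A\<close> to start with \<open>c\<close>.\<close>
  obtain c' where c': "indiscernible L \<MM> (M \<union> A) W natLeq c'"
    and c'M: "\<And>B. B \<subseteq> M \<union> A \<Longrightarrow> indiscernible L \<MM> B W natLeq s1 \<Longrightarrow> tp L \<MM> B (UNIV \<times> W) (\<lambda>(k, v). c' k v) = tp L \<MM> B (UNIV \<times> W) (\<lambda>(k, v). s1 k v)"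
    and c'0: "\<And>B. B \<subseteq> M \<union> A \<Longrightarrow> (\<And>i. tp L \<MM> B W (s1 i) = tp L \<MM> B W (s1 0)) \<Longrightarrow> tp L \<MM> B W (c' 0) = tp L \<MM> B W (s1 0)"
    using ex_indiscernible_over[OF sMA M(2), of s1] by blast
  have "indiscernible L \<MM> M W natLeq s1" by (rule Morley_indiscernible[OF P order_refl sM M(2) s1])
  then have "tp L \<MM> M (UNIV \<times> W) (\<lambda>(k, v). s1 k v) = tp L \<MM> M (UNIV \<times> W) (\<lambda>(k, v). c' k v)" using c'M by simp
  then obtain \<tau> where \<tau>: "\<tau> \<in> stab M" "\<And>u. u \<in> UNIV \<times> W \<Longrightarrow> \<tau> ((\<lambda>(k, v). s1 k v) u) = (\<lambda>(k, v). c' k v) u"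
    using tp_stabD[OF sM, of "UNIV \<times> W"] M(2) by (metis small_Times small_nat)
  have mor: "Morley (canon M W c) M W natLeq c'"
    by (rule Morley_stab[OF P order_refl s1 \<tau>(1)]) (use \<tau>(2) in force)
  have "tp L \<MM> (M \<union> A) W (c' 0) = tp L \<MM> (M \<union> A) W c" using c'0[OF order_refl] tp1 by simp
  then obtain \<rho> where \<rho>: "\<rho> \<in> stab (M \<union> A)" "\<And>v. v \<in> W \<Longrightarrow> \<rho> (c' 0 v) = c v" using tp_stabD[OF sMA M(2)] by blast
  have \<rho>M: "\<rho> \<in> stab M" using \<rho>(1) by (rule stab_mono) auto
  have "Morley (canon M W c) M W natLeq (\<lambda>i. \<rho> \<circ> c' i)" by (rule Morley_stab[OF P order_refl mor \<rho>M]) simp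
  moreover have "indiscernible L \<MM> (M \<union> A) W natLeq (\<lambda>i. \<rho> \<circ> c' i)"
    using indiscernible_push[OF c' sMA M(2) \<rho>(1)] stab_image[OF \<rho>(1) order_refl] by simp
  ultimately show "\<exists>s. Morley (canon M W c) M W natLeq s \<and> (\<forall>v\<in>W. s 0 v = c v) \<and> indiscernible L \<MM> (M \<union> A) W natLeq s"
    using \<rho>(2) by (intro exI[of _ "\<lambda>i. \<rho> \<circ> c' i"]) auto
next
  assume "\<exists>s. Morley (canon M W c) M W natLeq s \<and> (\<forall>v\<in>W. s 0 v = c v) \<and> indiscernible L \<MM> (M \<union> A) W natLeq s"
  then obtain s where s: "Morley (canon M W c) M W natLeq s" "\<And>v. v \<in> W \<Longrightarrow> s 0 v = c v" "indiscernible L \<MM> (M \<union> A) W natLeq s" by blast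
  show "Kim_ind ind A M (c ` W)" unfolding Kim_ind_iff[OF M A]
  proof (intro ballI impI)
    fix \<phi> assume \<phi>: "\<phi> \<in> formulas L A (W <+> M)" "holds \<MM> id (inst c \<phi>)"
    then obtain \<psi> where \<psi>: "\<psi> \<in> formulas L W (M \<union> A)" "\<And>t. holds \<MM> t \<psi> \<longleftrightarrow> holds \<MM> id (inst t \<phi>)"
      using formula_unflip by blast
    have "holds \<MM> id (inst (s 0) \<phi>)" using \<phi> inst_cong[OF \<phi>(1) s(2)] by simp
    then have "holds \<MM> id (inst (s i) \<phi>)" for i
      using tp_eqD[OF indiscernible_tp[OF s(3), of i 0] \<psi>(1)] \<psi>(2) by simp
    then have "consistent_along \<MM> natLeq s \<phi>" unfolding consistent_along_iff by blast
    then show "\<not> Kim_divides ind M W \<phi> c" using Kim_divides_iff[OF M \<phi>(1) s(1)] by blast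
  qed
qed

lemma Kim_ind_stab:
  assumes M: "small_model M" and small: "small A" "small B" and \<sigma>: "\<sigma> \<in> stab M" and K: "Kim_ind ind A M B"
  shows "Kim_ind ind (\<sigma> ` A) M (\<sigma> ` B)"
proof -
  obtain W :: "'k set" and c where W: "small W" "c ` W = B" using small(2) by (rule small_enum)
  note sM = small_model_small[OF M]
  obtain s where s: "Morley (canon M W c) M W natLeq s" "\<forall>v\<in>W. s 0 v = c v" "indiscernible L \<MM> (M \<union> A) W natLeq s"
    using K Kim_ind_iff_indiscernible[OF M W(1) small(1), of c] W(2) by blast
  have eq: "canon M W (\<sigma> \<circ> c) = canon M W c" using tp_stabI[OF \<sigma>, of W "\<sigma> \<circ> c" c] by simp
  have "Morley (canon M W (\<sigma> \<circ> c)) M W natLeq (\<lambda>i. \<sigma> \<circ> s i)"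
    unfolding eq by (rule Morley_stab[OF canon_global[OF M W(1)] canon_stab_invariant[OF M W(1)] order_refl s(1) \<sigma>]) simp
  moreover have "indiscernible L \<MM> (M \<union> \<sigma> ` A) W natLeq (\<lambda>i. \<sigma> \<circ> s i)"
    using indiscernible_push[OF s(3) _ W(1) \<sigma>] sM small stab_image[OF \<sigma> order_refl] by (simp add: image_Un)
  ultimately have "Kim_ind ind (\<sigma> ` A) M ((\<sigma> \<circ> c) ` W)"
    unfolding Kim_ind_iff_indiscernible[OF M W(1) small_image[OF small(1)]] using s(2) by (intro exI[of _ "\<lambda>i. \<sigma> \<circ> s i"]) auto
  then show ?thesis using W(2) by (metis image_comp)
qed

text \<open>If \<open>q\<close> contains an instance of a formula at \<open>c\<close>, invariance
  puts into \<open>q\<close> the instances at all terms of a canonical Morley sequence, so these are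
  consistent. Both Kim-independences to which symmetry is applied in the first implication arise
  this way, one over \<open>M\<close> and one over the larger model.\<close>

lemma Kim_ind_of_invariant:
  fixes a :: "'x \<Rightarrow> 'a"
  assumes M: "small_model M" and small: "small V" "small B" and q: "global_type L \<MM> V q" "stab_invariant M q"
    and a: "tp L \<MM> (M \<union> B) V a = restrict_type q (M \<union> B)"
  shows "Kim_ind ind (a ` V) M B"
proof -
  obtain W :: "'k set" and c where W: "small W" "c ` W = B" using small(2) by (rule small_enum)
  have "Kim_ind ind (a ` V) M (c ` W)"
    unfolding Kim_ind_iff[OF M W(1) small_image[OF small(1)]]
  proof (intro ballI impI)
    fix \<phi> assume \<phi>: "\<phi> \<in> formulas L (a ` V) (W <+> M)" "holds \<MM> id (inst c \<phi>)"
    \<comment> \<open>\<open>Kim_ind\<close> labels variables by the entries of \<open>a\<close>,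
      whereas \<open>q\<close> uses labels in \<open>V\<close>; \<open>g\<close> translates.\<close>
    define g where "g = inv_into V a"
    have g: "g x \<in> V" "a (g x) = x" if "x \<in> a ` V" for x using that by (simp_all add: g_def inv_into_into f_inv_into_f)
    let ?\<phi> = "map_fo_formula (map_sum g id) \<phi>"
    have F: "?\<phi> \<in> formulas L V (W <+> M)" using \<phi>(1) by (rule formulas_map) (use g in auto)
    have "holds \<MM> a (inst c ?\<phi>) = holds \<MM> id (inst c \<phi>)"
      unfolding holds_inst sat_map by (rule sat_cong) (use \<phi>(1) g in \<open>auto simp: formulas_def split: sum.split\<close>)
    then have "inst c ?\<phi> \<in> tp L \<MM> (M \<union> B) V a" using \<phi>(2) inst_formulas[OF F, of c] W(2) by (simp add: tp_def)
    then have q\<phi>: "inst c ?\<phi> \<in> q" unfolding a by (simp add: restrict_type_def)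
    obtain s where s: "Morley (canon M W c) M W natLeq s" using ex_canon_Morley[OF M W(1)] by blast
    have "inst (s i) ?\<phi> \<in> q" for i
    proof -
      have "tp L \<MM> M W c = tp L \<MM> M W (s i)" using s canon_Morley_nat_iff[OF M W(1)] by simp
      then obtain \<sigma> where "\<sigma> \<in> stab M" "\<And>v. v \<in> W \<Longrightarrow> \<sigma> (c v) = s i v" using tp_stab_obtain[OF M W(1)] by blast
      then show ?thesis using map_inst_stab[OF F, of \<sigma> "s i" c] q(2) q\<phi> unfolding stab_invariant_def by metis
    qed
    then have "consistent_along \<MM> natLeq s ?\<phi>"
      using q(1) unfolding consistent_along_def type_over_def consistent_def by (metis (no_types, lifting) image_subsetI subset_trans)
    then have "\<not> Kim_divides ind M W ?\<phi> c" using Kim_divides_iff[OF M W(1) F s] by blast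
    moreover have "inj_on g (a ` V)" using g(2) by (metis inj_onI)
    ultimately show "\<not> Kim_divides ind M W \<phi> c" using Kim_divides_rename[OF \<phi>(1)] by blast
  qed
  then show ?thesis using W(2) by simp
qed

text \<open>Freedom makes a canonical Morley sequence over \<open>M'\<close> that starts with
  \<open>b\<close> canonical over \<open>M\<close> as well, so the same sequence decides
  Kim-dividing over both models.\<close>

lemma Kim_divides_base_change:
  assumes M: "small_model M" "small_model M'" "M \<subseteq> M'" and V: "small V" and K: "Kim_ind ind M' M (b ` V)"
    and \<phi>: "\<phi> \<in> formulas L X (V <+> M)" "Kim_divides ind M V \<phi> b"
  shows "Kim_divides ind M' V \<phi> b"
proof -
  obtain s where s: "Morley (canon M V b) M V natLeq s" "\<forall>v\<in>V. s 0 v = b v" "indiscernible L \<MM> (M \<union> M') V natLeq s"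
    using K Kim_ind_iff_indiscernible[OF M(1) V small_model_small[OF M(2)], of b] by blast
  have "M \<union> M' = M'" using M(3) by blast
  then have 1: "ind_Morley ind M V label_order (label_seq s)" "starts_with label_order V (label_seq s) b"
    "indiscernible L \<MM> M' V label_order (label_seq s)"
    using canon_Morley_label[OF M(1) V s(1)] starts_with_label[of V s b] s(2) indiscernible_label[OF s(3)] by auto
  obtain t where t: "Morley (canon M' V b) M' V natLeq t" "\<And>v. v \<in> V \<Longrightarrow> t 0 v = b v"
    using ex_canon_Morley[OF M(2) V] by blast
  have 2: "ind_Morley ind M' V label_order (label_seq t)" "starts_with label_order V (label_seq t) b"
    using canon_Morley_label[OF M(2) V t(1)] starts_with_label[of V t b] t(2) by auto
  have "ind_Morley ind M V label_order (label_seq t)"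
    using generalized_freedom[unfolded generalized_freedom_def, rule_format, of M M' V b] M V small_model_elem[OF M] 1 2 by blast
  then have "Morley (canon M V b) M V natLeq t" using ind_Morley_canon[OF M(1) V _ 2(2)] Morley_label by blast
  then have "\<not> consistent_along \<MM> natLeq t \<phi>" using Kim_divides_iff[OF M(1) V \<phi>(1)] \<phi>(2) by blast
  moreover have "\<phi> \<in> formulas L X (V <+> M')" by (rule formulas_mono[OF \<phi>(1)]) (use M(3) in auto)
  ultimately show ?thesis using Kim_divides_iff[OF M(2) V _ t(1)] by blast
qed

section \<open>Symmetry implies the relative Kim's lemma\<close>

lemma symmetric_imp_relative_Kims_lemma:
  assumes sym: "\<And>M A B. small_model M \<Longrightarrow> small A \<Longrightarrow> small B \<Longrightarrow> Kim_ind ind A M B \<Longrightarrow> Kim_ind ind B M A"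
  shows "relative_Kims_lemma ind"
  unfolding relative_Kims_lemma_def
proof (intro allI impI, elim conjE)
  fix M and V :: "'k set" and p :: "('f, 'r, 'k + 'a) fo_formula set"
  assume M: "small_model M" and V: "small V" and p: "type_over L \<MM> M V p"
  note sM = small_model_small[OF M]
  obtain b0 where b0: "tp L \<MM> M V b0 = p" using realize_type[OF p sM V] .
  let ?P = "canon M V b0"
  have "Kim_dividing_ge M V q ?P"
    if q: "invariant_global_type L \<MM> M V q" and qM: "restrict_type q M = restrict_type ?P M" for q
    unfolding Kim_dividing_ge_def
  proof (intro allI ballI impI, elim conjE, rule notI)
    fix b and \<phi> :: "('f, 'r, 'k + ('k + 'a)) fo_formula" and R s
    assume \<phi>: "\<phi> \<in> formulas L UNIV (V <+> M)" and b: "tp L \<MM> M V b = restrict_type ?P M"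
      and div: "\<forall>R s. invariant_Morley M V ?P R s \<and> starts_with R V s b \<longrightarrow> \<not> consistent_along \<MM> R s \<phi>"
      and s: "invariant_Morley M V q R s" and con: "consistent_along \<MM> R s \<phi>"
    have q2: "global_type L \<MM> V q" "stab_invariant M q" using q invariant_global_type_iff[OF sM] by auto
    have qf: "q \<subseteq> formulas L V UNIV" using q2 by (simp add: type_over_def)
    have bp: "tp L \<MM> M V b = tp L \<MM> M V b0" using b canon_restrict[OF M V] by simp
    have KDb: "Kim_divides ind M V \<phi> b"
    proof -
      obtain t where t: "Morley (canon M V b) M V natLeq t" "\<And>v. v \<in> V \<Longrightarrow> t 0 v = b v" using ex_canon_Morley[OF M V] by blast
      have "invariant_Morley M V ?P label_order (label_seq t)"
        using t(1) Morley_label sequence_order_label bp unfolding invariant_Morley_def Morley_def by metis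
      then have "\<not> consistent_along \<MM> label_order (label_seq t) \<phi>" using div starts_with_label[of V t b] t(2) by blast
      then show ?thesis using Kim_divides_iff[OF M V \<phi> t(1)] consistent_along_label by blast
    qed
    \<comment> \<open>The hull makes the base of each realization a model containing the earlier
      terms; these models increase because hulls are monotone.\<close>
    define H where "H A = hull (M \<union> A)" for A
    obtain \<beta> where \<beta>: "\<And>i::nat. tp L \<MM> (H (\<Union>j<i. \<beta> j ` V)) V (\<beta> i) = restrict_type q (H (\<Union>j<i. \<beta> j ` V))"
      using ex_realizing_sequence[OF q2(1) V, of H] sM by (auto simp: H_def)
    have \<beta>M: "Morley q M V natLeq \<beta>"
      unfolding Morley_def
    proof
      fix i
      show "tp L \<MM> (M \<union> before natLeq V \<beta> i) V (\<beta> i) = restrict_type q (M \<union> before natLeq V \<beta> i)"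
        by (rule tp_restrict_mono[OF qf \<beta>]) (use subset_hull in \<open>auto simp: H_def\<close>)
    qed
    have sR: "Morley q M V R s" "Linear_order R" "infinite (Field R)"
      using s by (auto simp: invariant_Morley_def Morley_def sequence_order_def)
    have con\<beta>: "consistent_along \<MM> natLeq \<beta> \<phi>"
      by (rule consistent_transfer[OF q2 order_refl sM V \<beta>M natLeq_Linear_order sR(1,2) order_refl sR(3) \<phi>])
        (use con in \<open>simp add: consistent_along_iff\<close>)
    \<comment> \<open>The variables of \<open>\<phi>\<close> range over all labels, a set that is
      not small; only the finitely many occurring ones have to be realized.\<close>
    define X where "X = Inl -` fv \<phi>"
    have X: "finite X" "\<phi> \<in> formulas L X (V <+> M)" using \<phi> by (auto simp: X_def finite_vimageI formulas_def)
    obtain x where x: "\<And>i. holds \<MM> x (inst (\<beta> i) \<phi>)"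
      using consistent_along_realize[OF sM V small_finite[OF X(1)] X(2) con\<beta>] by blast
    define N where "N i = H (\<Union>j<i. \<beta> j ` V)" for i
    define M' where "M' = (\<Union>i. N i)"
    have monoN: "mono N" unfolding N_def H_def by (intro monoI hull_mono) force
    \<comment> \<open>The union is small because it lies in one small hull; smallness of the pieces
      would not suffice without regularity of \<kappa>.\<close>
    have "M' \<subseteq> hull (M \<union> (\<Union>i. \<beta> i ` V))"
      unfolding M'_def N_def H_def by (intro UN_least hull_mono) auto
    moreover have "small (hull (M \<union> (\<Union>i. \<beta> i ` V)))" using sM V by (simp add: small_UN_image)
    ultimately have sM': "small M'" using small_subset by blast
    have M': "small_model M'"
      unfolding M'_def by (rule Tarski_Vaught_small_model[OF Tarski_Vaught_chain[OF monoN]]) (use sM' in \<open>simp_all add: N_def H_def Tarski_Vaught_hull M'_def\<close>)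
    have MN: "M \<subseteq> N i" "(\<Union>j<i. \<beta> j ` V) \<subseteq> N i" for i
      unfolding N_def H_def using subset_hull[of "M \<union> (\<Union>j<i. \<beta> j ` V)"] by auto
    then have MM': "M \<subseteq> M'" by (auto simp: M'_def)
    have "\<beta> i ` V \<subseteq> M'" for i using MN(2)[of "Suc i"] by (auto simp: M'_def)
    then have \<beta>M': "(\<Union>i. \<beta> i ` V) \<subseteq> M'" by blast
    define A where "A = x ` X"
    have A: "small A" using X(1) by (simp add: A_def)
    obtain q' where q': "average_type \<beta> V q'" by (rule ex_average_type)
    note g' = average_type_global[OF q'] and i' = average_type_invariant[OF q' \<beta>M']
    have q'f: "q' \<subseteq> formulas L V UNIV" using g' by (simp add: type_over_def)
    have "small (M' \<union> A)" using sM' A by simp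
    then obtain b\<omega> where b\<omega>: "tp L \<MM> (M' \<union> A) V b\<omega> = restrict_type q' (M' \<union> A)" using realize_restrict[OF g' _ V] by blast
    have in_q': "holds \<MM> b\<omega> \<psi>" if "\<psi> \<in> q'" "\<psi> \<in> formulas L V (M' \<union> A)" for \<psi>
    proof -
      have "\<psi> \<in> tp L \<MM> (M' \<union> A) V b\<omega>" unfolding b\<omega> restrict_type_formulas[OF q'f] using that by blast
      then show ?thesis by (simp add: tp_def)
    qed
    \<comment> \<open>A formula of \<open>q\<close> over \<open>M'\<close> has its parameters in
      some \<open>N i\<close> and so holds of all later \<open>\<beta> j\<close>; it therefore
      belongs to \<open>q'\<close>. Thus \<open>q\<close> and \<open>q'\<close> agree over
      \<open>M'\<close>, and \<open>b\<omega>\<close> realizes both there.\<close>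
    have "restrict_type q M' = tp L \<MM> M' V b\<omega>"
    proof (rule tp_eq_type)
      show "type_over L \<MM> M' V (restrict_type q M')"
        unfolding restrict_type_formulas[OF qf] by (rule type_over_restrict[OF q2(1)]) simp
      show "restrict_type q M' \<subseteq> tp L \<MM> M' V b\<omega>"
      proof
        fix \<theta> assume "\<theta> \<in> restrict_type q M'"
        then have \<theta>: "\<theta> \<in> q" "\<theta> \<in> formulas L V M'" unfolding restrict_type_formulas[OF qf] by auto
        have "finite (Inr -` fv \<theta>)" "Inr -` fv \<theta> \<subseteq> (\<Union>i. N i)" using \<theta>(2) by (auto simp: finite_vimageI formulas_def M'_def)
        then obtain i where i: "Inr -` fv \<theta> \<subseteq> N i" using finite_subset_chain[OF monoN] by blast
        have \<theta>i: "\<theta> \<in> formulas L V (N i)"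
          using formulas_mono[OF formulas_params[OF \<theta>(2), of "{}"] order_refl, of "N i"] i by simp
        have "holds \<MM> (\<beta> j) \<theta>" if "i < j" for j
        proof -
          have "N i \<subseteq> N j" using monoN that by (simp add: monoD)
          then have "\<theta> \<in> formulas L V (N j)" by (rule formulas_mono[OF \<theta>i order_refl])
          then have "\<theta> \<in> tp L \<MM> (N j) V (\<beta> j)" unfolding N_def \<beta> restrict_type_formulas[OF qf] using \<theta>(1) by (simp add: N_def)
          then show ?thesis by (simp add: tp_def)
        qed
        then have "\<theta> \<in> q'" using \<theta>(1) qf by (intro average_type_eventually[OF q', of _ i]) auto
        then have "holds \<MM> b\<omega> \<theta>" by (rule in_q') (rule formulas_mono[OF \<theta>(2)], auto)
        then show "\<theta> \<in> tp L \<MM> M' V b\<omega>" using \<theta>(2) by (simp add: tp_def)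
      qed
    qed
    then have b\<omega>q: "tp L \<MM> M' V b\<omega> = restrict_type q M'" by simp
    have "M \<union> M' = M'" using MM' by blast
    \<comment> \<open>Over \<open>M\<close> the invariant type used is \<open>q\<close>; symmetry
      then puts \<open>M'\<close> on the left, as base change requires.\<close>
    then have "Kim_ind ind (b\<omega> ` V) M M'" using Kim_ind_of_invariant[OF M V sM' q2, of b\<omega>] b\<omega>q by simp
    then have K1: "Kim_ind ind M' M (b\<omega> ` V)" using sym[OF M _ sM'] V by simp
    have "tp L \<MM> M V b\<omega> = tp L \<MM> M V b" using tp_restrict_mono[OF qf b\<omega>q MM'] qM b by simp
    then have "Kim_divides ind M V \<phi> b\<omega>" using Kim_divides_cong[OF M V \<phi>] KDb by blast
    then have "Kim_divides ind M' V \<phi> b\<omega>" by (rule Kim_divides_base_change[OF M M' MM' V K1 \<phi>])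
    \<comment> \<open>The variables are replaced by the elements of \<open>A\<close> realizing them,
      possibly with repetitions, to match the labelling used by \<open>Kim_ind\<close>.\<close>
    let ?\<phi> = "map_fo_formula (map_sum x id) \<phi>"
    have KD: "Kim_divides ind M' V ?\<phi> b\<omega>" by (rule Kim_divides_substitute) fact
    have F: "?\<phi> \<in> formulas L A (V <+> M)" using X(2) by (rule formulas_map) (auto simp: A_def)
    obtain \<psi> where \<psi>: "\<psi> \<in> formulas L V (M \<union> A)" "\<And>t. holds \<MM> t \<psi> \<longleftrightarrow> holds \<MM> id (inst t ?\<phi>)"
      using formula_unflip[OF F] by blast
    have "holds \<MM> (\<beta> i) \<psi>" for i unfolding \<psi>(2) holds_inst_rename using x by simp
    then have "\<psi> \<in> q'" using formulas_mono[OF \<psi>(1), of V UNIV] by (intro average_type_eventually[OF q', of _ 0]) auto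
    then have "holds \<MM> b\<omega> \<psi>" by (rule in_q') (rule formulas_mono[OF \<psi>(1)], use MM' in auto)
    then have h: "holds \<MM> id (inst b\<omega> ?\<phi>)" using \<psi>(2) by blast
    \<comment> \<open>The same tuple is now read over \<open>M' \<union> A\<close>, as a realization
      of the \<open>M'\<close>-invariant type \<open>q'\<close>.\<close>
    have "Kim_ind ind (b\<omega> ` V) M' A" by (rule Kim_ind_of_invariant[OF M' V A g' i' b\<omega>])
    then have "Kim_ind ind A M' (b\<omega> ` V)" using sym[OF M' _ A] V by simp
    moreover have "?\<phi> \<in> formulas L A (V <+> M')" by (rule formulas_mono[OF F]) (use MM' in auto)
    ultimately show False using Kim_ind_iff[OF M' V A] h KD by blast
  qed
  then show "least_Kim_dividing M V (star ind M V p)"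
    unfolding least_Kim_dividing_def using invariant_global_type_iff[OF sM] canon_global[OF M V] canon_stab_invariant[OF M V] b0 by blast
qed

section \<open>The relative Kim's lemma implies symmetry\<close>

text \<open>The Kim-dividing order speaks of formulas in variables labelled by \<open>'k\<close>, so
  the finitely many variables of \<open>\<phi>\<close> are renamed into labels. It is then applied
  at \<open>t 0\<close>, which has the type of \<open>b\<close>, because the sequence need not start
  with \<open>b\<close>.\<close>

lemma relative_Kims_lemma_inconsistent:
  fixes q :: "('f, 'r, 'k + 'a) fo_formula set"
  assumes RKL: "relative_Kims_lemma ind" and M: "small_model M" "small V" and q: "global_type L \<MM> V q" "stab_invariant M q"
    and b: "tp L \<MM> M V b = restrict_type q M" and \<phi>: "\<phi> \<in> formulas L X (V <+> M)" "Kim_divides ind M V \<phi> b"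
    and t: "Morley q M V natLeq t"
  shows "\<not> consistent_along \<MM> natLeq t \<phi>"
proof -
  note sM = small_model_small[OF M(1)]
  have qf: "q \<subseteq> formulas L V UNIV" using q by (simp add: type_over_def)
  have t0: "tp L \<MM> M V (t 0) = restrict_type q M"
    by (rule tp_restrict_mono[OF qf t[unfolded Morley_def, rule_format, of 0]]) auto
  have "least_Kim_dividing M V (canon M V b)" using RKL M type_over_tp unfolding relative_Kims_lemma_def by blast
  moreover have "invariant_global_type L \<MM> M V q" using q invariant_global_type_iff[OF sM] by blast
  moreover have rq: "restrict_type q M = restrict_type (canon M V b) M" by (rule trans[OF b[symmetric] canon_restrict[OF M, symmetric]])
  ultimately have ge: "Kim_dividing_ge M V q (canon M V b)" unfolding least_Kim_dividing_def by blast
  define X0 where "X0 = Inl -` fv \<phi>"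
  have X0: "finite X0" "\<phi> \<in> formulas L X0 (V <+> M)" using \<phi>(1) by (auto simp: X0_def finite_vimageI formulas_def)
  obtain g :: "'b \<Rightarrow> 'k" where g: "inj_on g X0" using small_inj[OF small_finite[OF X0(1)]] .
  let ?\<phi> = "map_fo_formula (map_sum g id) \<phi>"
  note ren = consistent_along_rename[OF X0(2) g]
  have F: "?\<phi> \<in> formulas L UNIV (V <+> M)" using \<phi>(1) by (rule formulas_map) auto
  obtain u where u: "Morley (canon M V b) M V natLeq u" using ex_canon_Morley[OF M] by blast
  have nc: "\<not> consistent_along \<MM> natLeq u \<phi>" using Kim_divides_iff[OF M \<phi>(1) u] \<phi>(2) by blast
  have "\<not> consistent_along \<MM> R s ?\<phi>" if "invariant_Morley M V (canon M V b) R s" for R s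
  proof
    assume "consistent_along \<MM> R s ?\<phi>"
    then have "consistent_along \<MM> R s \<phi>" using ren by blast
    moreover have "Morley (canon M V b) M V R s" "Linear_order R" "infinite (Field R)"
      using that by (auto simp: invariant_Morley_def Morley_def sequence_order_def)
    ultimately show False using canon_consistent_transfer[OF M u natLeq_Linear_order _ _ _ \<phi>(1)] nc by blast
  qed
  then have "\<forall>R s. invariant_Morley M V q R s \<and> starts_with R V s (t 0) \<longrightarrow> \<not> consistent_along \<MM> R s ?\<phi>"
    using ge F t0 rq unfolding Kim_dividing_ge_def by metis
  moreover have "invariant_Morley M V q label_order (label_seq t)"
    using t Morley_label sequence_order_label unfolding invariant_Morley_def Morley_def by metis
  moreover have "starts_with label_order V (label_seq t) (t 0)" by (rule starts_with_label) simp
  ultimately have "\<not> consistent_along \<MM> label_order (label_seq t) ?\<phi>" by blast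
  then show ?thesis using consistent_along_label ren by blast
qed

text \<open>A sequence witnessing independence from \<open>A\<close> is extracted anew over a Skolem
  hull of \<open>M \<union> A\<close> and moved back onto itself; the image of the hull is the
  model. The bound by \<Lambda> is recorded because a chain of such models will be united.\<close>

lemma Kim_ind_model_extend:
  assumes M: "small_model M" and small: "small A" "small B" and K: "Kim_ind ind A M B"
    and \<Lambda>: "infinite \<Lambda>" "|funs L| \<le>o |\<Lambda>|" "|rels L| \<le>o |\<Lambda>|" "|M \<union> A| \<le>o |\<Lambda>|"
  obtains N where "Tarski_Vaught N" "M \<union> A \<subseteq> N" "Kim_ind ind N M B" "|N| \<le>o |\<Lambda>|"
proof -
  obtain W :: "'k set" and c where W: "small W" "c ` W = B" using small(2) by (rule small_enum)
  note sM = small_model_small[OF M]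
  have sMA: "small (M \<union> A)" using sM small by simp
  obtain s where s: "Morley (canon M W c) M W natLeq s" "\<forall>v\<in>W. s 0 v = c v" "indiscernible L \<MM> (M \<union> A) W natLeq s"
    using K Kim_ind_iff_indiscernible[OF M W(1) small(1), of c] W(2) by blast
  let ?H = "hull (M \<union> A)"
  have sH: "small ?H" using sMA by (rule small_hull)
  obtain c' where c': "indiscernible L \<MM> ?H W natLeq c'"
    and c'M: "\<And>B. B \<subseteq> ?H \<Longrightarrow> indiscernible L \<MM> B W natLeq s \<Longrightarrow> tp L \<MM> B (UNIV \<times> W) (\<lambda>(k, v). c' k v) = tp L \<MM> B (UNIV \<times> W) (\<lambda>(k, v). s k v)"
    by (rule ex_indiscernible_over[OF sH W(1), of s]) (rule that)
  have "small ((UNIV :: nat set) \<times> W)" using W(1) by simp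
  then obtain \<sigma> where \<sigma>: "\<sigma> \<in> stab (M \<union> A)" "\<And>u. u \<in> UNIV \<times> W \<Longrightarrow> \<sigma> ((\<lambda>(k, v). c' k v) u) = (\<lambda>(k, v). s k v) u"
    using tp_stabD[OF sMA _ c'M[OF subset_hull s(3)]] by blast
  let ?N = "\<sigma> ` ?H"
  have MA: "M \<union> A \<subseteq> ?N" using image_mono[OF subset_hull, of \<sigma> "M \<union> A"] stab_image[OF \<sigma>(1) order_refl] by simp
  have "indiscernible L \<MM> ?N W natLeq (\<lambda>i. \<sigma> \<circ> c' i)" by (rule indiscernible_push[OF c' sH W(1) \<sigma>(1)])
  then have "indiscernible L \<MM> ?N W natLeq s" by (rule indiscernible_cong) (use \<sigma>(2) in force)
  moreover have "M \<union> ?N = ?N" using MA by blast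
  ultimately have "Kim_ind ind ?N M (c ` W)"
    unfolding Kim_ind_iff_indiscernible[OF M W(1) small_image[OF sH]] using s(1,2) by auto
  then have K': "Kim_ind ind ?N M B" using W(2) by simp
  have le: "|?N| \<le>o |\<Lambda>|" by (rule ordLeq_transitive[OF card_of_image le_hull[OF \<Lambda>]])
  show thesis by (rule that[OF Tarski_Vaught_stab[OF \<sigma>(1) Tarski_Vaught_hull] MA K' le])
qed

text \<open>The global type \<open>Q\<close> of \<open>n\<close> consecutive terms of canonical Morley sequences is \<open>M\<close>-invariant, and the consecutive
  blocks of length \<open>n\<close> of such a sequence form a Morley sequence of \<open>Q\<close>.\<close>

lemma Kim_ind_chain:
  assumes RKL: "relative_Kims_lemma ind" and M: "small_model M" and small: "small V" "small A"
    and s: "Morley (canon M V c) M V natLeq s" "indiscernible L \<MM> (M \<union> A) V natLeq s"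
  shows "Kim_ind ind A M (\<Union>i. s i ` V)"
proof -
  note sM = small_model_small[OF M]
  let ?P = "canon M V c"
  note P = canon_global[OF M small(1), of c] canon_stab_invariant[OF M small(1), of c]
  have Pf: "?P \<subseteq> formulas L V UNIV" using P by (simp add: type_over_def)
  have sU: "small ((UNIV :: nat set) \<times> V)" using small by simp
  \<comment> \<open>Labels for pairs of a position and an entry, so that a whole sequence becomes
    one labelled tuple \<open>flat r\<close>.\<close>
  obtain g :: "nat \<times> 'k \<Rightarrow> 'k" where g: "inj_on g (UNIV \<times> V)" using small_inj[OF sU] .
  define h where "h = inv_into (UNIV \<times> V) g"
  have hg: "h (g u) = u" if "u \<in> UNIV \<times> V" for u using g that by (simp add: h_def)
  define flat where "flat r = (\<lambda>(i, v). r i v) \<circ> h" for r :: "nat \<Rightarrow> 'k \<Rightarrow> 'a"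
  define W where "W = g ` (UNIV \<times> V)"
  have W: "small W" using sU by (simp add: W_def)
  have flatW: "flat r ` W = (\<Union>i. r i ` V)" for r
  proof -
    have "flat r ` W = (\<lambda>(i, v). r i v) ` (UNIV \<times> V)"
      unfolding W_def flat_def image_image by (rule image_cong) (auto simp: hg)
    then show ?thesis by auto
  qed
  have "Kim_ind ind A M (flat s ` W)"
    unfolding Kim_ind_iff[OF M W small(2)]
  proof (intro ballI impI notI)
    fix \<phi> assume \<phi>: "\<phi> \<in> formulas L A (W <+> M)" "holds \<MM> id (inst (flat s) \<phi>)" "Kim_divides ind M W \<phi> (flat s)"
    \<comment> \<open>Only finitely many positions occur in \<open>\<phi>\<close>; \<open>n\<close>
      exceeds them all, and \<open>Wn\<close> holds the labels of the first block.\<close>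
    have "finite ((\<lambda>w. fst (h w)) ` (\<lambda>w. Inr (Inl w)) -` fv \<phi>)"
      by (intro finite_imageI finite_vimageI) (auto intro: injI)
    then obtain n0 where n0: "\<And>w. Inr (Inl w) \<in> fv \<phi> \<Longrightarrow> fst (h w) < n0"
      unfolding finite_nat_set_iff_bounded by blast
    define n where "n = Suc n0"
    define Wn where "Wn = g ` ({..<n} \<times> V)"
    have Wn: "Wn \<subseteq> W" "small Wn" using small by (auto simp: Wn_def W_def)
    have hWn: "h ` Wn \<subseteq> {..<n} \<times> V" unfolding Wn_def using hg by auto
    have \<phi>n: "\<phi> \<in> formulas L A (Wn <+> M)"
    proof (rule formulasI[OF formulas_wf[OF \<phi>(1)]])
      have "w \<in> Wn" if "Inr (Inl w) \<in> fv \<phi>" for w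
      proof -
        have "w \<in> W" using \<phi>(1) that by (auto simp: formulas_def)
        then obtain i v where iv: "w = g (i, v)" "v \<in> V" by (auto simp: W_def)
        then have "i < n" using n0[OF that] hg[of "(i, v)"] by (simp add: n_def)
        then show ?thesis using iv by (auto simp: Wn_def)
      qed
      then show "fv \<phi> \<subseteq> A <+> (Wn <+> M)" using \<phi>(1) by (fastforce simp: formulas_def)
    qed
    have KD: "Kim_divides ind M Wn \<phi> (flat s)" using Kim_divides_mono[OF M W Wn(1) \<phi>n] \<phi>(3) by blast
    define Q where "Q = {\<psi>. \<exists>B r. small B \<and> \<psi> \<in> formulas L Wn (M \<union> B) \<and> Morley ?P (M \<union> B) V natLeq r \<and> holds \<MM> (flat r) \<psi>}"
    have Qf: "Q \<subseteq> formulas L Wn UNIV"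
    proof
      fix \<psi> assume "\<psi> \<in> Q"
      then obtain B where "\<psi> \<in> formulas L Wn (M \<union> B)" by (auto simp: Q_def)
      then show "\<psi> \<in> formulas L Wn UNIV" by (rule formulas_mono) auto
    qed
    have Qtp: "tp L \<MM> (M \<union> B) Wn (flat r) = restrict_type Q (M \<union> B)" if B: "small B" and r: "Morley ?P (M \<union> B) V natLeq r" for B r
    proof
      show "tp L \<MM> (M \<union> B) Wn (flat r) \<subseteq> restrict_type Q (M \<union> B)"
        unfolding restrict_type_formulas[OF Qf] using B r by (auto simp: tp_def Q_def)
      show "restrict_type Q (M \<union> B) \<subseteq> tp L \<MM> (M \<union> B) Wn (flat r)"
      proof
        fix \<psi> assume "\<psi> \<in> restrict_type Q (M \<union> B)"
        then have \<psi>: "\<psi> \<in> Q" "\<psi> \<in> formulas L Wn (M \<union> B)" unfolding restrict_type_formulas[OF Qf] by auto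
        then obtain B' r' where r': "small B'" "\<psi> \<in> formulas L Wn (M \<union> B')" "Morley ?P (M \<union> B') V natLeq r'" "holds \<MM> (flat r') \<psi>"
          by (auto simp: Q_def)
        \<comment> \<open>A formula over both bases is over their intersection, where the two Morley
          sequences are conjugate.\<close>
        let ?D = "M \<union> (B \<inter> B')"
        have sD: "small ?D" using sM small_subset[OF B, of "B \<inter> B'"] by simp
        have "Morley ?P ?D V natLeq r" by (rule Morley_mono[OF Pf r]) auto
        moreover have "Morley ?P ?D V natLeq r'" by (rule Morley_mono[OF Pf r'(3)]) auto
        ultimately obtain \<sigma> where \<sigma>: "\<sigma> \<in> stab ?D" "\<And>i v. v \<in> V \<Longrightarrow> \<sigma> (r' i v) = r i v"
          using Morley_nat_eq[OF P Un_upper1 sD small(1), of r' r] by blast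
        have F: "\<psi> \<in> formulas L Wn ?D" using \<psi>(2) r'(2) by (fastforce simp: formulas_def)
        have "tp L \<MM> ?D Wn (flat r) = tp L \<MM> ?D Wn (flat r')"
        proof (rule tp_stabI[OF \<sigma>(1)])
          fix w assume "w \<in> Wn"
          then have "h w \<in> {..<n} \<times> V" using hWn by blast
          then show "flat r w = \<sigma> (flat r' w)" using \<sigma>(2) by (auto simp: flat_def)
        qed
        from tp_eqD[OF this F] show "\<psi> \<in> tp L \<MM> (M \<union> B) Wn (flat r)" using r'(4) \<psi>(2) by (simp add: tp_def)
      qed
    qed
    have ex: "\<exists>r. Morley ?P (M \<union> B) V natLeq r" if "small B" for B
      using ex_Morley[OF P(1) small(1), of "M \<union> B"] sM that by auto
    have params: "\<psi> \<in> formulas L Wn (M \<union> Inr -` fv \<psi>)" if "\<psi> \<in> formulas L Wn UNIV" for \<psi> :: "('f, 'r, 'k + 'a) fo_formula"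
      by (rule formulas_params[OF that])
    have sp: "small (Inr -` fv \<psi>)" for \<psi> :: "('f, 'r, 'k + 'a) fo_formula" by (simp add: finite_vimageI)
    have Qglobal: "global_type L \<MM> Wn Q"
      unfolding type_over_def
    proof (intro conjI ballI Qf)
      show "consistent \<MM> Q" unfolding consistent_def
      proof (intro allI impI)
        fix \<Psi> assume \<Psi>: "\<Psi> \<subseteq> Q" "finite \<Psi>"
        let ?B = "\<Union>\<psi>\<in>\<Psi>. Inr -` fv \<psi>"
        have B: "small ?B" using \<Psi>(2) by (simp add: finite_vimageI)
        obtain r where r: "Morley ?P (M \<union> ?B) V natLeq r" using ex[OF B] by blast
        have "holds \<MM> (flat r) \<psi>" if \<psi>: "\<psi> \<in> \<Psi>" for \<psi>
        proof -
          have "\<psi> \<in> formulas L Wn (M \<union> Inr -` fv \<psi>)" using params \<psi> \<Psi>(1) Qf by blast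
          then have "\<psi> \<in> formulas L Wn (M \<union> ?B)" by (rule formulas_mono) (use \<psi> in auto)
          then have "\<psi> \<in> restrict_type Q (M \<union> ?B)"
            unfolding restrict_type_formulas[OF Qf] using \<psi> \<Psi>(1) by blast
          then show ?thesis using Qtp[OF B r] by (auto simp: tp_def)
        qed
        then show "\<exists>a. \<forall>\<psi>\<in>\<Psi>. holds \<MM> a \<psi>" by blast
      qed
      fix \<psi> :: "('f, 'r, 'k + 'a) fo_formula" assume \<psi>: "\<psi> \<in> formulas L Wn UNIV"
      obtain r where r: "Morley ?P (M \<union> Inr -` fv \<psi>) V natLeq r" using ex[OF sp] by blast
      have "Neg \<psi> \<in> formulas L Wn (M \<union> Inr -` fv \<psi>)" using params[OF \<psi>] by simp
      then show "\<psi> \<in> Q \<or> Neg \<psi> \<in> Q"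
        using r sp params[OF \<psi>] unfolding Q_def by (cases "holds \<MM> (flat r) \<psi>") force+
    qed
    have Qinv: "stab_invariant M Q"
      unfolding stab_invariant_def
    proof (intro ballI)
      fix \<sigma> \<psi> assume \<sigma>: "\<sigma> \<in> stab M" and "\<psi> \<in> Q"
      then obtain B r where r: "small B" "\<psi> \<in> formulas L Wn (M \<union> B)" "Morley ?P (M \<union> B) V natLeq r" "holds \<MM> (flat r) \<psi>"
        by (auto simp: Q_def)
      have "Morley ?P (\<sigma> ` (M \<union> B)) V natLeq (\<lambda>i. \<sigma> \<circ> r i)" by (rule Morley_push[OF P r(3) \<sigma>]) simp
      then have 1: "Morley ?P (M \<union> \<sigma> ` B) V natLeq (\<lambda>i. \<sigma> \<circ> r i)" using stab_image[OF \<sigma> order_refl] by (simp add: image_Un)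
      have 2: "map_fo_formula (map_sum id \<sigma>) \<psi> \<in> formulas L Wn (M \<union> \<sigma> ` B)"
        using r(2) by (rule formulas_map) (use stab_fix[OF \<sigma>] in auto)
      have "flat (\<lambda>i. \<sigma> \<circ> r i) = \<sigma> \<circ> flat r" by (auto simp: flat_def fun_eq_iff split: prod.split)
      then have 3: "holds \<MM> (flat (\<lambda>i. \<sigma> \<circ> r i)) (map_fo_formula (map_sum id \<sigma>) \<psi>)"
        using holds_push[OF \<sigma> formulas_wf[OF r(2)]] r(4) by simp
      show "map_fo_formula (map_sum id \<sigma>) \<psi> \<in> Q" unfolding Q_def using 1 2 3 small_image[OF r(1)] by blast
    qed
    define t where "t k = flat (\<lambda>j. s (k * n + j))" for k
    have t: "Morley Q M Wn natLeq t"
      unfolding Morley_def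
    proof
      fix k
      \<comment> \<open>All terms before the \<open>k\<close>-th block. Over \<open>M\<close> and
        these, the terms from position \<open>k * n\<close> on are again a Morley sequence, so
        \<open>t k\<close> realizes \<open>Q\<close> there.\<close>
      let ?B = "\<Union>i<k * n. s i ` V"
      have "Morley ?P (M \<union> ?B) V natLeq (\<lambda>j. s (k * n + j))"
        unfolding Morley_def
      proof
        fix j
        have sub: "(M \<union> ?B) \<union> before natLeq V (\<lambda>j. s (k * n + j)) j \<subseteq> M \<union> before natLeq V s (k * n + j)"
        proof -
          have "?B \<subseteq> before natLeq V s (k * n + j)" unfolding before_nat by (intro UN_mono) auto
          moreover have "before natLeq V (\<lambda>j. s (k * n + j)) j \<subseteq> before natLeq V s (k * n + j)"
            unfolding before_nat by (rule UN_least, rule UN_upper) simp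
          ultimately show ?thesis by blast
        qed
        show "tp L \<MM> ((M \<union> ?B) \<union> before natLeq V (\<lambda>j. s (k * n + j)) j) V (s (k * n + j)) =
          restrict_type ?P ((M \<union> ?B) \<union> before natLeq V (\<lambda>j. s (k * n + j)) j)"
          by (rule tp_restrict_mono[OF Pf s(1)[unfolded Morley_def, rule_format, of "k * n + j"] sub]) simp
      qed
      moreover have "small ?B" using small(1) by (simp add: small_UN_image)
      ultimately have tk: "tp L \<MM> (M \<union> ?B) Wn (t k) = restrict_type Q (M \<union> ?B)" unfolding t_def by (intro Qtp)
      have "t k' ` Wn \<subseteq> ?B" if "k' < k" for k'
      proof
        fix y assume "y \<in> t k' ` Wn"
        then obtain w where w: "w \<in> Wn" "y = t k' w" by blast
        then obtain j v where jv: "h w = (j, v)" "j < n" "v \<in> V" using hWn by blast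
        have "Suc k' * n \<le> k * n" using that by (intro mult_right_mono) auto
        then have "k' * n + j < k * n" using jv(2) by simp
        then show "y \<in> ?B" using w(2) jv by (auto simp: t_def flat_def)
      qed
      then have "M \<union> before natLeq Wn t k \<subseteq> M \<union> ?B" by auto
      then show "tp L \<MM> (M \<union> before natLeq Wn t k) Wn (t k) = restrict_type Q (M \<union> before natLeq Wn t k)"
        by (rule tp_restrict_mono[OF Qf tk])
    qed
    have b: "tp L \<MM> M Wn (flat s) = restrict_type Q M" using Qtp[of "{}" s] s(1) by simp
    \<comment> \<open>\<open>Q\<close> may differ from the canonical extension of the type of a
      block, so it is the relative Kim's lemma that forbids consistency; indiscernibility over
      \<open>M \<union> A\<close> provides it nevertheless, with \<open>A\<close> as common
      solution.\<close>
    have "\<not> consistent_along \<MM> natLeq t \<phi>"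
      by (rule relative_Kims_lemma_inconsistent[OF RKL M Wn(2) Qglobal Qinv b \<phi>n KD t])
    moreover have "holds \<MM> id (inst (t k) \<phi>)" for k
    proof -
      obtain \<psi> where \<psi>: "\<psi> \<in> formulas L Wn (M \<union> A)" "\<And>t. holds \<MM> t \<psi> \<longleftrightarrow> holds \<MM> id (inst t \<phi>)"
        using formula_unflip[OF \<phi>n] by blast
      have "increasing natLeq n (\<lambda>j. j)" "increasing natLeq n (\<lambda>j. k * n + j)" by (auto simp: increasing_nat)
      then have "tp L \<MM> (M \<union> A) ({..<n} \<times> V) (\<lambda>(j, v). s j v) = tp L \<MM> (M \<union> A) ({..<n} \<times> V) (\<lambda>(j, v). s (k * n + j) v)"
        by (rule indiscernibleD[OF s(2)])
      from tp_reindex[OF this hWn] have "tp L \<MM> (M \<union> A) Wn (flat s) = tp L \<MM> (M \<union> A) Wn (t k)"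
        by (simp add: flat_def t_def)
      from tp_eqD[OF this \<psi>(1)] show ?thesis using \<psi>(2) \<phi>(2) by blast
    qed
    then have "consistent_along \<MM> natLeq t \<phi>" unfolding consistent_along_iff by blast
    ultimately show False by blast
  qed
  then show ?thesis by (simp add: flatW)
qed

text \<open>All the work happens along one Morley sequence \<open>s\<close> starting with
  \<open>B\<close>, arranged to be indiscernible over \<open>M \<union> A\<close> and over
  \<open>M\<close> with a conjugate of \<open>N\<close>. By the chain condition that conjugate is
  independent from the whole sequence, so it can be moved over the sequence to become independent
  from \<open>A\<close> too. A further extraction gives indiscernibility over both sets together,
  and finally the moves of \<open>N\<close> are undone.\<close>

lemma Kim_ind_amalgamate:
  assumes RKL: "relative_Kims_lemma ind" and M: "small_model M" and small: "small N" "small A" "small B"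
    and KN: "Kim_ind ind N M B" and KA: "Kim_ind ind A M B"
  obtains \<sigma> where "\<sigma> \<in> stab (M \<union> B)" "Kim_ind ind (N \<union> \<sigma> ` A) M B" "Kim_ind ind N M (\<sigma> ` A)"
proof -
  note sM = small_model_small[OF M]
  obtain V :: "'k set" and b where V: "small V" "b ` V = B" using small(3) by (rule small_enum)
  note P = canon_global[OF M V(1), of b] canon_stab_invariant[OF M V(1), of b]
  obtain s where s: "Morley (canon M V b) M V natLeq s" "\<forall>v\<in>V. s 0 v = b v" "indiscernible L \<MM> (M \<union> A) V natLeq s"
    using KA Kim_ind_iff_indiscernible[OF M V(1) small(2), of b] V(2) by blast
  obtain s' where s': "Morley (canon M V b) M V natLeq s'" "\<forall>v\<in>V. s' 0 v = b v" "indiscernible L \<MM> (M \<union> N) V natLeq s'"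
    using KN Kim_ind_iff_indiscernible[OF M V(1) small(1), of b] V(2) by blast
  \<comment> \<open>Both sequences are canonical, hence conjugate over \<open>M\<close>; as both
    start with \<open>B\<close>, \<tau> fixes \<open>B\<close> too.\<close>
  obtain \<tau> where \<tau>: "\<tau> \<in> stab M" "\<And>i v. v \<in> V \<Longrightarrow> \<tau> (s' i v) = s i v"
    using Morley_nat_eq[OF P order_refl sM V(1) s'(1) s(1)] by blast
  define I where "I = (\<Union>i. s i ` V)"
  have sI: "small I" using V(1) by (simp add: I_def small_UN_image)
  have "B = s 0 ` V" using s(2) V(2) by (auto intro: image_cong)
  then have BI: "B \<subseteq> I" by (auto simp: I_def)
  have "\<tau> x = x" if "x \<in> B" for x using that V(2) \<tau>(2)[of _ 0] s(2) s'(2) by force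
  then have \<tau>B: "\<tau> \<in> stab (M \<union> B)" using \<tau>(1) by (auto simp: stab_def)
  define N2 where "N2 = \<tau> ` N"
  have sN2: "small N2" using small by (simp add: N2_def)
  have "small (M \<union> N)" using sM small by simp
  from indiscernible_push[OF s'(3) this V(1) \<tau>(1)]
  have "indiscernible L \<MM> (M \<union> N2) V natLeq (\<lambda>i. \<tau> \<circ> s' i)"
    using stab_image[OF \<tau>(1) order_refl] by (simp add: image_Un N2_def)
  then have ind2: "indiscernible L \<MM> (M \<union> N2) V natLeq s" by (rule indiscernible_cong) (simp add: \<tau>(2))
  have "Kim_ind ind N2 M I" unfolding I_def by (rule Kim_ind_chain[OF RKL M V(1) sN2 s(1) ind2])
  moreover have "small (I \<union> A)" using sI small by simp
  \<comment> \<open>\<rho> fixes every term of the sequence, so \<open>s\<close> stays indiscernible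
    over the moved set \<open>N3\<close>.\<close>
  ultimately obtain \<rho> where \<rho>: "\<rho> \<in> stab (M \<union> I)" "Kim_ind ind (\<rho> ` N2) M (I \<union> A)"
    using Kim_ind_extend[OF M sN2 _ Un_upper1] by blast
  have \<rho>M: "\<rho> \<in> stab M" using \<rho>(1) by (rule stab_mono) auto
  define N3 where "N3 = \<rho> ` N2"
  have sN3: "small N3" using sN2 by (simp add: N3_def)
  have "small (M \<union> N2)" using sM sN2 by simp
  from indiscernible_push[OF ind2 this V(1) \<rho>(1)]
  have ind3': "indiscernible L \<MM> (M \<union> N3) V natLeq (\<lambda>i. \<rho> \<circ> s i)"
    using stab_image[OF \<rho>M order_refl] by (simp add: image_Un N3_def)
  have "s i v \<in> M \<union> I" if "v \<in> V" for i v using that by (auto simp: I_def)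
  then have "(\<rho> \<circ> s i) v = s i v" if "v \<in> V" for i v using that stab_fix[OF \<rho>(1)] by simp
  then have ind3: "indiscernible L \<MM> (M \<union> N3) V natLeq s" by (intro indiscernible_cong[OF ind3']) simp
  \<comment> \<open>Indiscernible over \<open>M \<union> N3\<close> and over
    \<open>M \<union> A\<close> separately, \<open>s\<close> need not be so over their union. The
    extracted \<open>c\<close> is, and it has the type of \<open>s\<close> over each of the two;
    \<pi> and \<xi> are the automorphisms recording this.\<close>
  let ?C = "M \<union> (N3 \<union> A)"
  have sC: "small ?C" using sM sN3 small by simp
  obtain c where c: "indiscernible L \<MM> ?C V natLeq c"
    and cs: "\<And>B. B \<subseteq> ?C \<Longrightarrow> indiscernible L \<MM> B V natLeq s \<Longrightarrow> tp L \<MM> B (UNIV \<times> V) (\<lambda>(k, v). c k v) = tp L \<MM> B (UNIV \<times> V) (\<lambda>(k, v). s k v)"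
    by (rule ex_indiscernible_over[OF sC V(1), of s]) (rule that)
  have sUV: "small ((UNIV :: nat set) \<times> V)" using V(1) by simp
  have move: "\<exists>\<pi>\<in>stab D. \<forall>i. \<forall>v\<in>V. \<pi> (c i v) = s i v" if D: "D \<subseteq> ?C" "indiscernible L \<MM> D V natLeq s" for D
  proof -
    have "small D" using small_subset[OF sC D(1)] .
    then obtain \<pi> where \<pi>: "\<pi> \<in> stab D" "\<And>u. u \<in> UNIV \<times> V \<Longrightarrow> \<pi> ((\<lambda>(k, v). c k v) u) = (\<lambda>(k, v). s k v) u"
      using tp_stabD[OF _ sUV cs[OF D]] by blast
    then have "\<forall>i. \<forall>v\<in>V. \<pi> (c i v) = s i v" by force
    then show ?thesis using \<pi>(1) by blast
  qed
  have "M \<union> N3 \<subseteq> ?C" "M \<union> A \<subseteq> ?C" by auto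
  then obtain \<pi> \<xi> where \<pi>: "\<pi> \<in> stab (M \<union> N3)" "\<And>i v. v \<in> V \<Longrightarrow> \<pi> (c i v) = s i v"
    and \<xi>: "\<xi> \<in> stab (M \<union> A)" "\<And>i v. v \<in> V \<Longrightarrow> \<xi> (c i v) = s i v"
    using move[OF _ ind3] move[OF _ s(3)] by blast
  have \<pi>M: "\<pi> \<in> stab M" and \<xi>M: "\<xi> \<in> stab M" using stab_mono[OF \<pi>(1)] stab_mono[OF \<xi>(1)] by auto
  have i\<xi>: "inv \<xi> (\<xi> x) = x" for x using stab_bij[OF \<xi>M] by (simp add: bij_is_inj)
  have cM: "Morley (canon M V b) M V natLeq c"
    by (rule Morley_stab[OF P order_refl s(1) stab_inv[OF \<xi>M]]) (simp add: \<xi>(2)[symmetric] i\<xi>)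
  have c0: "tp L \<MM> M V (c 0) = tp L \<MM> M V b" using cM canon_Morley_nat_iff[OF M V(1)] by blast
  then have "Kim_ind ind (N3 \<union> A) M (c 0 ` V)"
    unfolding Kim_ind_iff_indiscernible[OF M V(1), of "N3 \<union> A", simplified, OF conjI[OF sN3 small(2)]]
    using cM c by (intro exI[of _ c]) (simp add: Un_assoc)
  then have "Kim_ind ind (\<pi> ` (N3 \<union> A)) M (\<pi> ` c 0 ` V)"
    using Kim_ind_stab[OF M _ _ \<pi>M] sN3 small(2) V(1) by simp
  moreover have "\<pi> ` c 0 ` V = B" using \<pi>(2) s(2) V(2) by (auto simp: image_image)
  moreover have "\<pi> ` N3 = N3" using stab_image[OF \<pi>(1)] by simp
  ultimately have K1: "Kim_ind ind (N3 \<union> \<pi> ` A) M B" by (simp add: image_Un)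
  have "Kim_ind ind N3 M A" using Kim_ind_mono[OF \<rho>(2)] by (simp add: N3_def)
  from Kim_ind_stab[OF M sN3 small(2) \<pi>M this] have K2: "Kim_ind ind N3 M (\<pi> ` A)" using \<open>\<pi> ` N3 = N3\<close> by simp
  have \<rho>B: "\<rho> \<in> stab (M \<union> B)" using stab_mono[OF \<rho>(1)] BI by blast
  \<comment> \<open>This returns \<open>N3\<close> to \<open>N\<close> while fixing \<open>M\<close>
    and \<open>B\<close>.\<close>
  define \<upsilon> where "\<upsilon> = inv (\<rho> \<circ> \<tau>)"
  have \<rho>\<tau>: "\<rho> \<circ> \<tau> \<in> stab (M \<union> B)" by (rule stab_comp[OF \<rho>B \<tau>B])
  have \<upsilon>: "\<upsilon> \<in> stab (M \<union> B)" unfolding \<upsilon>_def by (rule stab_inv[OF \<rho>\<tau>])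
  have \<upsilon>M: "\<upsilon> \<in> stab M" using \<upsilon> by (rule stab_mono) auto
  have "N3 = (\<rho> \<circ> \<tau>) ` N" by (simp add: N3_def N2_def image_comp)
  then have \<upsilon>N: "\<upsilon> ` N3 = N" unfolding \<upsilon>_def by (simp only: image_inv_f_f[OF bij_is_inj[OF stab_bij[OF \<rho>\<tau>]]])
  have \<upsilon>B: "\<upsilon> ` B = B" using stab_image[OF \<upsilon>] by simp
  \<comment> \<open>Both \<pi> and \<xi> send the first term of \<open>c\<close> to that of
    \<open>s\<close>, so the composite fixes \<open>B\<close>; as \<xi> fixes \<open>A\<close>, the
    composite takes \<open>A\<close> to its image under \<pi>.\<close>
  have \<pi>\<xi>: "\<pi> \<circ> inv \<xi> \<in> stab (M \<union> B)"
  proof -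
    have "\<pi> (inv \<xi> x) = x" if "x \<in> B" for x
    proof -
      have "x \<in> b ` V" using that V(2) by simp
      then obtain v where v: "v \<in> V" "x = s 0 v" using s(2) by auto
      then have "inv \<xi> x = c 0 v" using \<xi>(2)[of v 0] i\<xi> by metis
      then show ?thesis using \<pi>(2) v by simp
    qed
    then show ?thesis using stab_comp[OF \<pi>M stab_inv[OF \<xi>M]] by (auto simp: stab_def)
  qed
  have \<xi>A: "inv \<xi> ` A = A" using stab_image[OF stab_inv[OF \<xi>(1)]] by simp
  define \<sigma> where "\<sigma> = \<upsilon> \<circ> (\<pi> \<circ> inv \<xi>)"
  have \<sigma>: "\<sigma> \<in> stab (M \<union> B)" unfolding \<sigma>_def by (rule stab_comp[OF \<upsilon> \<pi>\<xi>])
  have \<sigma>A: "\<sigma> ` A = \<upsilon> ` \<pi> ` A" unfolding \<sigma>_def using \<xi>A by (metis image_comp)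
  show thesis
  proof (rule that[OF \<sigma>])
    have "small (N3 \<union> \<pi> ` A)" using sN3 small(2) by simp
    from Kim_ind_stab[OF M this small(3) \<upsilon>M K1] show "Kim_ind ind (N \<union> \<sigma> ` A) M B"
      by (simp add: image_Un \<upsilon>N \<upsilon>B \<sigma>A)
    from Kim_ind_stab[OF M sN3 _ \<upsilon>M K2] show "Kim_ind ind N M (\<sigma> ` A)"
      using small(2) by (simp add: \<upsilon>N \<sigma>A)
  qed
qed

text \<open>Independence from \<open>B\<close> is carried along with each model as the hypothesis of
  the next amalgamation. All models are bounded by the same \<Lambda>, which keeps their countable
  union small.\<close>

lemma ex_independent_chain:
  assumes RKL: "relative_Kims_lemma ind" and M: "small_model M" and small: "small A" "small B" and K: "Kim_ind ind A M B"
  obtains N \<sigma> where "\<And>i::nat. Tarski_Vaught (N i)" "small (\<Union>i. N i)" "\<And>i. M \<subseteq> N i" "\<And>i. \<sigma> i \<in> stab (M \<union> B)"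
    "\<And>i. N i \<union> \<sigma> i ` A \<subseteq> N (Suc i)" "\<And>i. Kim_ind ind (N i) M (\<sigma> i ` A)"
proof -
  have "small (M \<union> A)" using small_model_small[OF M] small by simp
  then obtain \<Lambda> :: "(('a + 'f) + ('r + nat)) set" where \<Lambda>: "infinite \<Lambda>" "small \<Lambda>" "|funs L| \<le>o |\<Lambda>|" "|rels L| \<le>o |\<Lambda>|" "|M \<union> A| \<le>o |\<Lambda>|"
    by (rule small_bound)
  interpret infinite_bound \<Lambda> by unfold_locales (rule \<Lambda>)
  let ?P = "\<lambda>N. Tarski_Vaught N \<and> M \<subseteq> N \<and> le N \<and> Kim_ind ind N M B"
  let ?Q = "\<lambda>N N'. \<exists>\<sigma>\<in>stab (M \<union> B). N \<union> \<sigma> ` A \<subseteq> N' \<and> Kim_ind ind N M (\<sigma> ` A)"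
  have init: "\<exists>N. ?P N"
  proof -
    \<comment> \<open>The chain starts from a model around \<open>M\<close> alone, with the empty
      set in the role of \<open>A\<close>.\<close>
    have "Kim_ind ind {} M B" using Kim_ind_mono[OF K] by blast
    moreover have "le (M \<union> {})" by (rule le_subset[OF \<Lambda>(5)]) auto
    ultimately obtain N where "Tarski_Vaught N" "M \<union> {} \<subseteq> N" "Kim_ind ind N M B" "le N"
      using Kim_ind_model_extend[OF M _ small(2) _ \<Lambda>(1,3,4)] small_finite[OF finite.emptyI] by metis
    then show ?thesis by blast
  qed
  have next_model: "\<exists>N'. ?P N' \<and> ?Q N N'" if N: "?P N" for N
  proof -
    have sN: "small N" using small_le[OF \<Lambda>(2)] N by blast
    obtain \<sigma> where \<sigma>: "\<sigma> \<in> stab (M \<union> B)" "Kim_ind ind (N \<union> \<sigma> ` A) M B" "Kim_ind ind N M (\<sigma> ` A)"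
      using Kim_ind_amalgamate[OF RKL M sN small _ K] N by blast
    have "le A" "le M" by (rule le_subset[OF \<Lambda>(5)], blast)+
    then have "le (M \<union> (N \<union> \<sigma> ` A))" using N by (intro le_Un le_image) auto
    moreover have "small (N \<union> \<sigma> ` A)" using sN small by simp
    ultimately obtain N' where N': "Tarski_Vaught N'" "M \<union> (N \<union> \<sigma> ` A) \<subseteq> N'" "Kim_ind ind N' M B" "le N'"
      using Kim_ind_model_extend[OF M _ small(2) \<sigma>(2) \<Lambda>(1,3,4)] by blast
    have "?P N'" using N' by blast
    moreover have "?Q N N'" using \<sigma> N'(2) by (intro bexI[of _ \<sigma>]) auto
    ultimately have "?P N' \<and> ?Q N N'" by (rule conjI)
    then show ?thesis by (rule exI[where P = "\<lambda>N'. ?P N' \<and> ?Q N N'"])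
  qed
  have "\<exists>N. \<forall>i::nat. ?P (N i) \<and> ?Q (N i) (N (Suc i))"
    by (rule dependent_nat_choice[of "\<lambda>_. ?P" "\<lambda>_. ?Q", OF init next_model])
  then obtain N where "\<forall>i::nat. ?P (N i) \<and> ?Q (N i) (N (Suc i))" by (rule exE)
  then have N: "?P (N i)" "?Q (N i) (N (Suc i))" for i by (simp_all only:)
  obtain \<sigma> where \<sigma>: "\<And>i. \<sigma> i \<in> stab (M \<union> B) \<and> N i \<union> \<sigma> i ` A \<subseteq> N (Suc i) \<and> Kim_ind ind (N i) M (\<sigma> i ` A)"
    using N(2) by metis
  have "le (N i)" for i using N(1) by blast
  then have "le (\<Union>i. N i)" by (intro le_UN[OF le_nat])
  then have "small (\<Union>i. N i)" by (rule small_le[OF \<Lambda>(2)])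
  then show thesis using that[of N \<sigma>] N \<sigma> by blast
qed

lemma relative_Kims_lemma_imp_symmetric:
  assumes RKL: "relative_Kims_lemma ind" and M: "small_model M" and small: "small A" "small B" and K: "Kim_ind ind A M B"
  shows "Kim_ind ind B M A"
proof (rule ccontr)
  assume nK: "\<not> Kim_ind ind B M A"
  note sM = small_model_small[OF M]
  obtain V :: "'k set" and \<alpha> where V: "small V" "\<alpha> ` V = A" using small(1) by (rule small_enum)
  obtain \<phi> where \<phi>: "\<phi> \<in> formulas L B (V <+> M)" "holds \<MM> id (inst \<alpha> \<phi>)" "Kim_divides ind M V \<phi> \<alpha>"
    using nK Kim_ind_iff[OF M V(1) small(2), of \<alpha>] V(2) by blast
  obtain N \<sigma> where Tarski_Vaught_N: "\<And>i::nat. Tarski_Vaught (N i)" and sM': "small (\<Union>i. N i)" and MN: "\<And>i. M \<subseteq> N i" and \<sigma>: "\<And>i. \<sigma> i \<in> stab (M \<union> B)"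
    and step: "\<And>i. N i \<union> \<sigma> i ` A \<subseteq> N (Suc i)" and KN: "\<And>i. Kim_ind ind (N i) M (\<sigma> i ` A)"
    using ex_independent_chain[OF RKL M small K] by blast
  have monoN: "mono N" unfolding mono_iff_le_Suc using step by blast
  define M' where "M' = (\<Union>i. N i)"
  have M': "small_model M'" unfolding M'_def by (rule Tarski_Vaught_small_model[OF Tarski_Vaught_chain[OF monoN Tarski_Vaught_N] sM'])
  note sM' = sM'[folded M'_def]
  have MM': "M \<subseteq> M'" using MN by (auto simp: M'_def)
  define a where "a i = \<sigma> i \<circ> \<alpha>" for i
  have aV: "a i ` V = \<sigma> i ` A" for i unfolding V(2)[symmetric] a_def by (simp add: image_image)
  have "a i ` V \<subseteq> M'" for i using step[of i] unfolding aV M'_def by blast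
  then have aM': "(\<Union>i. a i ` V) \<subseteq> M'" by blast
  have \<sigma>M: "\<sigma> i \<in> stab M" for i using \<sigma> by (rule stab_mono) auto
  have atp: "tp L \<MM> M V (a i) = tp L \<MM> M V \<alpha>" for i by (rule tp_stabI[OF \<sigma>M]) (simp add: a_def)
  \<comment> \<open>Each \<open>\<sigma> i\<close> fixes \<open>B\<close> pointwise, so
    \<open>B\<close> still satisfies the formula at the moved copies of \<open>A\<close>.\<close>
  have a\<phi>: "holds \<MM> id (inst (a i) \<phi>)" for i
  proof -
    have "holds \<MM> (\<sigma> i \<circ> id) (inst (a i) \<phi>)" using holds_inst_stab[OF \<phi>(1) \<sigma>M, of "a i" i \<alpha> id] \<phi>(2) by (simp add: a_def)
    moreover have "holds \<MM> (\<sigma> i \<circ> id) (inst (a i) \<phi>) = holds \<MM> id (inst (a i) \<phi>)"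
      by (rule holds_cong_on[OF inst_formulas[OF \<phi>(1)]]) (use stab_fix[OF \<sigma>] in simp)
    ultimately show ?thesis by blast
  qed
  obtain q where q: "average_type a V q" by (rule ex_average_type)
  note g = average_type_global[OF q] and i = average_type_invariant[OF q aM']
  have qf: "q \<subseteq> formulas L V UNIV" using g by (simp add: type_over_def)
  obtain a\<omega> where a\<omega>: "tp L \<MM> M' V a\<omega> = restrict_type q M'" using realize_restrict[OF g sM' V(1)] .
  have a\<omega>_iff: "holds \<MM> a\<omega> \<psi> \<longleftrightarrow> \<psi> \<in> q" if "\<psi> \<in> formulas L V M'" for \<psi>
  proof -
    have "\<psi> \<in> tp L \<MM> M' V a\<omega> \<longleftrightarrow> \<psi> \<in> q" unfolding a\<omega> restrict_type_formulas[OF qf] using that by blast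
    then show ?thesis using that by (simp add: tp_def)
  qed
  have "tp L \<MM> M V \<alpha> \<subseteq> tp L \<MM> M V a\<omega>"
  proof
    fix \<psi> assume \<psi>: "\<psi> \<in> tp L \<MM> M V \<alpha>"
    then have F: "\<psi> \<in> formulas L V M" by (simp add: tp_def)
    have "holds \<MM> (a i) \<psi>" for i using tp_eqD[OF atp F] \<psi> by (simp add: tp_def)
    then have "\<psi> \<in> q" using formulas_mono[OF F, of V UNIV] by (intro average_type_eventually[OF q, of _ 0]) auto
    then show "\<psi> \<in> tp L \<MM> M V a\<omega>" using a\<omega>_iff formulas_mono[OF F order_refl MM'] F by (simp add: tp_def)
  qed
  then have tp\<omega>: "tp L \<MM> M V \<alpha> = tp L \<MM> M V a\<omega>" by (rule tp_eq_type[OF type_over_tp])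
  \<comment> \<open>A formula against this independence has its \<open>M'\<close>-variables in some
    \<open>N m\<close>, and averaging makes it hold at \<open>a j\<close> for some
    \<open>j > m\<close>; but \<open>N j\<close> contains \<open>N m\<close> and is independent from
    \<open>a j\<close>.\<close>
  have K\<omega>: "Kim_ind ind M' M (a\<omega> ` V)"
    unfolding Kim_ind_iff[OF M V(1) sM']
  proof (intro ballI impI notI)
    fix \<theta> assume \<theta>: "\<theta> \<in> formulas L M' (V <+> M)" "holds \<MM> id (inst a\<omega> \<theta>)" "Kim_divides ind M V \<theta> a\<omega>"
    obtain \<psi> where \<psi>: "\<psi> \<in> formulas L V (M \<union> M')" "\<And>t. holds \<MM> t \<psi> \<longleftrightarrow> holds \<MM> id (inst t \<theta>)"
      using formula_unflip[OF \<theta>(1)] by blast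
    have "M \<union> M' = M'" using MM' by blast
    then have "\<psi> \<in> q" using a\<omega>_iff[of \<psi>] \<psi>(1) \<psi>(2)[of a\<omega>] \<theta>(2) by simp
    have "finite (Inl -` fv \<theta>)" "Inl -` fv \<theta> \<subseteq> (\<Union>i. N i)" using \<theta>(1) by (auto simp: finite_vimageI formulas_def M'_def)
    then obtain m where m: "Inl -` fv \<theta> \<subseteq> N m" using finite_subset_chain[OF monoN] by blast
    obtain j where j: "m < j" "holds \<MM> (a j) \<psi>" using average_type_obtain[OF q \<open>\<psi> \<in> q\<close>] by blast
    have "Inl -` fv \<theta> \<subseteq> N j" using m monoN j(1) by (meson less_imp_le monoD order_trans)
    then have F: "\<theta> \<in> formulas L (N j) (V <+> M)" using \<theta>(1) by (fastforce simp: formulas_def)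
    have "small (N j)" by (rule small_subset[OF sM']) (auto simp: M'_def)
    then have "\<not> Kim_divides ind M V \<theta> (a j)" using Kim_ind_iff[OF M V(1), of "N j" "a j"] KN[of j] F j(2) \<psi>(2) unfolding aV by blast
    then show False using Kim_divides_cong[OF M V(1) F, of "a j" a\<omega>] atp tp\<omega> \<theta>(3) by simp
  qed
  have "Kim_divides ind M V \<phi> a\<omega>" using Kim_divides_cong[OF M V(1) \<phi>(1) tp\<omega>] \<phi>(3) by blast
  then have KD: "Kim_divides ind M' V \<phi> a\<omega>" by (rule Kim_divides_base_change[OF M M' MM' V(1) K\<omega> \<phi>(1)])
  have \<phi>M': "\<phi> \<in> formulas L B (V <+> M')" by (rule formulas_mono[OF \<phi>(1)]) (use MM' in auto)
  obtain \<psi> where \<psi>: "\<psi> \<in> formulas L V (M \<union> B)" "\<And>t. holds \<MM> t \<psi> \<longleftrightarrow> holds \<MM> id (inst t \<phi>)"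
    using formula_unflip[OF \<phi>(1)] by blast
  have \<psi>q: "\<psi> \<in> q" using formulas_mono[OF \<psi>(1), of V UNIV] a\<phi> \<psi>(2) by (intro average_type_eventually[OF q, of _ 0]) auto
  have "small (M' \<union> B)" using sM' small by simp
  \<comment> \<open>Taking the Morley sequence over \<open>B\<close> as well makes \<open>B\<close>
    itself a common solution of the instances along it.\<close>
  then obtain t where t: "Morley q (M' \<union> B) V natLeq t" using ex_Morley[OF g V(1)] by blast
  have "holds \<MM> id (inst (t i) \<phi>)" for i
  proof -
    have "tp L \<MM> (M \<union> B) V (t i) = restrict_type q (M \<union> B)"
      by (rule tp_restrict_mono[OF qf t[unfolded Morley_def, rule_format, of i]]) (use MM' in auto)
    then have "\<psi> \<in> tp L \<MM> (M \<union> B) V (t i)" unfolding restrict_type_formulas[OF qf] using \<psi>q \<psi>(1) by blast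
    then show ?thesis using \<psi>(2) by (simp add: tp_def)
  qed
  then have "consistent_along \<MM> natLeq t \<phi>" unfolding consistent_along_iff by blast
  moreover have "Morley q M' V natLeq t" by (rule Morley_mono[OF qf t]) auto
  ultimately show False
    using relative_Kims_lemma_inconsistent[OF RKL M' V(1) g i a\<omega> \<phi>M' KD] by blast
qed

end

theorem theorem3p8:
  fixes L :: "('f, 'r) lang"
    and T :: "('f, 'r, nat) fo_formula set"
    and \<kappa> :: "'k rel"
    and \<MM> :: "('f, 'r, 'a) struct"
    and ind :: "'a set \<Rightarrow> 'a set \<Rightarrow> 'a set \<Rightarrow> bool"
  assumes "monster L T \<kappa> \<MM>"
    and "monster.invariance L \<kappa> \<MM> ind"
    and "monster.monotonicity L \<kappa> \<MM> ind"
    and "monster.full_existence L \<kappa> \<MM> ind"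
    and "monster.full_stationarity L \<kappa> \<MM> ind"
    and "monster.generalized_freedom L \<kappa> \<MM> ind"
  shows "monster.relative_Kims_lemma L \<kappa> \<MM> ind \<longleftrightarrow>
    (\<forall>M a b. monster.small_model L \<kappa> \<MM> M \<and> monster.small \<kappa> a \<and> monster.small \<kappa> b \<longrightarrow>
       (monster.Kim_ind L \<kappa> \<MM> ind a M b \<longleftrightarrow> monster.Kim_ind L \<kappa> \<MM> ind b M a))"
proof -
  interpret independence L T \<kappa> \<MM> ind
    using assms by (simp add: independence_def independence_axioms_def)
  show ?thesis
    using symmetric_imp_relative_Kims_lemma relative_Kims_lemma_imp_symmetric by blast
qed

end
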